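(* Let $(A,\mathfrak m)$ be a Noetherian local ring and $M$ a finitely generated $A$-module such that $\operatorname{depth}_A M>0$. Assume that there exist two submodules $N$ and $L$ of $M$ such that (1) $N\subseteq L\subseteq N:_M\mathfrak m$, (2) $\mathfrak m N\neq\mathfrak m L$, and (3) $\operatorname{pd}_A N<\infty$. Then $A$ is a regular local ring.
   Context: $N:_M\mathfrak m=\{x\in M:\mathfrak m x\subseteq N\}$, and $\operatorname{pd}_A$ denotes projective dimension. *)

theory Defs
  imports
    "HOL-Algebra.Module"
    "HOL-Algebra.Ring_Divisibility"
    "HOL-Library.Extended_Nat"
begin

locale noetherian_local_ring = cring A + noetherian_ring A + maximalideal \<mm> A
  for A (structure) and \<mm> +
  assumes maximal_unique: "maximalideal J A \<Longrightarrow> J = \<mm>"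

definition krull_dim :: "('a, 'r) ring_scheme \<Rightarrow> enat" where
  "krull_dim A = Sup {enat n | n. \<exists>P :: nat \<Rightarrow> 'a set.
     (\<forall>i\<le>n. primeideal (P i) A) \<and> (\<forall>i<n. P i \<subset> P (Suc i))}"

definition embdim :: "('a, 'r) ring_scheme \<Rightarrow> 'a set \<Rightarrow> nat" where
  "embdim A \<mm> = (LEAST n. \<exists>S \<subseteq> carrier A. finite S \<and> card S = n \<and> \<mm> = Idl\<^bsub>A\<^esub> S)"

definition regular_local_ring :: "('a, 'r) ring_scheme \<Rightarrow> 'a set \<Rightarrow> bool" where
  "regular_local_ring A \<mm> \<longleftrightarrow>
     noetherian_local_ring A \<mm> \<and> krull_dim A = enat (embdim A \<mm>)"

definition gen_submodule ::
    "('a, 'r) ring_scheme \<Rightarrow> ('a, 'b, 'm) module_scheme \<Rightarrow> 'b set \<Rightarrow> 'b set" where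
  "gen_submodule R M S = \<Inter>{H. submodule H R M \<and> S \<subseteq> H}"

definition fin_gen_module ::
    "('a, 'r) ring_scheme \<Rightarrow> ('a, 'b, 'm) module_scheme \<Rightarrow> bool" where
  "fin_gen_module R M \<longleftrightarrow>
     module R M \<and> (\<exists>S \<subseteq> carrier M. finite S \<and> carrier M = gen_submodule R M S)"

definition ideal_smult ::
    "('a, 'r) ring_scheme \<Rightarrow> ('a, 'b, 'm) module_scheme \<Rightarrow> 'a set \<Rightarrow> 'b set \<Rightarrow> 'b set" where
  "ideal_smult R M I N = gen_submodule R M {a \<odot>\<^bsub>M\<^esub> x | a x. a \<in> I \<and> x \<in> N}"

definition colon ::
    "('a, 'b, 'm) module_scheme \<Rightarrow> 'b set \<Rightarrow> 'a set \<Rightarrow> 'b set" where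
  "colon M N I = {x \<in> carrier M. \<forall>a \<in> I. a \<odot>\<^bsub>M\<^esub> x \<in> N}"

text \<open>
  The condition on \<open>xs ! i\<close> says that it is a nonzerodivisor on
  \<open>M / (xs ! 0, \<dots>, xs ! (i - 1)) M\<close>, spelled out without the quotient module.
\<close>

definition regular_sequence ::
    "('a, 'r) ring_scheme \<Rightarrow> ('a, 'b, 'm) module_scheme \<Rightarrow> 'a list \<Rightarrow> bool" where
  "regular_sequence R M xs \<longleftrightarrow>
     set xs \<subseteq> carrier R \<and>
     (\<forall>i < length xs. \<forall>y \<in> carrier M.
        xs ! i \<odot>\<^bsub>M\<^esub> y \<in> ideal_smult R M (Idl\<^bsub>R\<^esub> (set (take i xs))) (carrier M) \<longrightarrow>
        y \<in> ideal_smult R M (Idl\<^bsub>R\<^esub> (set (take i xs))) (carrier M)) \<and>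
     ideal_smult R M (Idl\<^bsub>R\<^esub> (set xs)) (carrier M) \<noteq> carrier M"

text \<open>
  The first branch is the convention that the depth is infinite if \<open>\<mm> M = M\<close>; over a
  local ring with \<open>M\<close> finitely generated this means \<open>M = 0\<close>.
\<close>

definition depth ::
    "('a, 'r) ring_scheme \<Rightarrow> 'a set \<Rightarrow> ('a, 'b, 'm) module_scheme \<Rightarrow> enat" where
  "depth A \<mm> M =
     (if ideal_smult A M \<mm> (carrier M) = carrier M then \<infinity>
      else Sup {enat (length xs) | xs. set xs \<subseteq> \<mm> \<and> regular_sequence A M xs})"

definition mod_hom ::
    "('a, 'r) ring_scheme \<Rightarrow> ('a, 'b, 'm) module_scheme \<Rightarrow> ('a, 'c, 'n) module_scheme
      \<Rightarrow> ('b \<Rightarrow> 'c) set" where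
  "mod_hom R M N = {f \<in> carrier M \<rightarrow> carrier N.
     (\<forall>x \<in> carrier M. \<forall>y \<in> carrier M. f (x \<oplus>\<^bsub>M\<^esub> y) = f x \<oplus>\<^bsub>N\<^esub> f y) \<and>
     (\<forall>a \<in> carrier R. \<forall>x \<in> carrier M. f (a \<odot>\<^bsub>M\<^esub> x) = a \<odot>\<^bsub>N\<^esub> f x)}"

definition mod_ker ::
    "('a, 'b, 'm) module_scheme \<Rightarrow> ('a, 'c, 'n) module_scheme \<Rightarrow> ('b \<Rightarrow> 'c) \<Rightarrow> 'b set" where
  "mod_ker M N f = {x \<in> carrier M. f x = \<zero>\<^bsub>N\<^esub>}"

text \<open>
  The lifting property. HOL cannot quantify over the types of \<open>E\<close> and \<open>F\<close> inside a
  definition, so two types are fixed. This is no restriction: they contain the surjection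
  onto \<open>F = P\<close> from the free module \<open>E\<close> on the set \<open>carrier P\<close>, consisting of the finitely
  supported functions \<open>'c \<Rightarrow> 'a\<close>. A lift of the identity along it makes \<open>P\<close> a direct
  summand of \<open>E\<close>, and hence gives lifts along surjections between modules of any type.
\<close>

definition projective_module ::
    "('a, 'r) ring_scheme \<Rightarrow> ('a, 'c) module \<Rightarrow> bool" where
  "projective_module R P \<longleftrightarrow> module R P \<and>
     (\<forall>(E :: ('a, 'c \<Rightarrow> 'a) module) (F :: ('a, 'c) module) g f.
        module R E \<longrightarrow> module R F \<longrightarrow>
        g \<in> mod_hom R E F \<longrightarrow> g ` carrier E = carrier F \<longrightarrow> f \<in> mod_hom R P F \<longrightarrow>
        (\<exists>h \<in> mod_hom R P E. \<forall>x \<in> carrier P. g (h x) = f x))"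

text \<open>
  The resolution \<open>\<dots> \<rightarrow> P 2 \<rightarrow> P 1 \<rightarrow> P 0 \<rightarrow> N \<rightarrow> 0\<close> has differentials
  \<open>d i : P (i + 1) \<rightarrow> P i\<close> and augmentation \<open>e : P 0 \<rightarrow> N\<close>.
\<close>

definition projective_resolution ::
    "('a, 'r) ring_scheme \<Rightarrow> ('a, 'b, 'm) module_scheme \<Rightarrow> (nat \<Rightarrow> ('a, 'c) module)
      \<Rightarrow> (nat \<Rightarrow> 'c \<Rightarrow> 'c) \<Rightarrow> ('c \<Rightarrow> 'b) \<Rightarrow> bool" where
  "projective_resolution R N P d e \<longleftrightarrow>
     (\<forall>i. projective_module R (P i)) \<and>
     (\<forall>i. d i \<in> mod_hom R (P (Suc i)) (P i)) \<and>
     e \<in> mod_hom R (P 0) N \<and>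
     e ` carrier (P 0) = carrier N \<and>
     mod_ker (P 0) N e = d 0 ` carrier (P (Suc 0)) \<and>
     (\<forall>i. mod_ker (P (Suc i)) (P i) (d i) = d (Suc i) ` carrier (P (Suc (Suc i))))"

text \<open>
  The modules of a resolution again need a fixed type. The type below suffices for modules
  \<open>N\<close> of type \<open>'b\<close> over rings \<open>R\<close> of type \<open>'a\<close>: if \<open>R\<close> is not the zero ring, the free module
  on \<open>nat \<times> carrier R \<times> carrier N\<close> has the same cardinality as its basis, so it maps onto
  \<open>N\<close> and onto each of its own submodules. Hence \<open>N\<close> has a free resolution in this type,
  and if \<open>N\<close> has a projective resolution of length \<open>n\<close> in any type, then by Schanuel's
  lemma this free resolution may be cut off at its \<open>n\<close>-th syzygy.
\<close>

type_synonym ('a, 'b) res_carrier = "nat \<times> 'a \<times> 'b \<Rightarrow> 'a"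

text \<open>The projective dimension of the zero module comes out as \<open>0\<close> rather than
  \<open>- \<infinity>\<close>.\<close>

definition proj_dim ::
    "('a, 'r) ring_scheme \<Rightarrow> ('a, 'b, 'm) module_scheme \<Rightarrow> enat" where
  "proj_dim R N = Inf {enat n | n.
     \<exists>(P :: nat \<Rightarrow> ('a, ('a, 'b) res_carrier) module) d e.
       projective_resolution R N P d e \<and> (\<forall>i>n. carrier (P i) = {\<zero>\<^bsub>P i\<^esub>})}"

end

theory Submission
  imports Defs
begin

text \<open>
Some \<open>x \<in> \<mm>\<close> and \<open>u \<in> L\<close> satisfy \<open>x u \<notin> \<mm> N\<close>. The element \<open>w = x u\<close> lies in \<open>N\<close> because
\<open>\<mm> u \<subseteq> N\<close>, and \<open>\<mm> w = x (\<mm> u) \<subseteq> x N\<close>. So the class of \<open>w\<close> in \<open>N / x N\<close> is killed by \<open>\<mm>\<close> and is a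
minimal generator; it spans a copy of the residue field \<open>k = A / \<mm>\<close>, and this copy is a direct
summand. Therefore \<open>k\<close> inherits a finite projective dimension from \<open>N\<close>, and a local ring whose residue
field has finite projective dimension is regular (Serre, Auslander and Buchsbaum).

The first half is carried out with complexes. Let \<open>P\<close> be the given finite resolution of \<open>N\<close> and \<open>F\<close> a
minimal free resolution of \<open>k\<close>. The inclusion of \<open>k\<close> and the projection to \<open>k\<close> lift to chain maps from
\<open>F\<close> to the mapping cone of \<open>x : P \<rightarrow> P\<close> and back. The composite \<open>F \<rightarrow> F\<close> induces the identity on \<open>k\<close>,
so it is homotopic to the identity of \<open>F\<close> by a homotopy \<open>h\<close>. In a degree where the cone vanishes this
reads \<open>1 = d h + h d\<close>; since the differentials of \<open>F\<close> have entries in \<open>\<mm>\<close>, \<open>F\<close> vanishes there as well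
(\<open>resolution_stops\<close>). The components of the two chain maps are \<open>to_residue\<close>,
\<open>to_residue_homotopy\<close>, \<open>from_syzygy\<close> and \<open>from_residue\<close>; from the lowest degree they are continued by
one lifting lemma, \<open>chain_lift\<close>, which also provides \<open>h\<close>.

For the second half let \<open>n\<close> be the last degree with \<open>F n \<noteq> 0\<close> and \<open>r\<close> the rank of \<open>F 1\<close>, so that \<open>\<mm>\<close> has
\<open>r\<close> generators. Then \<open>r \<le> n\<close>: multiplication by a generator of \<open>\<mm>\<close> is null-homotopic on \<open>F\<close>, and applying
the \<open>r\<close> homotopies one after the other to \<open>1 \<in> F 0\<close> leads to an element of \<open>F r\<close> outside \<open>\<mm> F r\<close>
(\<open>betti_nonzero_embdim\<close>). Moreover a regular sequence of length \<open>i < n\<close> in \<open>\<mm>\<close> can be prolonged: if \<open>I\<close> is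
the ideal it generates, \<open>F / I F\<close> is acyclic above degree \<open>i\<close>, whereas an element \<open>s \<notin> I\<close> with
\<open>\<mm> s \<subseteq> I\<close> would give the cycles \<open>s F n\<close> (\<open>reg_ideal_extend\<close>). Hence there is a regular sequence of length
\<open>n\<close>, which yields a chain of primes of length \<open>n\<close>. Together with Krull's height theorem
(\<open>height_theorem\<close>) this gives \<open>embdim A \<le> r \<le> n \<le> krull_dim A \<le> embdim A\<close>.
\<close>

section \<open>Ideals, saturation and maximal members of families of ideals\<close>

locale noetherian_cring = cring R + noetherian_ring R for R (structure)

sublocale noetherian_local_ring \<subseteq> noetherian_cring A ..

definition adjoin :: "('a, 'r) ring_scheme \<Rightarrow> 'a set \<Rightarrow> 'a \<Rightarrow> 'a set" where
  "adjoin R I x = {i \<oplus>\<^bsub>R\<^esub> r \<otimes>\<^bsub>R\<^esub> x | i r. i \<in> I \<and> r \<in> carrier R}"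

text \<open>
The contraction to \<open>R\<close> of the extension of \<open>I\<close> to the localisation at \<open>P\<close>. Working with such saturated
ideals of \<open>R\<close> replaces working in the localised ring.
\<close>

definition sat :: "('a, 'r) ring_scheme \<Rightarrow> 'a set \<Rightarrow> 'a set \<Rightarrow> 'a set" where
  "sat R P I = {z \<in> carrier R. \<exists>s \<in> carrier R - P. s \<otimes>\<^bsub>R\<^esub> z \<in> I}"

context cring
begin

lemma ideal_add: "ideal I R \<Longrightarrow> a \<in> I \<Longrightarrow> b \<in> I \<Longrightarrow> a \<oplus> b \<in> I"
  by (simp add: additive_subgroup.a_closed ideal.axioms(1))

lemma ideal_minus: "ideal I R \<Longrightarrow> a \<in> I \<Longrightarrow> \<ominus> a \<in> I"
  by (simp add: additive_subgroup.a_inv_closed ideal.axioms(1))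

lemma ideal_diff: "ideal I R \<Longrightarrow> a \<in> I \<Longrightarrow> b \<in> I \<Longrightarrow> a \<ominus> b \<in> I"
  by (simp add: a_minus_def ideal_add ideal_minus)

lemma ideal_lmult: "ideal I R \<Longrightarrow> a \<in> carrier R \<Longrightarrow> b \<in> I \<Longrightarrow> a \<otimes> b \<in> I"
  by (simp add: ideal.I_l_closed)

lemma ideal_rmult: "ideal I R \<Longrightarrow> a \<in> carrier R \<Longrightarrow> b \<in> I \<Longrightarrow> b \<otimes> a \<in> I"
  by (simp add: ideal.I_r_closed)

lemma ideal_zero: "ideal I R \<Longrightarrow> \<zero> \<in> I"
  by (simp add: additive_subgroup.zero_closed ideal.axioms(1))

lemma ideal_carr: "ideal I R \<Longrightarrow> a \<in> I \<Longrightarrow> a \<in> carrier R"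
  by (rule ideal.Icarr)

lemmas ideal_simps = ideal_add ideal_minus ideal_diff ideal_lmult ideal_rmult ideal_zero

lemma ideal_of_closed:
  assumes "I \<subseteq> carrier R" "\<zero> \<in> I" "\<And>a b. a \<in> I \<Longrightarrow> b \<in> I \<Longrightarrow> a \<oplus> b \<in> I"
    and mult: "\<And>a r. a \<in> I \<Longrightarrow> r \<in> carrier R \<Longrightarrow> r \<otimes> a \<in> I"
  shows "ideal I R"
proof (rule idealI)
  show "ring R" by (rule ring_axioms)
  show "subgroup I (add_monoid R)"
  proof (rule add.subgroupI)
    fix a assume a: "a \<in> I"
    have "\<ominus> a = (\<ominus> \<one>) \<otimes> a" using a assms(1) by (auto simp: l_minus)
    then show "\<ominus> a \<in> I" using mult[OF a, of "\<ominus> \<one>"] by simp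
  qed (use assms in auto)
  fix a r assume a: "a \<in> I" "r \<in> carrier R"
  show "r \<otimes> a \<in> I" by (rule mult[OF a])
  then show "a \<otimes> r \<in> I" using a assms(1) m_comm[of a r] by auto
qed

lemma adjoinE:
  assumes "a \<in> adjoin R I x"
  obtains i r where "i \<in> I" "r \<in> carrier R" "a = i \<oplus> r \<otimes> x"
  using assms unfolding adjoin_def by blast

lemma adjoinI: "i \<in> I \<Longrightarrow> r \<in> carrier R \<Longrightarrow> i \<oplus> r \<otimes> x \<in> adjoin R I x"
  unfolding adjoin_def by blast

lemma ideal_adjoin:
  assumes I: "ideal I R" and x: "x \<in> carrier R"
  shows "ideal (adjoin R I x) R"
proof (rule ideal_of_closed)
  show "adjoin R I x \<subseteq> carrier R" using x ideal_carr[OF I] by (auto simp: adjoin_def)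
  show "\<zero> \<in> adjoin R I x" using adjoinI[OF ideal_zero[OF I], of \<zero> x] x by simp
  fix a assume "a \<in> adjoin R I x"
  then obtain i r where a: "i \<in> I" "r \<in> carrier R" and eq: "a = i \<oplus> r \<otimes> x" by (rule adjoinE)
  have ic: "i \<in> carrier R" by (rule ideal_carr[OF I a(1)])
  show "a \<oplus> b \<in> adjoin R I x" if "b \<in> adjoin R I x" for b
  proof -
    obtain j s where b: "j \<in> I" "s \<in> carrier R" "b = j \<oplus> s \<otimes> x" using \<open>b \<in> adjoin R I x\<close> by (rule adjoinE)
    have "a \<oplus> b = (i \<oplus> j) \<oplus> (r \<oplus> s) \<otimes> x"
      unfolding eq b(3) using ic a(2) b(2) x ideal_carr[OF I b(1)] by algebra
    then show ?thesis using adjoinI[OF ideal_add[OF I a(1) b(1)], of "r \<oplus> s" x] a(2) b(2) by simp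
  qed
  show "c \<otimes> a \<in> adjoin R I x" if c: "c \<in> carrier R" for c
  proof -
    have "c \<otimes> a = c \<otimes> i \<oplus> (c \<otimes> r) \<otimes> x" unfolding eq using ic a(2) c x by algebra
    then show ?thesis using adjoinI[OF ideal_lmult[OF I c a(1)], of "c \<otimes> r" x] a(2) c by simp
  qed
qed

lemma adjoin_superset: "ideal I R \<Longrightarrow> x \<in> carrier R \<Longrightarrow> I \<subseteq> adjoin R I x"
proof
  fix i assume I: "ideal I R" and x: "x \<in> carrier R" and i: "i \<in> I"
  have "i = i \<oplus> \<zero> \<otimes> x" using x ideal_carr[OF I i] by simp
  then show "i \<in> adjoin R I x" using adjoinI[OF i, of \<zero> x] by simp
qed

lemma adjoin_self: "ideal I R \<Longrightarrow> x \<in> carrier R \<Longrightarrow> x \<in> adjoin R I x"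
proof -
  assume I: "ideal I R" and x: "x \<in> carrier R"
  have "x = \<zero> \<oplus> \<one> \<otimes> x" using x by simp
  then show "x \<in> adjoin R I x" using adjoinI[OF ideal_zero[OF I], of \<one> x] by simp
qed

lemma adjoin_minimal:
  assumes "ideal J R" "I \<subseteq> J" "x \<in> J"
  shows "adjoin R I x \<subseteq> J"
  using assms by (auto simp: adjoin_def ideal_simps subset_iff)

lemma primeideal_mult_iff:
  assumes P: "primeideal P R" and a: "a \<in> carrier R" and b: "b \<in> carrier R"
  shows "a \<otimes> b \<in> P \<longleftrightarrow> a \<in> P \<or> b \<in> P"
  using primeideal.I_prime[OF P a b] primeideal.axioms(1)[OF P] a b by (auto simp: ideal_simps)

lemma primeideal_one: "primeideal P R \<Longrightarrow> \<one> \<notin> P"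
  using primeideal.I_notcarr primeideal.axioms(1) ideal.one_imp_carrier by metis

lemma primeideal_pow:
  assumes P: "primeideal P R" and a: "a \<in> carrier R" and m: "a [^] (n::nat) \<in> P"
  shows "a \<in> P"
  using m
proof (induction n)
  case 0 then show ?case using primeideal_one[OF P] by simp
next
  case (Suc n) then show ?case using primeideal_mult_iff[OF P] a by auto
qed

lemma ideal_prime: "primeideal P R \<Longrightarrow> ideal P R"
  by (rule primeideal.axioms(1))

lemma ideal_sat:
  assumes P: "primeideal P R" and I: "ideal I R"
  shows "ideal (sat R P I) R"
proof (rule ideal_of_closed)
  show "sat R P I \<subseteq> carrier R" by (auto simp: sat_def)
  show "\<zero> \<in> sat R P I"
    using ideal_zero[OF I] primeideal_one[OF P] by (auto simp: sat_def intro!: bexI[of _ \<one>])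
  fix a assume "a \<in> sat R P I"
  then obtain s where a: "a \<in> carrier R" "s \<in> carrier R - P" "s \<otimes> a \<in> I" by (auto simp: sat_def)
  show "a \<oplus> b \<in> sat R P I" if "b \<in> sat R P I" for b
  proof -
    obtain t where b: "b \<in> carrier R" "t \<in> carrier R - P" "t \<otimes> b \<in> I"
      using \<open>b \<in> sat R P I\<close> by (auto simp: sat_def)
    have "(s \<otimes> t) \<otimes> (a \<oplus> b) = t \<otimes> (s \<otimes> a) \<oplus> s \<otimes> (t \<otimes> b)"
      using a b by (simp add: r_distr m_ac)
    then have "(s \<otimes> t) \<otimes> (a \<oplus> b) \<in> I" using a b I by (simp add: ideal_simps)
    moreover have "s \<otimes> t \<in> carrier R - P" using a b primeideal_mult_iff[OF P] by auto
    ultimately show ?thesis using a b by (auto simp: sat_def)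
  qed
  show "c \<otimes> a \<in> sat R P I" if c: "c \<in> carrier R" for c
  proof -
    have "s \<otimes> (c \<otimes> a) = c \<otimes> (s \<otimes> a)" using a c by (simp add: m_ac)
    then have "s \<otimes> (c \<otimes> a) \<in> I" using a c I by (simp add: ideal_simps)
    then show ?thesis using a c by (auto simp: sat_def)
  qed
qed

lemma ideal_colon:
  assumes "ideal L R" and "a \<in> carrier R"
  shows "ideal {t \<in> carrier R. t \<otimes> a \<in> L} R"
  by (rule ideal_of_closed) (use assms in \<open>auto simp: l_distr m_assoc ideal_simps\<close>)

lemma satI: "s \<in> carrier R \<Longrightarrow> s \<notin> P \<Longrightarrow> z \<in> carrier R \<Longrightarrow> s \<otimes> z \<in> I \<Longrightarrow> z \<in> sat R P I"
  by (auto simp: sat_def)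

lemma satE:
  assumes "z \<in> sat R P I"
  obtains s where "z \<in> carrier R" "s \<in> carrier R" "s \<notin> P" "s \<otimes> z \<in> I"
  using assms by (auto simp: sat_def)

lemma sat_superset: "primeideal P R \<Longrightarrow> ideal I R \<Longrightarrow> I \<subseteq> sat R P I"
  using primeideal_one ideal_carr by (auto intro!: satI[of \<one>])

lemma sat_mono: "I \<subseteq> J \<Longrightarrow> sat R P I \<subseteq> sat R P J"
  by (auto simp: sat_def)

lemma sat_cancel:
  assumes P: "primeideal P R" and s: "s \<in> carrier R" "s \<notin> P" and z: "z \<in> carrier R"
    and m: "s \<otimes> z \<in> sat R P I"
  shows "z \<in> sat R P I"
proof -
  obtain t where t: "t \<in> carrier R" "t \<notin> P" "t \<otimes> (s \<otimes> z) \<in> I" using m by (rule satE)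
  then have "(t \<otimes> s) \<otimes> z \<in> I" using s z by (simp add: m_assoc)
  moreover have "t \<otimes> s \<notin> P" using t s primeideal_mult_iff[OF P] by blast
  ultimately show ?thesis using t s z by (intro satI[of "t \<otimes> s"]) auto
qed

end

context noetherian_cring
begin

lemma maximal_ideal_in_family:
  assumes "C \<noteq> {}" and "\<And>I. I \<in> C \<Longrightarrow> ideal I R"
  obtains I where "I \<in> C" "\<And>J. J \<in> C \<Longrightarrow> I \<subseteq> J \<Longrightarrow> J = I"
proof -
  have "\<exists>I\<in>C. \<forall>J\<in>C. I \<subseteq> J \<longrightarrow> J = I"
  proof (rule subset_Zorn_nonempty[OF assms(1)])
    fix D assume D: "D \<noteq> {}" "subset.chain C D"
    then have "subset.chain {I. ideal I R} D"
      using assms(2) unfolding pred_on.chain_def by auto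
    then have "\<Union>D \<in> D" by (rule ideal_chain_is_trivial[OF D(1)])
    then show "\<Union>D \<in> C" using D(2) unfolding pred_on.chain_def by auto
  qed
  then show ?thesis using that by blast
qed

text \<open>
An ideal that is maximal among those containing \<open>I\<close> and missing \<open>S\<close> is prime, since each larger ideal
meets the multiplicative set \<open>S\<close>.
\<close>

lemma prime_disjoint_exists:
  assumes I: "ideal I R" and S: "S \<subseteq> carrier R" "\<one> \<in> S" "\<And>a b. a \<in> S \<Longrightarrow> b \<in> S \<Longrightarrow> a \<otimes> b \<in> S"
    and disj: "I \<inter> S = {}"
  obtains P where "primeideal P R" "I \<subseteq> P" "P \<inter> S = {}"
proof -
  let ?C = "{J. ideal J R \<and> I \<subseteq> J \<and> J \<inter> S = {}}"
  obtain P where P: "P \<in> ?C" and max: "\<And>J. J \<in> ?C \<Longrightarrow> P \<subseteq> J \<Longrightarrow> J = P"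
    by (rule maximal_ideal_in_family[of ?C]) (use I disj in auto)
  have iP: "ideal P R" using P by simp
  have meets: "\<exists>p\<in>P. \<exists>r\<in>carrier R. p \<oplus> r \<otimes> a \<in> S" if a: "a \<in> carrier R" "a \<notin> P" for a
  proof (rule ccontr)
    assume *: "\<not> ?thesis"
    then have "adjoin R P a \<inter> S = {}" by (auto elim!: adjoinE)
    then have "adjoin R P a = P"
      using max[of "adjoin R P a"] ideal_adjoin[OF iP a(1)] adjoin_superset[OF iP a(1)] P by blast
    then show False using adjoin_self[OF iP a(1)] a by simp
  qed
  have "primeideal P R"
  proof (rule primeidealI[OF iP is_cring])
    show "carrier R \<noteq> P" using P S by auto
    fix a b assume a: "a \<in> carrier R" and b: "b \<in> carrier R" and ab: "a \<otimes> b \<in> P"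
    show "a \<in> P \<or> b \<in> P"
    proof (rule ccontr)
      assume "\<not> (a \<in> P \<or> b \<in> P)"
      then obtain p r q t where p: "p \<in> P" "r \<in> carrier R" "p \<oplus> r \<otimes> a \<in> S"
        and q: "q \<in> P" "t \<in> carrier R" "q \<oplus> t \<otimes> b \<in> S"
        using meets a b by meson
      have pc: "p \<in> carrier R" "q \<in> carrier R" using p q ideal_carr[OF iP] by auto
      have "(p \<oplus> r \<otimes> a) \<otimes> (q \<oplus> t \<otimes> b) = (q \<oplus> t \<otimes> b) \<otimes> p \<oplus> ((r \<otimes> a) \<otimes> q \<oplus> (r \<otimes> t) \<otimes> (a \<otimes> b))"
        using p(2) q(2) pc a b by algebra
      also have "\<dots> \<in> P" using p q pc a b ab iP by (simp add: ideal_simps)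
      finally show False using S(3)[OF p(3) q(3)] P by auto
    qed
  qed
  then show ?thesis using that P by blast
qed

text \<open>
The primes missing the multiplicative set of the elements \<open>s x ^ k\<close> with \<open>s \<notin> Q\<close> are those inside \<open>Q\<close> that do
not contain \<open>x\<close>; this is the localisation at \<open>Q\<close>, further localised at the powers of \<open>x\<close>.
\<close>

lemma prime_missing_powers:
  assumes I: "ideal I R" and Q: "primeideal Q R" and x: "x \<in> carrier R"
    and miss: "\<And>s k. s \<in> carrier R \<Longrightarrow> s \<notin> Q \<Longrightarrow> s \<otimes> x [^] (k::nat) \<notin> I"
  obtains P where "primeideal P R" "I \<subseteq> P" "P \<subseteq> Q" "x \<notin> P"
proof -
  let ?S = "{s \<otimes> x [^] (k::nat) | s k. s \<in> carrier R \<and> s \<notin> Q}"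
  have S: "?S \<subseteq> carrier R" using x by auto
  have S1: "s \<in> ?S" if "s \<in> carrier R" "s \<notin> Q" for s
  proof -
    have "s = s \<otimes> x [^] (0::nat)" using that by simp
    then show ?thesis using that by blast
  qed
  have Sm: "a \<otimes> b \<in> ?S" if ab: "a \<in> ?S" "b \<in> ?S" for a b
  proof -
    obtain s k t l where st: "s \<in> carrier R" "s \<notin> Q" "t \<in> carrier R" "t \<notin> Q"
      and eq: "a = s \<otimes> x [^] (k::nat)" "b = t \<otimes> x [^] (l::nat)" using ab by auto
    have "a \<otimes> b = (s \<otimes> t) \<otimes> x [^] (k + l)"
      unfolding eq using st x by (simp add: nat_pow_mult[symmetric] m_ac)
    moreover have "s \<otimes> t \<notin> Q" using st primeideal_mult_iff[OF Q] by blast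
    ultimately show ?thesis using st by blast
  qed
  have "I \<inter> ?S = {}" using miss by blast
  moreover have "\<one> \<in> ?S" by (rule S1) (use primeideal_one[OF Q] in auto)
  ultimately obtain P where P: "primeideal P R" "I \<subseteq> P" "P \<inter> ?S = {}"
    using prime_disjoint_exists[OF I S _ Sm] by (metis (no_types, lifting))
  have "P \<subseteq> Q" using S1 P(3) ideal_carr[OF ideal_prime[OF P(1)]] by blast
  moreover have "x \<notin> P"
  proof -
    have "x = \<one> \<otimes> x [^] (1::nat)" using x by simp
    then have "x \<in> ?S" using primeideal_one[OF Q] one_closed by blast
    then show ?thesis using P(3) by blast
  qed
  ultimately show ?thesis using that P by blast
qed

section \<open>Krull's principal ideal theorem and height theorem\<close>

text \<open>
This is Nakayama's lemma in the localisation at \<open>P\<close>: if \<open>I = J + x I\<close> there, then \<open>I = J\<close> there.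
Choose \<open>K\<close> maximal among the ideals above \<open>J\<close> for which the conclusion fails and \<open>z \<in> I\<close> witnessing the
failure. Modulo \<open>K\<close> all of \<open>I\<close> is locally a multiple of \<open>z\<close>, so \<open>z\<close> is locally a multiple of \<open>x z\<close>, and
the factor that kills \<open>z\<close> is a unit at \<open>P\<close>.
\<close>

lemma saturated_nakayama:
  assumes P: "primeideal P R" and x: "x \<in> P" and I: "ideal I R" and J: "ideal J R"
    and step: "\<And>z. z \<in> I \<Longrightarrow> \<exists>s\<in>carrier R - P. \<exists>b\<in>I. \<exists>j\<in>J. s \<otimes> z = j \<oplus> b \<otimes> x"
  shows "I \<subseteq> sat R P J"
proof (rule ccontr)
  assume not: "\<not> I \<subseteq> sat R P J"
  let ?C = "{K. ideal K R \<and> J \<subseteq> K \<and> \<not> I \<subseteq> sat R P K}"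
  obtain K where K: "K \<in> ?C" and max: "\<And>L. L \<in> ?C \<Longrightarrow> K \<subseteq> L \<Longrightarrow> L = K"
    by (rule maximal_ideal_in_family[of ?C]) (use J not in auto)
  have iK: "ideal K R" using K by simp
  have xc: "x \<in> carrier R" using x ideal_carr[OF ideal_prime[OF P]] by blast
  obtain z where z: "z \<in> I" "z \<notin> sat R P K" using K by auto
  have zc: "z \<in> carrier R" using z I ideal_carr by blast
  have "z \<notin> K" using z sat_superset[OF P iK] by auto
  then have "adjoin R K z \<noteq> K" using adjoin_self[OF iK zc] by auto
  then have sub: "I \<subseteq> sat R P (adjoin R K z)"
    using max[of "adjoin R K z"] ideal_adjoin[OF iK zc] adjoin_superset[OF iK zc] K by blast
  obtain s b j where s: "s \<in> carrier R" "s \<notin> P" and b: "b \<in> I" and j: "j \<in> J"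
    and eq: "s \<otimes> z = j \<oplus> b \<otimes> x" using step[OF z(1)] by auto
  have bc: "b \<in> carrier R" using b I ideal_carr by blast
  \<comment> \<open>By maximality of \<open>K\<close>, the element \<open>b\<close> is a multiple of \<open>z\<close> modulo \<open>K\<close>, after multiplication by \<open>t\<close>.\<close>
  obtain t where t: "t \<in> carrier R" "t \<notin> P" "t \<otimes> b \<in> adjoin R K z"
    using b sub by (auto elim: satE)
  then obtain k r where k: "k \<in> K" "r \<in> carrier R" "t \<otimes> b = k \<oplus> r \<otimes> z" by (auto elim: adjoinE)
  have kc: "k \<in> carrier R" "j \<in> carrier R" using k j iK J ideal_carr by auto
  have "(t \<otimes> s \<ominus> r \<otimes> x) \<otimes> z = t \<otimes> (s \<otimes> z) \<ominus> r \<otimes> x \<otimes> z"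
    using t(1) s(1) k(2) xc zc by algebra
  also have "\<dots> = t \<otimes> j \<oplus> (t \<otimes> b) \<otimes> x \<ominus> r \<otimes> x \<otimes> z"
    unfolding eq using t(1) k(2) kc bc xc zc by algebra
  also have "\<dots> = t \<otimes> j \<oplus> x \<otimes> k"
    unfolding k(3) using t(1) k(2) kc xc zc by algebra
  also have "\<dots> \<in> K" using t j k xc K by (intro ideal_add[OF iK] ideal_lmult[OF iK]) auto
  finally have inK: "(t \<otimes> s \<ominus> r \<otimes> x) \<otimes> z \<in> K" .
  have "t \<otimes> s \<ominus> r \<otimes> x \<notin> P"
  proof
    assume "t \<otimes> s \<ominus> r \<otimes> x \<in> P"
    then have "(t \<otimes> s \<ominus> r \<otimes> x) \<oplus> r \<otimes> x \<in> P" using x k ideal_prime[OF P] by (simp add: ideal_simps)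
    moreover have "(t \<otimes> s \<ominus> r \<otimes> x) \<oplus> r \<otimes> x = t \<otimes> s" using t(1) s(1) k(2) xc by algebra
    ultimately show False using primeideal_mult_iff[OF P] t s by auto
  qed
  then show False using z inK zc t s k xc by (auto intro: satI[of "t \<otimes> s \<ominus> r \<otimes> x"])
qed

text \<open>
The ring \<open>R / I\<close>, localised at \<open>P\<close>, is Artinian.
\<close>

definition dcc_above :: "'a set \<Rightarrow> 'a set \<Rightarrow> bool" where
  "dcc_above P I \<longleftrightarrow> (\<forall>J :: nat \<Rightarrow> 'a set.
     (\<forall>n. ideal (J n) R \<and> sat R P (J n) \<subseteq> J n \<and> I \<subseteq> J n \<and> J (Suc n) \<subseteq> J n) \<longrightarrow>
     (\<exists>n. \<forall>m\<ge>n. J m = J n))"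

text \<open>
Noetherian induction on \<open>I\<close>. Let \<open>K\<close> be a maximal counterexample. It lies in \<open>P\<close>, since otherwise \<open>R\<close> is the
only saturated ideal above it, and it is not prime, since otherwise \<open>K = P\<close> and \<open>R / K\<close> localises to a field.
So \<open>a b \<in> K\<close> with \<open>a, b \<notin> K\<close>, and both \<open>K + (a)\<close> and \<open>(K : a)\<close> are larger than \<open>K\<close>. A descending chain
\<open>J\<close> of saturated ideals above \<open>K\<close> is determined by the two chains \<open>J + (a)\<close> and \<open>(J : a)\<close>, which become
stationary.
\<close>

lemma dcc_above_minimal_prime:
  assumes P: "primeideal P R" and I: "ideal I R"
    and min: "\<And>Q. primeideal Q R \<Longrightarrow> I \<subseteq> Q \<Longrightarrow> Q \<subseteq> P \<Longrightarrow> Q = P"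
  shows "dcc_above P I"
proof (rule ccontr)
  assume not: "\<not> dcc_above P I"
  let ?C = "{K. ideal K R \<and> I \<subseteq> K \<and> \<not> dcc_above P K}"
  obtain K where K: "K \<in> ?C" and max: "\<And>L. L \<in> ?C \<Longrightarrow> K \<subseteq> L \<Longrightarrow> L = K"
    by (rule maximal_ideal_in_family[of ?C]) (use I not in auto)
  have iK: "ideal K R" using K by simp
  have larger: "dcc_above P L" if "ideal L R" "K \<subseteq> L" "L \<noteq> K" for L
    using max[of L] that K by blast
  have "\<not> dcc_above P K" using K by simp
  then obtain J :: "nat \<Rightarrow> 'a set"
    where J0: "\<forall>n. ideal (J n) R \<and> sat R P (J n) \<subseteq> J n \<and> K \<subseteq> J n \<and> J (Suc n) \<subseteq> J n"
      and bad0: "\<not> (\<exists>n. \<forall>m\<ge>n. J m = J n)"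
    unfolding dcc_above_def not_all not_imp by (elim exE conjE) (rule that)
  have J: "ideal (J n) R" "sat R P (J n) \<subseteq> J n" "K \<subseteq> J n" "J (Suc n) \<subseteq> J n" for n
    using J0 by auto
  have bad: "\<exists>m\<ge>n. J m \<noteq> J n" for n using bad0 by auto
  have mono: "J m \<subseteq> J n" if "n \<le> m" for m n using lift_Suc_antimono_le[of J, OF J(4) that] .
  have whole: "J n = carrier R" if nP: "\<not> J n \<subseteq> P" for n
  proof -
    obtain s where s: "s \<in> J n" "s \<notin> P" using nP by blast
    have sc: "s \<in> carrier R" using s J(1) ideal_carr by blast
    have "carrier R \<subseteq> sat R P (J n)"
      using s sc J(1)[of n] by (auto intro!: satI[of s] ideal_rmult)
    then show ?thesis using J(1,2)[of n] ideal_carr by blast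
  qed
  have KP: "K \<subseteq> P"
  proof (rule ccontr)
    assume "\<not> K \<subseteq> P"
    then have "\<And>n. J n = carrier R" using whole J(3) by blast
    then show False using bad by simp
  qed
  show False
  proof (cases "primeideal K R")
    case True
    then have KP: "K = P" using min K KP by blast
    show False
    proof (cases "\<exists>n. J n \<subseteq> P")
      case True
      then obtain n where n: "J n \<subseteq> P" ..
      have "J m = P" if "m \<ge> n" for m using mono[OF that] n J(3)[of m] KP by blast
      then show False using bad[of n] by auto
    next
      case False
      then have "\<And>n. J n = carrier R" using whole by blast
      then show False using bad by simp
    qed
  next
    case False
    have "carrier R \<noteq> K" using KP primeideal.I_notcarr[OF P] ideal_carr[OF ideal_prime[OF P]] by blast
    then obtain a b where a: "a \<in> carrier R" "a \<notin> K" and b: "b \<in> carrier R" "b \<notin> K"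
      and ab: "a \<otimes> b \<in> K" using False primeidealI[OF iK is_cring] by blast
    let ?U = "\<lambda>n. sat R P (adjoin R (J n) a)"
    let ?V = "\<lambda>n. {t \<in> carrier R. t \<otimes> a \<in> J n}"
    note iV = ideal_colon[OF _ a(1)]
    have dU: "dcc_above P (adjoin R K a)"
      using larger[of "adjoin R K a"] adjoin_superset[OF iK a(1)] adjoin_self[OF iK a(1)] a
        ideal_adjoin[OF iK a(1)] by blast
    have dV: "dcc_above P {t \<in> carrier R. t \<otimes> a \<in> K}"
    proof (rule larger)
      show "ideal {t \<in> carrier R. t \<otimes> a \<in> K} R" by (rule iV[OF iK])
      show "K \<subseteq> {t \<in> carrier R. t \<otimes> a \<in> K}" using a ideal_carr[OF iK] by (auto intro: ideal_rmult[OF iK])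
      show "{t \<in> carrier R. t \<otimes> a \<in> K} \<noteq> K"
      proof -
        have "b \<otimes> a \<in> K" using a b ab m_comm[of b a] by simp
        then show ?thesis using b by blast
      qed
    qed
    have "\<forall>n. ideal (?U n) R \<and> sat R P (?U n) \<subseteq> ?U n \<and> adjoin R K a \<subseteq> ?U n \<and> ?U (Suc n) \<subseteq> ?U n"
    proof (intro allI conjI)
      fix n
      have iA: "ideal (adjoin R (J n) a) R" by (rule ideal_adjoin[OF J(1) a(1)])
      show "ideal (?U n) R" by (rule ideal_sat[OF P iA])
      show "sat R P (?U n) \<subseteq> ?U n" by (auto elim!: satE[of _ P "?U n"] intro: sat_cancel[OF P])
      have "adjoin R K a \<subseteq> adjoin R (J n) a" using J(3)[of n] unfolding adjoin_def by blast
      then show "adjoin R K a \<subseteq> ?U n" using sat_superset[OF P iA] by blast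
      have "adjoin R (J (Suc n)) a \<subseteq> adjoin R (J n) a" using J(4)[of n] unfolding adjoin_def by blast
      then show "?U (Suc n) \<subseteq> ?U n" by (rule sat_mono)
    qed
    then obtain n1 where n1: "\<forall>m\<ge>n1. ?U m = ?U n1"
      using dU[unfolded dcc_above_def, rule_format, of ?U] by blast
    have "\<forall>n. ideal (?V n) R \<and> sat R P (?V n) \<subseteq> ?V n \<and> {t \<in> carrier R. t \<otimes> a \<in> K} \<subseteq> ?V n \<and> ?V (Suc n) \<subseteq> ?V n"
    proof (intro allI conjI)
      fix n
      show "ideal (?V n) R" by (rule iV[OF J(1)])
      show "sat R P (?V n) \<subseteq> ?V n"
      proof
        fix z assume "z \<in> sat R P (?V n)"
        then obtain s where s: "z \<in> carrier R" "s \<in> carrier R" "s \<notin> P" "s \<otimes> z \<in> ?V n" by (rule satE)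
        then have "s \<otimes> (z \<otimes> a) \<in> J n" using a by (simp add: m_assoc)
        then have "z \<otimes> a \<in> sat R P (J n)" using s a by (auto intro: satI)
        then show "z \<in> ?V n" using J(2)[of n] s by auto
      qed
      show "{t \<in> carrier R. t \<otimes> a \<in> K} \<subseteq> ?V n" using J(3)[of n] by blast
      show "?V (Suc n) \<subseteq> ?V n" using J(4)[of n] by blast
    qed
    then obtain n2 where n2: "\<forall>m\<ge>n2. ?V m = ?V n2"
      using dV[unfolded dcc_above_def, rule_format, of ?V] by blast
    define n where "n = max n1 n2"
    obtain m where m: "m \<ge> n" "J m \<noteq> J n" using bad by blast
    have le: "n1 \<le> n" "n2 \<le> n" "n1 \<le> m" "n2 \<le> m" using m(1) by (auto simp: n_def)
    have U: "?U n = ?U m" using n1[rule_format, OF le(1)] n1[rule_format, OF le(3)] by (rule trans[OF _ sym])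
    have V: "?V n = ?V m" using n2[rule_format, OF le(2)] n2[rule_format, OF le(4)] by (rule trans[OF _ sym])
    have "J n \<subseteq> J m"
    proof
      fix z assume z: "z \<in> J n"
      have zc: "z \<in> carrier R" using z J(1) ideal_carr by blast
      have "z \<in> ?U n"
        using z adjoin_superset[OF J(1) a(1)] sat_superset[OF P ideal_adjoin[OF J(1) a(1)]] by blast
      then have "z \<in> ?U m" using U by simp
      then obtain s where s: "s \<in> carrier R" "s \<notin> P" "s \<otimes> z \<in> adjoin R (J m) a" by (rule satE)
      then obtain w t where w: "w \<in> J m" "t \<in> carrier R" "s \<otimes> z = w \<oplus> t \<otimes> a" by (auto elim: adjoinE)
      have wc: "w \<in> carrier R" using w J(1) ideal_carr by blast
      have "t \<otimes> a = s \<otimes> z \<ominus> w" unfolding w(3) using w(2) wc a(1) by algebra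
      moreover have "\<dots> \<in> J n" using z w mono[OF m(1)] s by (intro ideal_diff[OF J(1)] ideal_lmult[OF J(1)]) auto
      ultimately have "t \<in> ?V n" using w by simp
      then have "t \<otimes> a \<in> J m" using V by blast
      then have "s \<otimes> z \<in> J m" using w J(1) by (simp add: ideal_simps)
      then show "z \<in> J m" using J(2)[of m] s zc by (auto intro: satI)
    qed
    then show False using m mono[OF m(1)] by blast
  qed
qed

text \<open>
No prime \<open>P\<close> lies strictly between \<open>Q\<close> and a minimal prime \<open>M\<close> over \<open>Q + (x)\<close>. Take \<open>c \<in> P - Q\<close> and let
\<open>C n\<close> be the saturation of \<open>Q + (c ^ n)\<close> at \<open>P\<close>. The chain \<open>C n + (x)\<close> becomes stationary at \<open>M\<close>; as \<open>x\<close> is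
not in \<open>P\<close>, this means \<open>C n = C (n + 1) + x C n\<close>, hence \<open>C n = C (n + 1)\<close> by Nakayama. Then \<open>c ^ n\<close> is, at
\<open>P\<close> and modulo \<open>Q\<close>, a multiple of \<open>c ^ (n + 1)\<close>, which forces \<open>c \<in> Q\<close>. The ideals \<open>C n\<close> play the part that
the symbolic powers of \<open>P\<close> have in the textbook proof.
\<close>

lemma principal_ideal_theorem:
  assumes Q: "primeideal Q R" and P: "primeideal P R" and M: "primeideal M R"
    and QP: "Q \<subset> P" and PM: "P \<subset> M" and x: "x \<in> M"
    and min: "\<And>P'. primeideal P' R \<Longrightarrow> Q \<subseteq> P' \<Longrightarrow> x \<in> P' \<Longrightarrow> P' \<subseteq> M \<Longrightarrow> P' = M"
  shows False
proof -
  have iQ: "ideal Q R" and iP: "ideal P R" and iM: "ideal M R" using Q P M ideal_prime by auto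
  have xc: "x \<in> carrier R" using x iM ideal_carr by blast
  have xP: "x \<notin> P" using min[OF P] QP PM by blast
  obtain c where c: "c \<in> P" "c \<notin> Q" using QP by blast
  have cc: "c \<in> carrier R" using c iP ideal_carr by blast
  have pc: "c [^] (n::nat) \<in> carrier R" for n using cc by simp
  define C where "C n = sat R P (adjoin R Q (c [^] (n::nat)))" for n
  have iC: "ideal (C n) R" for n unfolding C_def by (intro ideal_sat[OF P] ideal_adjoin[OF iQ] pc)
  have cancel: "z \<in> C n" if "s \<in> carrier R" "s \<notin> P" "z \<in> carrier R" "s \<otimes> z \<in> C n" for s z n
    using that sat_cancel[OF P] unfolding C_def by blast
  have QC: "Q \<subseteq> C n" for n unfolding C_def
    using adjoin_superset[OF iQ pc] sat_superset[OF P ideal_adjoin[OF iQ pc]] by blast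
  have cC: "c [^] n \<in> C n" for n unfolding C_def
    using adjoin_self[OF iQ pc] sat_superset[OF P ideal_adjoin[OF iQ pc]] by blast
  have CS: "C (Suc n) \<subseteq> C n" for n
  proof -
    have "c [^] Suc n \<in> adjoin R Q (c [^] n)"
      using ideal_rmult[OF ideal_adjoin[OF iQ pc] cc adjoin_self[OF iQ pc]] by simp
    then have "adjoin R Q (c [^] Suc n) \<subseteq> adjoin R Q (c [^] n)"
      by (intro adjoin_minimal ideal_adjoin[OF iQ pc] adjoin_superset[OF iQ pc])
    then show ?thesis unfolding C_def by (rule sat_mono)
  qed
  define J where "J n = sat R M (adjoin R (C n) x)" for n
  have "dcc_above M (adjoin R Q x)"
  proof (rule dcc_above_minimal_prime[OF M ideal_adjoin[OF iQ xc]])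
    fix P' assume "primeideal P' R" "adjoin R Q x \<subseteq> P'" "P' \<subseteq> M"
    then show "P' = M" using min adjoin_superset[OF iQ xc] adjoin_self[OF iQ xc] by blast
  qed
  moreover have "\<forall>n. ideal (J n) R \<and> sat R M (J n) \<subseteq> J n \<and> adjoin R Q x \<subseteq> J n \<and> J (Suc n) \<subseteq> J n"
  proof (intro allI conjI)
    fix n
    have iA: "ideal (adjoin R (C n) x) R" by (rule ideal_adjoin[OF iC xc])
    show "ideal (J n) R" unfolding J_def by (rule ideal_sat[OF M iA])
    show "sat R M (J n) \<subseteq> J n" unfolding J_def
      by (auto elim!: satE[of _ M "sat R M _"] intro: sat_cancel[OF M])
    have "adjoin R Q x \<subseteq> adjoin R (C n) x" using QC[of n] unfolding adjoin_def by blast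
    then show "adjoin R Q x \<subseteq> J n" using sat_superset[OF M iA] unfolding J_def by blast
    have "adjoin R (C (Suc n)) x \<subseteq> adjoin R (C n) x" using CS[of n] unfolding adjoin_def by blast
    then show "J (Suc n) \<subseteq> J n" unfolding J_def by (rule sat_mono)
  qed
  ultimately obtain n where "\<forall>m\<ge>n. J m = J n" unfolding dcc_above_def by blast
  then have Jn: "J (Suc n) = J n" by (rule allE[of _ "Suc n"]) simp
  have "C n \<subseteq> sat R M (C (Suc n))"
  proof (rule saturated_nakayama[OF M x iC iC])
    fix z assume z: "z \<in> C n"
    have zc: "z \<in> carrier R" using z iC ideal_carr by blast
    have "z \<in> J (Suc n)" unfolding Jn unfolding J_def
      using z adjoin_superset[OF iC xc] sat_superset[OF M ideal_adjoin[OF iC xc]] by blast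
    then obtain s where s: "s \<in> carrier R" "s \<notin> M" "s \<otimes> z \<in> adjoin R (C (Suc n)) x"
      unfolding J_def by (rule satE)
    then obtain j b where j: "j \<in> C (Suc n)" "b \<in> carrier R" "s \<otimes> z = j \<oplus> b \<otimes> x" by (auto elim: adjoinE)
    have jc: "j \<in> carrier R" using j iC ideal_carr by blast
    have "x \<otimes> b = s \<otimes> z \<ominus> j" unfolding j(3) using j(2) jc xc by algebra
    moreover have "\<dots> \<in> C n" using z s j CS by (intro ideal_diff[OF iC] ideal_lmult[OF iC]) auto
    ultimately have "b \<in> C n" using cancel[OF xc xP] j by simp
    then show "\<exists>s\<in>carrier R - M. \<exists>b\<in>C n. \<exists>j\<in>C (Suc n). s \<otimes> z = j \<oplus> b \<otimes> x" using s j by blast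
  qed
  then have "c [^] n \<in> sat R M (C (Suc n))" using cC by blast
  then obtain s where s: "s \<in> carrier R" "s \<notin> M" "s \<otimes> c [^] n \<in> C (Suc n)" by (rule satE)
  then have "c [^] n \<in> C (Suc n)" using cancel[of s "c [^] n"] PM pc by blast
  then obtain t where t: "t \<in> carrier R" "t \<notin> P" "t \<otimes> c [^] n \<in> adjoin R Q (c [^] Suc n)"
    unfolding C_def by (rule satE)
  then obtain q r where q: "q \<in> Q" "r \<in> carrier R" "t \<otimes> c [^] n = q \<oplus> r \<otimes> c [^] Suc n" by (auto elim: adjoinE)
  have qc: "q \<in> carrier R" using q iQ ideal_carr by blast
  have "(t \<ominus> r \<otimes> c) \<otimes> c [^] n = t \<otimes> c [^] n \<ominus> r \<otimes> c \<otimes> c [^] n"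
    using t(1) q(2) cc pc[of n] by algebra
  also have "\<dots> = q" unfolding q(3) nat_pow_Suc using q(2) qc cc pc[of n] by algebra
  finally have "(t \<ominus> r \<otimes> c) \<otimes> c [^] n \<in> Q" using q by simp
  moreover have "c [^] n \<notin> Q" using primeideal_pow[OF Q cc] c by blast
  ultimately have "t \<ominus> r \<otimes> c \<in> Q" using primeideal_mult_iff[OF Q _ pc] t q cc by simp
  then have "(t \<ominus> r \<otimes> c) \<oplus> r \<otimes> c \<in> P" using QP c q by (intro ideal_add[OF iP] ideal_lmult[OF iP]) auto
  moreover have "(t \<ominus> r \<otimes> c) \<oplus> r \<otimes> c = t" using t(1) q(2) cc by algebra
  ultimately show False using t by simp
qed

text \<open>
Induction on the length of the chain. Let \<open>P\<close> be maximal among the primes between the last but one member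
of the chain and \<open>M\<close>, and choose \<open>x \<in> S - P\<close>. The only prime over \<open>P + (x)\<close> inside \<open>M\<close> is \<open>M\<close>, so a power of each
\<open>y \<in> S\<close> is, at \<open>M\<close>, congruent modulo \<open>(x)\<close> to an element \<open>w y\<close> of \<open>P\<close>. By the principal ideal theorem \<open>P\<close> is
minimal over the elements \<open>w y\<close> with \<open>y \<noteq> x\<close>, which are fewer than the elements of \<open>S\<close>.
\<close>

lemma height_theorem:
  assumes "finite S" "S \<subseteq> M" "primeideal M R"
    and "\<And>P. primeideal P R \<Longrightarrow> S \<subseteq> P \<Longrightarrow> P \<subseteq> M \<Longrightarrow> P = M"
    and "\<And>i. i \<le> m \<Longrightarrow> primeideal (C i) R" "\<And>i. i < m \<Longrightarrow> C i \<subset> C (Suc i)" "C m = M"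
  shows "m \<le> card S"
  using assms
proof (induction m arbitrary: S M C)
  case 0
  then show ?case by simp
next
  case (Suc m)
  note M = \<open>primeideal M R\<close>
  have iM: "ideal M R" by (rule ideal_prime[OF M])
  let ?F = "{P. primeideal P R \<and> C m \<subseteq> P \<and> P \<subset> M}"
  have "C m \<in> ?F" using Suc.prems(5)[of m] Suc.prems(6)[of m] Suc.prems(7) by auto
  then obtain P where PF: "P \<in> ?F" and max: "\<And>P'. P' \<in> ?F \<Longrightarrow> P \<subseteq> P' \<Longrightarrow> P' = P"
    by (rule_tac maximal_ideal_in_family[of ?F]) (auto intro: ideal_prime)
  have P: "primeideal P R" and iP: "ideal P R" and PM: "P \<subset> M" and CP: "C m \<subseteq> P"
    using PF ideal_prime by auto
  obtain x where x: "x \<in> S" "x \<notin> P" using Suc.prems(4)[OF P] PM by blast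
  have xc: "x \<in> carrier R" using x Suc.prems(2) ideal_carr[OF iM] by blast
  have "\<exists>w. w \<in> P \<and> (\<exists>s\<in>carrier R - M. \<exists>k::nat. \<exists>a\<in>carrier R. s \<otimes> y [^] k = w \<oplus> a \<otimes> x)"
    if y: "y \<in> S" for y
  proof (rule ccontr)
    assume no: "\<not> ?thesis"
    have yM: "y \<in> M" and yc: "y \<in> carrier R" using y Suc.prems(2) ideal_carr[OF iM] by auto
    obtain P' where P': "primeideal P' R" "adjoin R P x \<subseteq> P'" "P' \<subseteq> M" "y \<notin> P'"
      by (rule prime_missing_powers[OF ideal_adjoin[OF iP xc] M yc]) (use no in \<open>blast elim: adjoinE\<close>)
    have "P \<subseteq> P'" "x \<in> P'" using P'(2) adjoin_superset[OF iP xc] adjoin_self[OF iP xc] by auto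
    then have "P' = M" using max[of P'] P' CP x by blast
    then show False using yM P' by blast
  qed
  then obtain w where w: "\<And>y. y \<in> S \<Longrightarrow> w y \<in> P"
    and w2: "\<And>y. y \<in> S \<Longrightarrow> \<exists>s\<in>carrier R - M. \<exists>k::nat. \<exists>a\<in>carrier R. s \<otimes> y [^] k = w y \<oplus> a \<otimes> x"
    by metis
  define S' where "S' = w ` (S - {x})"
  \<comment> \<open>Replace the last but one member of the chain by \<open>P\<close>.\<close>
  define C' where "C' i = (if i = m then P else C i)" for i
  have "m \<le> card S'"
  proof (rule Suc.IH[of S' P C'])
    show "finite S'" "S' \<subseteq> P" using Suc.prems(1) w by (auto simp: S'_def)
    show "primeideal P R" by (rule P)
    show "primeideal (C' i) R" if "i \<le> m" for i using that P Suc.prems(5) by (auto simp: C'_def)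
    show "C' i \<subset> C' (Suc i)" if "i < m" for i
      using that Suc.prems(6)[of i] CP by (auto simp: C'_def)
    show "C' m = P" by (simp add: C'_def)
    fix Q assume Q: "primeideal Q R" "S' \<subseteq> Q" "Q \<subseteq> P"
    show "Q = P"
    proof (rule ccontr)
      assume "Q \<noteq> P"
      then have QP: "Q \<subset> P" using Q by blast
      show False
      proof (rule principal_ideal_theorem[OF Q(1) P M QP PM])
        show "x \<in> M" using x Suc.prems(2) by blast
        fix P' assume P': "primeideal P' R" "Q \<subseteq> P'" "x \<in> P'" "P' \<subseteq> M"
        have iP': "ideal P' R" by (rule ideal_prime[OF P'(1)])
        have "S \<subseteq> P'"
        proof
          fix y assume y: "y \<in> S"
          show "y \<in> P'"
          proof (cases "y = x")
            case False
            then have wQ: "w y \<in> P'" using y Q(2) P'(2) by (auto simp: S'_def)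
            obtain s k a where s: "s \<in> carrier R" "s \<notin> M" and a: "a \<in> carrier R"
              and eq: "s \<otimes> y [^] (k::nat) = w y \<oplus> a \<otimes> x" using w2[OF y] by blast
            have yc: "y \<in> carrier R" using y Suc.prems(2) ideal_carr[OF iM] by blast
            have "s \<otimes> y [^] k \<in> P'" unfolding eq using wQ a P'(3) iP' by (simp add: ideal_simps)
            then have "y [^] k \<in> P'" using primeideal_mult_iff[OF P'(1)] s yc P'(4) by auto
            then show ?thesis by (rule primeideal_pow[OF P'(1) yc])
          qed (use P' in simp)
        qed
        then show "P' = M" using Suc.prems(4) P' by blast
      qed
    qed
  qed
  also have "card S' \<le> card (S - {x})" unfolding S'_def using Suc.prems(1) by (simp add: card_image_le)
  finally show ?case using x Suc.prems(1) by (simp add: card_Diff_singleton) (metis card_gt_0_iff empty_iff Suc_leI Suc_pred le_imp_less_Suc less_Suc_eq_le not_less_eq_eq)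
qed

end

section \<open>Prime avoidance and zero divisors\<close>

context cring
begin

lemma element_outside_prime:
  assumes "finite S" "\<And>Q. Q \<in> S \<Longrightarrow> ideal Q R \<and> \<not> Q \<subseteq> P" and P: "primeideal P R"
  shows "\<exists>c\<in>carrier R. c \<notin> P \<and> (\<forall>Q\<in>S. c \<in> Q)"
  using assms(1,2)
proof (induction S rule: finite_induct)
  case empty
  then show ?case using primeideal_one[OF P] by auto
next
  case (insert Q S)
  then obtain c where c: "c \<in> carrier R" "c \<notin> P" "\<forall>Q\<in>S. c \<in> Q" by auto
  obtain q where q: "q \<in> Q" "q \<notin> P" using insert.prems by auto
  have qc: "q \<in> carrier R" using q insert.prems ideal_carr by blast
  have "q \<otimes> c \<notin> P" using primeideal_mult_iff[OF P qc c(1)] q c by simp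
  moreover have "\<forall>Q'\<in>insert Q S. q \<otimes> c \<in> Q'"
    using q c qc insert.prems by (auto intro: ideal_lmult ideal_rmult)
  ultimately show ?case using qc c by auto
qed

lemma prime_avoidance:
  assumes "finite S" "\<And>P. P \<in> S \<Longrightarrow> primeideal P R"
    and "\<And>P Q. P \<in> S \<Longrightarrow> Q \<in> S \<Longrightarrow> P \<subseteq> Q \<Longrightarrow> P = Q"
    and J: "ideal J R" and "J \<subseteq> \<Union>S"
  shows "\<exists>P\<in>S. J \<subseteq> P"
  using assms(1,2,3,5)
proof (induction S rule: finite_induct)
  case empty
  then show ?case using ideal_zero[OF J] by auto
next
  case (insert P S)
  have P: "primeideal P R" using insert.prems by simp
  show ?case
  proof (rule ccontr)
    assume no: "\<not> ?thesis"
    then have "\<not> (\<exists>Q\<in>S. J \<subseteq> Q)" by simp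
    then have "\<not> J \<subseteq> \<Union>S" using insert.IH insert.prems by (metis insert_iff)
    then obtain a where a: "a \<in> J" "a \<notin> \<Union>S" by blast
    then have aP: "a \<in> P" using insert.prems by auto
    have ac: "a \<in> carrier R" using a J ideal_carr by blast
    obtain b where b: "b \<in> J" "b \<notin> P" using no by auto
    have bc: "b \<in> carrier R" using b J ideal_carr by blast
    have "\<exists>c\<in>carrier R. c \<notin> P \<and> (\<forall>Q\<in>S. c \<in> Q)"
    proof (rule element_outside_prime[OF insert.hyps(1) _ P])
      fix Q assume Q: "Q \<in> S"
      then have "primeideal Q R" using insert.prems(1) by simp
      moreover have "\<not> Q \<subseteq> P"
      proof
        assume "Q \<subseteq> P"
        then have "Q = P" using insert.prems(2)[of Q P] Q by simp
        then show False using Q insert.hyps by simp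
      qed
      ultimately show "ideal Q R \<and> \<not> Q \<subseteq> P" using ideal_prime by simp
    qed
    then obtain c where c: "c \<in> carrier R" "c \<notin> P" "\<forall>Q\<in>S. c \<in> Q" by blast
    have bcP: "b \<otimes> c \<notin> P" using primeideal_mult_iff[OF P bc c(1)] b c by simp
    have "a \<oplus> b \<otimes> c \<in> J" using a b c by (intro ideal_add[OF J] ideal_rmult[OF J]) auto
    then obtain Q where Q: "Q \<in> insert P S" "a \<oplus> b \<otimes> c \<in> Q" using insert.prems(3) by blast
    have iQ: "ideal Q R" using Q(1) insert.prems(1) ideal_prime by blast
    show False
    proof (cases "Q = P")
      case True
      have "(a \<oplus> b \<otimes> c) \<ominus> a \<in> P" using Q True aP iQ ideal_diff by blast
      moreover have "(a \<oplus> b \<otimes> c) \<ominus> a = b \<otimes> c" using ac bc c(1) by algebra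
      ultimately show False using bcP by simp
    next
      case False
      then have QS: "Q \<in> S" using Q by simp
      have "b \<otimes> c \<in> Q" using c(3) QS bc iQ by (simp add: ideal_lmult)
      then have "(a \<oplus> b \<otimes> c) \<ominus> b \<otimes> c \<in> Q" using Q iQ ideal_diff by blast
      moreover have "(a \<oplus> b \<otimes> c) \<ominus> b \<otimes> c = a" using ac bc c(1) by algebra
      ultimately show False using a QS by auto
    qed
  qed
qed

end

context noetherian_cring
begin

text \<open>
The maximal members \<open>\<M>\<close> of the family of ideals \<open>(I : s)\<close> with \<open>s \<notin> I\<close> are prime, and each zero divisor
modulo \<open>I\<close> lies in one of them. They are finite in number: write each \<open>P \<in> \<M>\<close> as \<open>(I : s P)\<close>; finitely many of
the elements \<open>s P\<close> generate the others, so an element common to the corresponding primes kills every \<open>s P\<close>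
modulo \<open>I\<close> and hence lies in every member of \<open>\<M>\<close>. Prime avoidance puts \<open>J\<close> into a single member.
\<close>

lemma zero_divisors_common_annihilator:
  assumes I: "ideal I R" and J: "ideal J R"
    and zd: "\<And>x. x \<in> J \<Longrightarrow> \<exists>a\<in>carrier R. a \<notin> I \<and> x \<otimes> a \<in> I"
  shows "\<exists>s\<in>carrier R. s \<notin> I \<and> (\<forall>x\<in>J. x \<otimes> s \<in> I)"
proof -
  define col where "col s = {t \<in> carrier R. t \<otimes> s \<in> I}" for s
  \<comment> \<open>All proper ideals of the form \<open>(I : s)\<close>.\<close>
  define \<C> where "\<C> = col ` (carrier R - I)"
  define \<M> where "\<M> = {P \<in> \<C>. \<forall>Q\<in>\<C>. P \<subseteq> Q \<longrightarrow> Q = P}"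
  have icol: "ideal (col s) R" if "s \<in> carrier R" for s
    unfolding col_def by (rule ideal_colon[OF I that])
  have prime: "primeideal P R" if P: "P \<in> \<M>" for P
  proof -
    obtain s where s: "s \<in> carrier R" "s \<notin> I" "P = col s" using P by (auto simp: \<M>_def \<C>_def)
    have max: "col u = P" if "u \<in> carrier R" "u \<notin> I" "P \<subseteq> col u" for u
      using P that by (auto simp: \<M>_def \<C>_def)
    show ?thesis
    proof (rule primeidealI)
      show "ideal P R" using s icol by simp
      show "cring R" by (rule is_cring)
      have "\<one> \<notin> P" using s by (simp add: col_def)
      then show "carrier R \<noteq> P" by blast
      fix a b assume a: "a \<in> carrier R" and b: "b \<in> carrier R" and ab: "a \<otimes> b \<in> P"
      show "a \<in> P \<or> b \<in> P"
      proof (rule disjCI)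
        assume nb: "b \<notin> P"
        have bs: "b \<otimes> s \<in> carrier R" "b \<otimes> s \<notin> I" using nb b s by (auto simp: col_def)
        have "P \<subseteq> col (b \<otimes> s)"
        proof
          fix t assume t: "t \<in> P"
          then have tc: "t \<in> carrier R" and "t \<otimes> s \<in> I" using s by (auto simp: col_def)
          then have "b \<otimes> (t \<otimes> s) \<in> I" using b I by (simp add: ideal_lmult)
          moreover have "b \<otimes> (t \<otimes> s) = t \<otimes> (b \<otimes> s)" using b tc s(1) by (simp add: m_lcomm)
          ultimately show "t \<in> col (b \<otimes> s)" using tc by (simp add: col_def)
        qed
        then have eq: "col (b \<otimes> s) = P" by (rule max[OF bs])
        have "a \<otimes> (b \<otimes> s) \<in> I" using ab a b s(1,3) by (simp add: col_def m_assoc)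
        then have "a \<in> col (b \<otimes> s)" using a by (simp add: col_def)
        then show "a \<in> P" using eq by simp
      qed
    qed
  qed
  have ex: "\<exists>s. s \<in> carrier R \<and> s \<notin> I \<and> P = col s" if "P \<in> \<M>" for P
    using that by (auto simp: \<M>_def \<C>_def)
  then obtain s where s: "\<And>P. P \<in> \<M> \<Longrightarrow> s P \<in> carrier R \<and> s P \<notin> I \<and> P = col (s P)"
    by metis
  have sub: "s ` F \<subseteq> carrier R" if "F \<subseteq> \<M>" for F using that s by blast
  let ?G = "{Idl (s ` F) | F. finite F \<and> F \<subseteq> \<M>}"
  have "?G \<noteq> {}" by (auto intro!: exI[of _ "{}"])
  moreover have "\<And>L. L \<in> ?G \<Longrightarrow> ideal L R" using genideal_ideal[OF sub] by blast
  ultimately obtain L where "L \<in> ?G" and Lmax: "\<And>L'. L' \<in> ?G \<Longrightarrow> L \<subseteq> L' \<Longrightarrow> L' = L"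
    using maximal_ideal_in_family[of ?G] by (metis (no_types, lifting))
  then obtain F where F: "finite F" "F \<subseteq> \<M>" "L = Idl (s ` F)" by blast
  have "\<M> \<subseteq> F"
  proof
    fix P assume P: "P \<in> \<M>"
    have PF: "insert P F \<subseteq> \<M>" using P F by blast
    have "L \<subseteq> Idl (s ` insert P F)" unfolding F(3)
      by (rule subset_Idl_subset[OF sub[OF PF]]) (use genideal_self[OF sub[OF PF]] in auto)
    moreover have "Idl (s ` insert P F) \<in> ?G" using F(1) PF by blast
    ultimately have "Idl (s ` insert P F) = L" by (intro Lmax)
    then have sP: "s P \<in> Idl (s ` F)" using genideal_self[OF sub[OF PF]] F(3) by auto
    show "P \<in> F"
    proof (rule ccontr)
      assume nP: "P \<notin> F"
      have "\<exists>c\<in>carrier R. c \<notin> P \<and> (\<forall>Q\<in>F. c \<in> Q)"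
      proof (rule element_outside_prime[OF F(1) _ prime[OF P]])
        fix Q assume Q: "Q \<in> F"
        then have QM: "Q \<in> \<M>" using F by blast
        have "\<not> Q \<subseteq> P"
        proof
          assume "Q \<subseteq> P"
          then have "P = Q" using QM P by (auto simp: \<M>_def)
          then show False using Q nP by simp
        qed
        then show "ideal Q R \<and> \<not> Q \<subseteq> P" using prime[OF QM] ideal_prime by simp
      qed
      then obtain c where c: "c \<in> carrier R" "c \<notin> P" "\<forall>Q\<in>F. c \<in> Q" by blast
      have "s ` F \<subseteq> {t \<in> carrier R. t \<otimes> c \<in> I}"
      proof
        fix y assume "y \<in> s ` F"
        then obtain Q where Q: "Q \<in> F" "y = s Q" by blast
        have Q2: "s Q \<in> carrier R" "Q = col (s Q)" using s[of Q] Q F by auto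
        have "c \<in> col (s Q)" using c(3) Q(1) Q2(2) by blast
        then have "c \<otimes> s Q \<in> I" by (simp add: col_def)
        then show "y \<in> {t \<in> carrier R. t \<otimes> c \<in> I}" using Q Q2(1) c(1) m_comm[of c "s Q"] by simp
      qed
      then have "Idl (s ` F) \<subseteq> {t \<in> carrier R. t \<otimes> c \<in> I}"
        by (rule genideal_minimal[OF ideal_colon[OF I c(1)]])
      then have "s P \<otimes> c \<in> I" using sP by blast
      then have "c \<otimes> s P \<in> I" using c(1) s[OF P] m_comm[of c "s P"] by simp
      then have "c \<in> col (s P)" using c(1) by (simp add: col_def)
      then show False using c(2) s[OF P] by blast
    qed
  qed
  then have fin: "finite \<M>" using F(1) finite_subset by blast
  have "J \<subseteq> \<Union>\<M>"
  proof
    fix x assume x: "x \<in> J"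
    obtain a where a: "a \<in> carrier R" "a \<notin> I" "x \<otimes> a \<in> I" using zd[OF x] by blast
    have xa: "x \<in> col a" using a x J ideal_carr by (auto simp: col_def)
    let ?K = "{Q \<in> \<C>. col a \<subseteq> Q}"
    have "?K \<noteq> {}" using a by (auto simp: \<C>_def)
    moreover have "\<And>Q. Q \<in> ?K \<Longrightarrow> ideal Q R" using icol by (auto simp: \<C>_def)
    ultimately obtain P where P: "P \<in> ?K" "\<And>Q. Q \<in> ?K \<Longrightarrow> P \<subseteq> Q \<Longrightarrow> Q = P"
      using maximal_ideal_in_family[of ?K] by (metis (no_types, lifting))
    have "P \<in> \<M>" unfolding \<M>_def using P by blast
    then show "x \<in> \<Union>\<M>" using P xa by blast
  qed
  then obtain P where P: "P \<in> \<M>" "J \<subseteq> P"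
    using prime_avoidance[OF fin prime _ J] by (auto simp: \<M>_def)
  have "\<forall>x\<in>J. x \<otimes> s P \<in> I"
  proof
    fix x assume "x \<in> J"
    then have "x \<in> col (s P)" using P s[OF P(1)] by blast
    then show "x \<otimes> s P \<in> I" by (simp add: col_def)
  qed
  then show ?thesis using s[OF P(1)] by blast
qed

text \<open>
If \<open>s x ^ k \<in> I\<close> with \<open>s \<notin> Q\<close>, cancelling \<open>x ^ k\<close> would give \<open>s \<in> I \<subseteq> Q\<close>.
\<close>

lemma prime_below_avoiding_nonzerodivisor:
  assumes I: "ideal I R" and x: "x \<in> carrier R" and nzd: "\<And>a. a \<in> carrier R \<Longrightarrow> x \<otimes> a \<in> I \<Longrightarrow> a \<in> I"
    and Q: "primeideal Q R" and IQ: "I \<subseteq> Q"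
  obtains Q' where "primeideal Q' R" "I \<subseteq> Q'" "Q' \<subseteq> Q" "x \<notin> Q'"
proof -
  have nzdp: "a \<in> I" if "a \<in> carrier R" "x [^] (k::nat) \<otimes> a \<in> I" for a k
    using that
  proof (induction k arbitrary: a)
    case 0 then show ?case by simp
  next
    case (Suc k)
    have "x [^] k \<otimes> (x \<otimes> a) \<in> I" using Suc.prems x by (simp add: m_assoc)
    then have "x \<otimes> a \<in> I" using Suc.IH[of "x \<otimes> a"] Suc.prems(1) x by simp
    then show ?case using nzd Suc.prems by blast
  qed
  have miss: "s \<otimes> x [^] (k::nat) \<notin> I" if s: "s \<in> carrier R" "s \<notin> Q" for s k
  proof
    assume "s \<otimes> x [^] k \<in> I"
    then have "x [^] k \<otimes> s \<in> I" using s x m_comm[of s "x [^] k"] by simp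
    then have "s \<in> I" using nzdp s by blast
    then show False using s IQ by blast
  qed
  show ?thesis by (rule prime_missing_powers[OF I Q x miss]) (use that in blast)+
qed

end

section \<open>Regular sequences and Krull dimension of a local ring\<close>

context noetherian_local_ring
begin

lemma ideal_max: "ideal \<mm> A" by (rule is_ideal)

lemma prime_max: "primeideal \<mm> A"
  by (rule maximalideal_prime) (rule is_maximalideal)

lemma max_carr: "a \<in> \<mm> \<Longrightarrow> a \<in> carrier A"
  by (rule ideal_carr[OF ideal_max])

lemma one_not_max: "\<one> \<notin> \<mm>"
  by (rule primeideal_one[OF prime_max])

text \<open>
A proper ideal containing \<open>a\<close> would lie in a maximal ideal, hence in \<open>\<mm>\<close>.
\<close>

lemma inverse_outside_max:
  assumes a: "a \<in> carrier A" "a \<notin> \<mm>"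
  obtains b where "b \<in> carrier A" "b \<otimes> a = \<one>"
proof -
  let ?I = "adjoin A {\<zero>} a"
  have iI: "ideal ?I A" by (rule ideal_adjoin[OF zeroideal a(1)])
  have "\<one> \<in> ?I"
  proof (rule ccontr)
    assume one: "\<one> \<notin> ?I"
    let ?C = "{J. ideal J A \<and> ?I \<subseteq> J \<and> \<one> \<notin> J}"
    obtain J where J: "J \<in> ?C" and max: "\<And>K. K \<in> ?C \<Longrightarrow> J \<subseteq> K \<Longrightarrow> K = J"
      by (rule maximal_ideal_in_family[of ?C]) (use one iI in auto)
    have "maximalideal J A"
    proof (rule maximalidealI)
      show "ideal J A" using J by simp
      show "carrier A \<noteq> J" using J by auto
      fix K assume K: "ideal K A" "J \<subseteq> K" "K \<subseteq> carrier A"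
      show "K = J \<or> K = carrier A"
        using max[of K] K J ideal.one_imp_carrier[OF K(1)] by blast
    qed
    then have "J = \<mm>" by (rule maximal_unique)
    then show False using J adjoin_self[OF zeroideal a(1)] a by blast
  qed
  then obtain r where "r \<in> carrier A" "\<one> = \<zero> \<oplus> r \<otimes> a" by (auto elim: adjoinE)
  then show ?thesis using that a by simp
qed

text \<open>
The ideals generated by a regular sequence of length \<open>n\<close> in \<open>\<mm>\<close>, without keeping the sequence itself.
\<close>

inductive reg_ideal :: "nat \<Rightarrow> 'a set \<Rightarrow> bool" where
  reg_0: "reg_ideal 0 {\<zero>}"
| reg_Suc: "reg_ideal n I \<Longrightarrow> x \<in> \<mm> \<Longrightarrow> (\<And>a. a \<in> carrier A \<Longrightarrow> x \<otimes> a \<in> I \<Longrightarrow> a \<in> I)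
    \<Longrightarrow> reg_ideal (Suc n) (adjoin A I x)"

lemma reg_ideal_ideal: "reg_ideal n I \<Longrightarrow> ideal I A \<and> I \<subseteq> \<mm>"
proof (induction rule: reg_ideal.induct)
  case reg_0
  then show ?case using zeroideal ideal_zero[OF ideal_max] by auto
next
  case (reg_Suc n I x)
  then show ?case using ideal_adjoin[of I x] adjoin_minimal[OF ideal_max, of I x] max_carr by auto
qed

lemma reg_ideal_prime_chain:
  assumes "reg_ideal n I" "primeideal Q A" "I \<subseteq> Q"
  shows "\<exists>C. (\<forall>i\<le>n. primeideal (C i) A) \<and> (\<forall>i<n. C i \<subset> C (Suc i)) \<and> C n = Q"
  using assms
proof (induction arbitrary: Q rule: reg_ideal.induct)
  case reg_0
  then show ?case by (intro exI[of _ "\<lambda>_. Q"]) auto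
next
  case (reg_Suc n I x)
  have iI: "ideal I A" using reg_ideal_ideal reg_Suc by blast
  have xc: "x \<in> carrier A" using reg_Suc max_carr by blast
  have IQ: "I \<subseteq> Q" "x \<in> Q" using reg_Suc.prems adjoin_superset[OF iI xc] adjoin_self[OF iI xc] by auto
  obtain Q' where Q': "primeideal Q' A" "I \<subseteq> Q'" "Q' \<subseteq> Q" "x \<notin> Q'"
    by (rule prime_below_avoiding_nonzerodivisor[OF iI xc reg_Suc.hyps(3) reg_Suc.prems(1) IQ(1)])
  obtain C where C: "\<forall>i\<le>n. primeideal (C i) A" "\<forall>i<n. C i \<subset> C (Suc i)" "C n = Q'"
    using reg_Suc.IH[OF Q'(1,2)] by blast
  define C' where "C' i = (if i = Suc n then Q else C i)" for i
  have "\<forall>i\<le>Suc n. primeideal (C' i) A" using C(1) reg_Suc.prems(1) by (auto simp: C'_def le_Suc_eq)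
  moreover have "\<forall>i<Suc n. C' i \<subset> C' (Suc i)"
    using C(2,3) Q' IQ by (auto simp: C'_def less_Suc_eq)
  ultimately show ?case by (intro exI[of _ C']) (auto simp: C'_def)
qed

lemma reg_ideal_le_krull_dim:
  assumes "reg_ideal n I"
  shows "enat n \<le> krull_dim A"
proof -
  obtain C where "(\<forall>i\<le>n. primeideal (C i) A) \<and> (\<forall>i<n. C i \<subset> C (Suc i))"
    using reg_ideal_prime_chain[OF assms prime_max] reg_ideal_ideal[OF assms] by blast
  then show ?thesis unfolding krull_dim_def by (intro Sup_upper) blast
qed

lemma krull_dim_le_generators:
  assumes S: "finite S" "S \<subseteq> carrier A" "\<mm> = Idl S"
  shows "krull_dim A \<le> enat (card S)"
  unfolding krull_dim_def
proof (rule Sup_least)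
  fix d assume "d \<in> {enat n | n. \<exists>P :: nat \<Rightarrow> 'a set.
     (\<forall>i\<le>n. primeideal (P i) A) \<and> (\<forall>i<n. P i \<subset> P (Suc i))}"
  then obtain n and P :: "nat \<Rightarrow> 'a set" where d: "d = enat n"
    and P: "\<forall>i\<le>n. primeideal (P i) A" "\<forall>i<n. P i \<subset> P (Suc i)" by blast
  have le: "Q \<subseteq> \<mm>" if "primeideal Q A" for Q
  proof
    fix a assume a: "a \<in> Q"
    have iQ: "ideal Q A" using that ideal_prime by blast
    show "a \<in> \<mm>"
    proof (rule ccontr)
      assume "a \<notin> \<mm>"
      moreover have ac: "a \<in> carrier A" using a iQ ideal_carr by blast
      ultimately obtain b where "b \<in> carrier A" "b \<otimes> a = \<one>" using inverse_outside_max by blast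
      then have "\<one> \<in> Q" using a iQ ideal_lmult by metis
      then show False using primeideal_one[OF that] by simp
    qed
  qed
  define C where "C i = (if i = n then \<mm> else P i)" for i
  have Pn: "P n \<subseteq> \<mm>" using le P(1) by blast
  have "n \<le> card S"
  proof (rule height_theorem[OF S(1) _ prime_max])
    show "S \<subseteq> \<mm>" using genideal_self[OF S(2)] S(3) by simp
    show "Q = \<mm>" if Q: "primeideal Q A" "S \<subseteq> Q" "Q \<subseteq> \<mm>" for Q
      using genideal_minimal[OF ideal_prime[OF Q(1)] Q(2)] Q(3) S(3) by blast
    show "primeideal (C i) A" if "i \<le> n" for i using that P(1) prime_max by (simp add: C_def)
    show "C i \<subset> C (Suc i)" if "i < n" for i
      using that P(2)[rule_format, OF that] Pn by (auto simp: C_def)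
    show "C n = \<mm>" by (simp add: C_def)
  qed
  then show "d \<le> enat (card S)" using d by simp
qed

lemma regularI:
  assumes "noetherian_local_ring A \<mm>" and reg: "reg_ideal n I" and "r \<le> n"
    and S: "finite S" "S \<subseteq> carrier A" "\<mm> = Idl S" "card S \<le> r"
  shows "regular_local_ring A \<mm>"
proof -
  let ?Q = "\<lambda>n. \<exists>S \<subseteq> carrier A. finite S \<and> card S = n \<and> \<mm> = Idl S"
  have "?Q (card S)" using S by blast
  then have Q: "?Q (embdim A \<mm>)" and le: "embdim A \<mm> \<le> card S"
    unfolding embdim_def by (rule LeastI, rule Least_le)
  obtain T where T: "T \<subseteq> carrier A" "finite T" "card T = embdim A \<mm>" "\<mm> = Idl T" using Q by blast
  have "krull_dim A \<le> enat (embdim A \<mm>)" using krull_dim_le_generators[OF T(2,1,4)] T(3) by simp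
  moreover have "enat (embdim A \<mm>) \<le> enat n" using le S \<open>r \<le> n\<close> by simp
  moreover have "enat n \<le> krull_dim A" by (rule reg_ideal_le_krull_dim[OF reg])
  ultimately have "krull_dim A = enat (embdim A \<mm>)" by (meson antisym order_trans)
  then show ?thesis unfolding regular_local_ring_def using assms(1) by simp
qed

end

section \<open>Free modules, dual bases and lifting\<close>

text \<open>
The elements of \<open>free_mod R B\<close> are the finitely supported functions on \<open>B\<close>, extended by \<open>0\<close>. The set \<open>B\<close>
may be infinite, as it is for the free cover of an arbitrary projective module.
\<close>

definition free_mod :: "('a, 'r) ring_scheme \<Rightarrow> 'i set \<Rightarrow> ('a, 'i \<Rightarrow> 'a) module" where
  "free_mod R B = \<lparr>carrier = {z. (\<forall>i. z i \<in> carrier R) \<and> finite {i. z i \<noteq> \<zero>\<^bsub>R\<^esub>} \<and> (\<forall>i. i \<notin> B \<longrightarrow> z i = \<zero>\<^bsub>R\<^esub>)},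
     mult = (\<lambda>_ _ _. \<zero>\<^bsub>R\<^esub>), one = (\<lambda>_. \<zero>\<^bsub>R\<^esub>), zero = (\<lambda>_. \<zero>\<^bsub>R\<^esub>),
     add = (\<lambda>x y i. x i \<oplus>\<^bsub>R\<^esub> y i), smult = (\<lambda>a x i. a \<otimes>\<^bsub>R\<^esub> x i)\<rparr>"

definition delta :: "('a, 'r) ring_scheme \<Rightarrow> 'i \<Rightarrow> 'i \<Rightarrow> 'a" where
  "delta R i = (\<lambda>j. if j = i then \<one>\<^bsub>R\<^esub> else \<zero>\<^bsub>R\<^esub>)"

definition lin :: "('a, 'r) ring_scheme \<Rightarrow> ('a, 'x, 'm) module_scheme \<Rightarrow> ('i \<Rightarrow> 'x) \<Rightarrow> ('i \<Rightarrow> 'a) \<Rightarrow> 'x" where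
  "lin R X b z = finsum X (\<lambda>i. z i \<odot>\<^bsub>X\<^esub> b i) {i. z i \<noteq> \<zero>\<^bsub>R\<^esub>}"

text \<open>
The dual basis criterion: \<open>b\<close> maps a free module onto \<open>X\<close>, and \<open>c\<close> splits this map. Unlike the lifting
property that defines projective modules, it does not refer to modules of particular types.
\<close>

definition dual_basis :: "('a, 'r) ring_scheme \<Rightarrow> ('a, 'x, 'm) module_scheme \<Rightarrow> 'i set
    \<Rightarrow> ('i \<Rightarrow> 'x) \<Rightarrow> ('x \<Rightarrow> 'i \<Rightarrow> 'a) \<Rightarrow> bool" where
  "dual_basis R X B b c \<longleftrightarrow> c \<in> mod_hom R X (free_mod R B) \<and> b \<in> B \<rightarrow> carrier X
     \<and> (\<forall>x\<in>carrier X. lin R X b (c x) = x)"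

text \<open>
The dual bases are parameters, because an existential quantifier in a definition could not range over their
index type.
\<close>

definition projective_complex :: "('a, 'r) ring_scheme \<Rightarrow> (nat \<Rightarrow> ('a, 'x, 'm) module_scheme)
    \<Rightarrow> (nat \<Rightarrow> 'x \<Rightarrow> 'x) \<Rightarrow> (nat \<Rightarrow> 'i set) \<Rightarrow> (nat \<Rightarrow> 'i \<Rightarrow> 'x) \<Rightarrow> (nat \<Rightarrow> 'x \<Rightarrow> 'i \<Rightarrow> 'a) \<Rightarrow> bool" where
  "projective_complex R X d B b c \<longleftrightarrow>
     (\<forall>i. module R (X i) \<and> dual_basis R (X i) (B i) (b i) (c i) \<and> d i \<in> mod_hom R (X (Suc i)) (X i)
        \<and> (\<forall>x\<in>carrier (X (Suc (Suc i))). d i (d (Suc i) x) = \<zero>\<^bsub>X i\<^esub>))"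

text \<open>
Exactness is in positive degrees, so that \<open>Y\<close> resolves the cokernel of its first differential.
\<close>

definition acyclic_complex :: "('a, 'r) ring_scheme \<Rightarrow> (nat \<Rightarrow> ('a, 'x, 'm) module_scheme)
    \<Rightarrow> (nat \<Rightarrow> 'x \<Rightarrow> 'x) \<Rightarrow> bool" where
  "acyclic_complex R Y d \<longleftrightarrow>
     (\<forall>i. module R (Y i) \<and> d i \<in> mod_hom R (Y (Suc i)) (Y i)
        \<and> (\<forall>y\<in>carrier (Y (Suc i)). d i y = \<zero>\<^bsub>Y i\<^esub> \<longrightarrow> y \<in> d (Suc i) ` carrier (Y (Suc (Suc i)))))"

lemma projective_complex_shift:
  "projective_complex R X d B b c \<Longrightarrow> projective_complex R (\<lambda>i. X (Suc i)) (\<lambda>i. d (Suc i))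
    (\<lambda>i. B (Suc i)) (\<lambda>i. b (Suc i)) (\<lambda>i. c (Suc i))"
  by (simp add: projective_complex_def)

lemma hom_closed: "f \<in> mod_hom R X Y \<Longrightarrow> x \<in> carrier X \<Longrightarrow> f x \<in> carrier Y"
  by (auto simp: mod_hom_def)

lemma hom_add: "f \<in> mod_hom R X Y \<Longrightarrow> x \<in> carrier X \<Longrightarrow> y \<in> carrier X
    \<Longrightarrow> f (x \<oplus>\<^bsub>X\<^esub> y) = f x \<oplus>\<^bsub>Y\<^esub> f y"
  by (auto simp: mod_hom_def)

lemma hom_smult: "f \<in> mod_hom R X Y \<Longrightarrow> a \<in> carrier R \<Longrightarrow> x \<in> carrier X
    \<Longrightarrow> f (a \<odot>\<^bsub>X\<^esub> x) = a \<odot>\<^bsub>Y\<^esub> f x"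
  by (auto simp: mod_hom_def)

lemma homI:
  assumes "\<And>x. x \<in> carrier X \<Longrightarrow> f x \<in> carrier Y"
    and "\<And>x y. x \<in> carrier X \<Longrightarrow> y \<in> carrier X \<Longrightarrow> f (x \<oplus>\<^bsub>X\<^esub> y) = f x \<oplus>\<^bsub>Y\<^esub> f y"
    and "\<And>a x. a \<in> carrier R \<Longrightarrow> x \<in> carrier X \<Longrightarrow> f (a \<odot>\<^bsub>X\<^esub> x) = a \<odot>\<^bsub>Y\<^esub> f x"
  shows "f \<in> mod_hom R X Y"
  using assms by (auto simp: mod_hom_def)

lemma hom_zero:
  assumes "module R X" "module R Y" "f \<in> mod_hom R X Y"
  shows "f \<zero>\<^bsub>X\<^esub> = \<zero>\<^bsub>Y\<^esub>"
proof -
  interpret X: module R X by fact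
  interpret Y: module R Y by fact
  have "f (\<zero>\<^bsub>R\<^esub> \<odot>\<^bsub>X\<^esub> \<zero>\<^bsub>X\<^esub>) = \<zero>\<^bsub>R\<^esub> \<odot>\<^bsub>Y\<^esub> f \<zero>\<^bsub>X\<^esub>"
    by (rule hom_smult[OF assms(3)]) auto
  moreover have "\<zero>\<^bsub>R\<^esub> \<odot>\<^bsub>X\<^esub> \<zero>\<^bsub>X\<^esub> = \<zero>\<^bsub>X\<^esub>" by simp
  moreover have "\<zero>\<^bsub>R\<^esub> \<odot>\<^bsub>Y\<^esub> f \<zero>\<^bsub>X\<^esub> = \<zero>\<^bsub>Y\<^esub>" using hom_closed[OF assms(3)] by simp
  ultimately show ?thesis by simp
qed

lemma hom_neg:
  assumes "module R X" "module R Y" "f \<in> mod_hom R X Y" "x \<in> carrier X"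
  shows "f (\<ominus>\<^bsub>X\<^esub> x) = \<ominus>\<^bsub>Y\<^esub> f x"
proof -
  interpret X: module R X by fact
  interpret Y: module R Y by fact
  have fx: "f x \<in> carrier Y" by (rule hom_closed[OF assms(3,4)])
  have "f (\<ominus>\<^bsub>X\<^esub> x) \<oplus>\<^bsub>Y\<^esub> f x = f (\<ominus>\<^bsub>X\<^esub> x \<oplus>\<^bsub>X\<^esub> x)"
    by (rule hom_add[OF assms(3), symmetric]) (use assms(4) in auto)
  also have "\<dots> = \<zero>\<^bsub>Y\<^esub>" using assms(4) hom_zero[OF assms(1-3)] X.M.l_neg by simp
  finally show ?thesis using fx assms(4) hom_closed[OF assms(3)] Y.M.minus_equality by simp
qed

lemma hom_diff:
  assumes "module R X" "module R Y" "f \<in> mod_hom R X Y" "x \<in> carrier X" "y \<in> carrier X"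
  shows "f (x \<ominus>\<^bsub>X\<^esub> y) = f x \<ominus>\<^bsub>Y\<^esub> f y"
proof -
  interpret X: module R X by fact
  interpret Y: module R Y by fact
  show ?thesis using assms by (simp add: a_minus_def hom_neg hom_add[OF assms(3)])
qed

lemma hom_comp:
  assumes "f \<in> mod_hom R X Y" "g \<in> mod_hom R Y Z"
  shows "(\<lambda>x. g (f x)) \<in> mod_hom R X Z"
  using assms by (auto simp: mod_hom_def Pi_iff)

lemma hom_sum:
  assumes "module R Y" "f \<in> mod_hom R X Y" "g \<in> mod_hom R X Y"
  shows "(\<lambda>x. f x \<oplus>\<^bsub>Y\<^esub> g x) \<in> mod_hom R X Y"
proof -
  interpret Y: module R Y by fact
  note c = hom_closed[OF assms(2)] hom_closed[OF assms(3)]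
  show ?thesis
    by (rule homI) (auto simp: c hom_add[OF assms(2)] hom_add[OF assms(3)] hom_smult[OF assms(2)]
        hom_smult[OF assms(3)] Y.smult_r_distr Y.M.a_ac)
qed

lemma hom_scale:
  assumes "module R Y" "f \<in> mod_hom R X Y" "a \<in> carrier R"
  shows "(\<lambda>x. a \<odot>\<^bsub>Y\<^esub> f x) \<in> mod_hom R X Y"
proof -
  interpret Y: module R Y by fact
  note c = hom_closed[OF assms(2)] assms(3)
  show ?thesis
  proof (rule homI)
    fix r x assume r: "r \<in> carrier R" "x \<in> carrier X"
    then show "a \<odot>\<^bsub>Y\<^esub> f (r \<odot>\<^bsub>X\<^esub> x) = r \<odot>\<^bsub>Y\<^esub> (a \<odot>\<^bsub>Y\<^esub> f x)"
      using c Y.R.m_comm[of a r] by (simp add: hom_smult[OF assms(2)] flip: Y.smult_assoc1)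
  qed (auto simp: c hom_add[OF assms(2)] Y.smult_r_distr)
qed

lemma hom_minus:
  assumes "module R Y" "f \<in> mod_hom R X Y"
  shows "(\<lambda>x. \<ominus>\<^bsub>Y\<^esub> f x) \<in> mod_hom R X Y"
proof -
  interpret Y: module R Y by fact
  note c = hom_closed[OF assms(2)]
  show ?thesis
    by (rule homI) (auto simp: c hom_add[OF assms(2)] hom_smult[OF assms(2)] Y.M.minus_add Y.smult_r_minus)
qed

lemma hom_subtract:
  assumes "module R Y" "f \<in> mod_hom R X Y" "g \<in> mod_hom R X Y"
  shows "(\<lambda>x. f x \<ominus>\<^bsub>Y\<^esub> g x) \<in> mod_hom R X Y"
  using hom_sum[OF assms(1,2) hom_minus[OF assms(1,3)]] by (simp add: a_minus_def)

lemma hom_const_zero: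
  assumes "module R Y"
  shows "(\<lambda>x. \<zero>\<^bsub>Y\<^esub>) \<in> mod_hom R X Y"
proof -
  interpret Y: module R Y by fact
  show ?thesis by (rule homI) auto
qed

lemma hom_ident: "(\<lambda>x. x) \<in> mod_hom R X X"
  by (rule homI) auto

context cring
begin

lemma free_mod_sel [simp]:
  "zero (free_mod R B) = (\<lambda>_. \<zero>)"
  "x \<oplus>\<^bsub>free_mod R B\<^esub> y = (\<lambda>i. x i \<oplus> y i)"
  "a \<odot>\<^bsub>free_mod R B\<^esub> x = (\<lambda>i. a \<otimes> x i)"
  by (simp_all add: free_mod_def)

lemma free_mod_carrier:
  "z \<in> carrier (free_mod R B) \<longleftrightarrow>
     (\<forall>i. z i \<in> carrier R) \<and> finite {i. z i \<noteq> \<zero>} \<and> (\<forall>i. i \<notin> B \<longrightarrow> z i = \<zero>)"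
  by (simp add: free_mod_def)

lemma module_free: "module R (free_mod R (B :: 'i set))"
proof (rule moduleI)
  show "cring R" by (rule is_cring)
  have add: "(\<lambda>i. x i \<oplus> y i) \<in> carrier (free_mod R B)"
    if "x \<in> carrier (free_mod R B)" "y \<in> carrier (free_mod R B)" for x y :: "'i \<Rightarrow> 'a"
  proof -
    have "{i. x i \<oplus> y i \<noteq> \<zero>} \<subseteq> {i. x i \<noteq> \<zero>} \<union> {i. y i \<noteq> \<zero>}" by auto
    then show ?thesis using that by (auto simp: free_mod_carrier intro: finite_subset)
  qed
  have scale: "(\<lambda>i. a \<otimes> x i) \<in> carrier (free_mod R B)"
    if "x \<in> carrier (free_mod R B)" "a \<in> carrier R" for x :: "'i \<Rightarrow> 'a" and a
  proof -
    have "{i. a \<otimes> x i \<noteq> \<zero>} \<subseteq> {i. x i \<noteq> \<zero>}" using that(2) by auto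
    then show ?thesis using that by (auto simp: free_mod_carrier intro: finite_subset)
  qed
  show "abelian_group (free_mod R B)"
  proof (rule abelian_groupI)
    fix x assume x: "x \<in> carrier (free_mod R B)"
    have "(\<lambda>i. \<ominus> \<one> \<otimes> x i) \<in> carrier (free_mod R B)" by (rule scale[OF x]) simp
    moreover have "(\<lambda>i. (\<ominus> \<one> \<otimes> x i) \<oplus> x i) = (\<lambda>_. \<zero>)"
      using x by (auto simp: free_mod_carrier l_minus l_neg)
    ultimately show "\<exists>y\<in>carrier (free_mod R B). y \<oplus>\<^bsub>free_mod R B\<^esub> x = \<zero>\<^bsub>free_mod R B\<^esub>"
      by (auto intro!: bexI[of _ "\<lambda>i. \<ominus> \<one> \<otimes> x i"])
  qed (auto simp: add, auto simp: free_mod_carrier a_ac)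
qed (auto simp: free_mod_carrier l_distr r_distr m_assoc fun_eq_iff intro: rev_finite_subset)

lemma delta_carrier: "i \<in> B \<Longrightarrow> delta R i \<in> carrier (free_mod R B)"
proof -
  assume "i \<in> B"
  moreover have "finite {j. delta R i j \<noteq> \<zero>}"
    by (rule finite_subset[of _ "{i}"]) (auto simp: delta_def)
  ultimately show ?thesis by (auto simp: free_mod_carrier delta_def)
qed

lemma lin_eq:
  assumes X: "module R X" and z: "z \<in> carrier (free_mod R B)" and b: "b \<in> B \<rightarrow> carrier X"
    and T: "finite T" "T \<subseteq> B" "{i. z i \<noteq> \<zero>} \<subseteq> T"
  shows "lin R X b z = finsum X (\<lambda>i. z i \<odot>\<^bsub>X\<^esub> b i) T"
proof -
  interpret X: module R X by fact
  have zc: "z i \<in> carrier R" for i using z by (simp add: free_mod_carrier)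
  show ?thesis unfolding lin_def
  proof (rule X.M.add.finprod_mono_neutral_cong_left)
    show "finite T" "{i. z i \<noteq> \<zero>} \<subseteq> T" by fact+
    show "z i \<odot>\<^bsub>X\<^esub> b i = \<zero>\<^bsub>X\<^esub>" if "i \<in> T - {i. z i \<noteq> \<zero>}" for i
    proof -
      have "b i \<in> carrier X" using that T(2) b by auto
      then show ?thesis using that by simp
    qed
    show "(\<lambda>i. z i \<odot>\<^bsub>X\<^esub> b i) \<in> T \<rightarrow> carrier X" using zc b T(2) by auto
  qed simp
qed

lemma lin_hom:
  assumes X: "module R X" and b: "b \<in> B \<rightarrow> carrier X"
  shows "lin R X b \<in> mod_hom R (free_mod R B) X"
proof -
  interpret X: module R X by fact
  interpret F: module R "free_mod R B" by (rule module_free)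
  have supp: "finite {i. z i \<noteq> \<zero>}" "{i. z i \<noteq> \<zero>} \<subseteq> B" "\<And>i. z i \<in> carrier R"
    if "z \<in> carrier (free_mod R B)" for z using that by (auto simp: free_mod_carrier)
  show ?thesis
  proof (rule homI)
    fix z assume z: "z \<in> carrier (free_mod R B)"
    show "lin R X b z \<in> carrier X" unfolding lin_def
      by (rule X.M.finsum_closed) (use supp[OF z] b in auto)
    fix a assume a: "a \<in> carrier R"
    have "lin R X b (a \<odot>\<^bsub>free_mod R B\<^esub> z) = finsum X (\<lambda>i. (a \<otimes> z i) \<odot>\<^bsub>X\<^esub> b i) {i. z i \<noteq> \<zero>}"
      using a by (subst lin_eq[OF X F.smult_closed[OF a z] b supp(1,2)[OF z]]) auto
    also have "\<dots> = finsum X (\<lambda>i. a \<odot>\<^bsub>X\<^esub> (z i \<odot>\<^bsub>X\<^esub> b i)) {i. z i \<noteq> \<zero>}"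
      by (rule X.M.finsum_cong') (use a supp[OF z] b in \<open>auto simp: X.smult_assoc1 Pi_iff subset_iff\<close>)
    also have "\<dots> = a \<odot>\<^bsub>X\<^esub> lin R X b z" unfolding lin_def
      by (rule X.finsum_smult_ldistr[symmetric]) (use a supp[OF z] b in auto)
    finally show "lin R X b (a \<odot>\<^bsub>free_mod R B\<^esub> z) = a \<odot>\<^bsub>X\<^esub> lin R X b z" .
  next
    fix y z assume y: "y \<in> carrier (free_mod R B)" and z: "z \<in> carrier (free_mod R B)"
    let ?T = "{i. y i \<noteq> \<zero>} \<union> {i. z i \<noteq> \<zero>}"
    have T: "finite ?T" "?T \<subseteq> B" using supp[OF y] supp[OF z] by auto
    have "lin R X b (y \<oplus>\<^bsub>free_mod R B\<^esub> z) = finsum X (\<lambda>i. (y i \<oplus> z i) \<odot>\<^bsub>X\<^esub> b i) ?T"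
      by (subst lin_eq[OF X F.add.m_closed[OF y z] b T]) auto
    also have "\<dots> = finsum X (\<lambda>i. y i \<odot>\<^bsub>X\<^esub> b i \<oplus>\<^bsub>X\<^esub> z i \<odot>\<^bsub>X\<^esub> b i) ?T"
      by (rule X.M.finsum_cong') (use supp[OF y] supp[OF z] b in \<open>auto simp: X.smult_l_distr Pi_iff subset_iff\<close>)
    also have "\<dots> = finsum X (\<lambda>i. y i \<odot>\<^bsub>X\<^esub> b i) ?T \<oplus>\<^bsub>X\<^esub> finsum X (\<lambda>i. z i \<odot>\<^bsub>X\<^esub> b i) ?T"
      by (rule X.M.finsum_addf) (use supp[OF y] supp[OF z] b in \<open>auto simp: Pi_iff subset_iff\<close>)
    also have "\<dots> = lin R X b y \<oplus>\<^bsub>X\<^esub> lin R X b z"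
      using lin_eq[OF X y b T] lin_eq[OF X z b T] by simp
    finally show "lin R X b (y \<oplus>\<^bsub>free_mod R B\<^esub> z) = lin R X b y \<oplus>\<^bsub>X\<^esub> lin R X b z" .
  qed
qed

lemma lin_delta:
  assumes X: "module R X" and b: "b \<in> B \<rightarrow> carrier X" and i: "i \<in> B"
  shows "lin R X b (delta R i) = b i"
proof -
  interpret X: module R X by fact
  have bi: "b i \<in> carrier X" using b i by auto
  have "lin R X b (delta R i) = finsum X (\<lambda>j. delta R i j \<odot>\<^bsub>X\<^esub> b j) {i}"
    by (rule lin_eq[OF X delta_carrier[OF i] b]) (use i in \<open>auto simp: delta_def\<close>)
  also have "\<dots> = b i" using bi by (simp add: delta_def)
  finally show ?thesis .
qed

lemma lin_mem_submodule:
  assumes X: "module R X" and H: "submodule H R X"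
    and z: "\<And>i. z i \<noteq> \<zero> \<Longrightarrow> z i \<odot>\<^bsub>X\<^esub> b i \<in> H"
  shows "lin R X b z \<in> H"
proof -
  interpret X: module R X by fact
  interpret H: submodule H R X by fact
  have HX: "H \<subseteq> carrier X" using X.submoduleE(1)[OF H] .
  have "finsum X (\<lambda>i. z i \<odot>\<^bsub>X\<^esub> b i) T \<in> H" if "T \<subseteq> {i. z i \<noteq> \<zero>}" for T
  proof (cases "finite T")
    case True
    then show ?thesis using that
    proof (induction T rule: finite_induct)
      case empty
      then show ?case using H.one_closed by simp
    next
      case (insert i T)
      have "(\<lambda>i. z i \<odot>\<^bsub>X\<^esub> b i) \<in> T \<rightarrow> carrier X" "z i \<odot>\<^bsub>X\<^esub> b i \<in> carrier X"
        using z HX insert.prems by auto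
      then show ?case using insert z X.submoduleE(5)[OF H] by simp
    qed
  next
    case False
    then show ?thesis using H.one_closed by simp
  qed
  then show ?thesis unfolding lin_def by simp
qed

lemma hom_lin:
  assumes X: "module R X" and Y: "module R Y" and f: "f \<in> mod_hom R X Y"
    and b: "b \<in> B \<rightarrow> carrier X" and z: "z \<in> carrier (free_mod R B)"
  shows "f (lin R X b z) = lin R Y (\<lambda>i. f (b i)) z"
proof -
  interpret X: module R X by fact
  interpret Y: module R Y by fact
  have zc: "\<And>i. z i \<in> carrier R" and fin: "finite {i. z i \<noteq> \<zero>}" and sB: "{i. z i \<noteq> \<zero>} \<subseteq> B"
    using z by (auto simp: free_mod_carrier)
  have "f (finsum X (\<lambda>i. z i \<odot>\<^bsub>X\<^esub> b i) T) = finsum Y (\<lambda>i. z i \<odot>\<^bsub>Y\<^esub> f (b i)) T"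
    if "finite T" "T \<subseteq> B" for T
    using that
  proof (induction T rule: finite_induct)
    case empty
    then show ?case using hom_zero[OF X Y f] by simp
  next
    case (insert i T)
    have 1: "(\<lambda>i. z i \<odot>\<^bsub>X\<^esub> b i) \<in> T \<rightarrow> carrier X" "z i \<odot>\<^bsub>X\<^esub> b i \<in> carrier X" "b i \<in> carrier X"
      using zc b insert.prems by auto
    have 2: "(\<lambda>i. z i \<odot>\<^bsub>Y\<^esub> f (b i)) \<in> T \<rightarrow> carrier Y" "z i \<odot>\<^bsub>Y\<^esub> f (b i) \<in> carrier Y"
      using zc b insert.prems hom_closed[OF f] by (auto simp: Pi_iff subset_iff)
    show ?case using insert 1 2 X.M.finsum_closed[OF 1(1)]
      by (simp add: hom_add[OF f] hom_smult[OF f] zc)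
  qed
  then show ?thesis unfolding lin_def using fin sB by simp
qed

lemma finsum_free_apply:
  assumes "finite T" "f \<in> T \<rightarrow> carrier (free_mod R B)"
  shows "finsum (free_mod R B) f T k = (\<Oplus>i\<in>T. f i k)"
  using assms
proof (induction T rule: finite_induct)
  case empty
  interpret F: module R "free_mod R B" by (rule module_free)
  show ?case by simp
next
  case (insert i T)
  interpret F: module R "free_mod R B" by (rule module_free)
  have "(\<lambda>i. f i k) \<in> T \<rightarrow> carrier R" "f i k \<in> carrier R"
    using insert.prems by (auto simp: free_mod_carrier Pi_iff)
  then show ?case using insert by simp
qed

lemma dual_basis_free: "dual_basis R (free_mod R B) B (delta R) (\<lambda>z. z)"
  unfolding dual_basis_def
proof (intro conjI ballI)
  show "(\<lambda>z. z) \<in> mod_hom R (free_mod R B) (free_mod R B)" by (rule hom_ident)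
  show "delta R \<in> B \<rightarrow> carrier (free_mod R B)" using delta_carrier by auto
  fix z assume z: "z \<in> carrier (free_mod R B)"
  interpret F: module R "free_mod R B" by (rule module_free)
  let ?S = "{i. z i \<noteq> \<zero>}"
  have zc: "\<And>i. z i \<in> carrier R" and fin: "finite ?S" and sB: "?S \<subseteq> B"
    using z by (auto simp: free_mod_carrier)
  show "lin R (free_mod R B) (delta R) z = z"
  proof
    fix k
    have c: "z i \<odot>\<^bsub>free_mod R B\<^esub> delta R i \<in> carrier (free_mod R B)" if "i \<in> ?S" for i
      by (rule F.smult_closed[OF zc delta_carrier]) (use that sB in auto)
    have "lin R (free_mod R B) (delta R) z k = (\<Oplus>i\<in>?S. (z i \<odot>\<^bsub>free_mod R B\<^esub> delta R i) k)"
      unfolding lin_def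
      by (rule finsum_free_apply[OF fin]) (use c in blast)
    also have "\<dots> = (\<Oplus>i\<in>?S. if k = i then z i else \<zero>)"
      by (rule add.finprod_cong') (auto simp: delta_def zc)
    also have "\<dots> = z k"
    proof (cases "k \<in> ?S")
      case True
      then show ?thesis using fin zc by (intro add.finprod_singleton) auto
    next
      case False
      then have "(\<Oplus>i\<in>?S. if k = i then z i else \<zero>) = (\<Oplus>i\<in>?S. \<zero>)"
        by (intro add.finprod_cong') auto
      then show ?thesis using False by simp
    qed
    finally show "lin R (free_mod R B) (delta R) z k = z k" .
  qed
qed

text \<open>
The tautological surjection from the free module on the set \<open>carrier P\<close> onto \<open>P\<close> is one of the
surjections along which the identity of \<open>P\<close> lifts.
\<close>

lemma dual_basis_projective:
  fixes P :: "('a, 'c) module"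
  assumes P: "projective_module R P"
  shows "\<exists>c. dual_basis R P (carrier P) (\<lambda>x. x) c"
proof -
  have mP: "module R P" using P by (simp add: projective_module_def)
  let ?g = "lin R P (\<lambda>x. x)"
  have g: "?g \<in> mod_hom R (free_mod R (carrier P)) P" by (rule lin_hom[OF mP]) auto
  have "?g ` carrier (free_mod R (carrier P)) = carrier P"
  proof
    show "?g ` carrier (free_mod R (carrier P)) \<subseteq> carrier P" using hom_closed[OF g] by auto
    show "carrier P \<subseteq> ?g ` carrier (free_mod R (carrier P))"
    proof
      fix x assume x: "x \<in> carrier P"
      have "?g (delta R x) = x" by (rule lin_delta[OF mP _ x]) auto
      then show "x \<in> ?g ` carrier (free_mod R (carrier P))"
        using delta_carrier[OF x] by (metis image_eqI)
    qed
  qed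
  then obtain h where "h \<in> mod_hom R P (free_mod R (carrier P))" "\<forall>x\<in>carrier P. ?g (h x) = x"
    using P[unfolded projective_module_def, THEN conjunct2, rule_format,
        of "free_mod R (carrier P)" P ?g "\<lambda>x. x"] mP module_free g hom_ident by blast
  then show ?thesis unfolding dual_basis_def by (intro exI[of _ h]) auto
qed

lemma dual_basis_lift:
  assumes X: "module R X" and Y: "module R Y" and Z: "module R Z"
    and db: "dual_basis R X B b c"
    and r: "r \<in> mod_hom R X Z" and s: "s \<in> mod_hom R Y Z"
    and im: "\<And>x. x \<in> carrier X \<Longrightarrow> r x \<in> s ` carrier Y"
  shows "\<exists>h\<in>mod_hom R X Y. \<forall>x\<in>carrier X. s (h x) = r x"
proof -
  have c: "c \<in> mod_hom R X (free_mod R B)" and b: "b \<in> B \<rightarrow> carrier X"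
    and bc: "\<And>x. x \<in> carrier X \<Longrightarrow> lin R X b (c x) = x"
    using db by (auto simp: dual_basis_def)
  have "\<exists>y. y \<in> carrier Y \<and> s y = r (b i)" if "i \<in> B" for i
  proof -
    have "b i \<in> carrier X" using that b by auto
    then have "r (b i) \<in> s ` carrier Y" by (rule im)
    then show ?thesis by (auto simp: image_iff)
  qed
  then obtain y where y: "\<And>i. i \<in> B \<Longrightarrow> y i \<in> carrier Y \<and> s (y i) = r (b i)" by metis
  have yB: "y \<in> B \<rightarrow> carrier Y" using y by auto
  have "s (lin R Y y (c x)) = r x" if x: "x \<in> carrier X" for x
  proof -
    have cx: "c x \<in> carrier (free_mod R B)" by (rule hom_closed[OF c x])
    have "s (lin R Y y (c x)) = lin R Z (\<lambda>i. s (y i)) (c x)" by (rule hom_lin[OF Y Z s yB cx])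
    also have "\<dots> = lin R Z (\<lambda>i. r (b i)) (c x)"
    proof -
      interpret Z: module R Z by fact
      have "c x i \<noteq> \<zero> \<Longrightarrow> i \<in> B" "c x i \<in> carrier R" for i using cx by (auto simp: free_mod_carrier)
      then show ?thesis unfolding lin_def
        using y hom_closed[OF r] b by (intro Z.M.finsum_cong') (auto simp: Pi_iff)
    qed
    also have "\<dots> = r (lin R X b (c x))" by (rule hom_lin[OF X Z r b cx, symmetric])
    finally show ?thesis using bc[OF x] by simp
  qed
  then show ?thesis
    using hom_comp[OF c lin_hom[OF Y yB]] by (intro bexI[of _ "\<lambda>x. lin R Y y (c x)"]) auto
qed

text \<open>
The comparison theorem in a form that covers chain maps and homotopies together. With \<open>e = 1\<close> and \<open>\<theta> i = 0\<close> for
\<open>i > 0\<close> the maps \<open>h\<close> are a chain map that raises the degree by one and lifts \<open>\<theta> 0\<close>; with \<open>e = - 1\<close> and a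
chain map \<open>\<theta>\<close> they are a null homotopy of \<open>\<theta>\<close>. The last assumption makes the value prescribed for \<open>d (h x)\<close> a cycle.
\<close>

lemma chain_lift:
  assumes pX: "projective_complex R X dX B b c" and aY: "acyclic_complex R Y dY"
    and \<theta>: "\<And>i. \<theta> i \<in> mod_hom R (X i) (Y i)"
    and \<theta>0: "\<And>x. x \<in> carrier (X 0) \<Longrightarrow> \<theta> 0 x \<in> dY 0 ` carrier (Y (Suc 0))"
    and e: "e \<in> carrier R"
    and compat: "\<And>i x. x \<in> carrier (X (Suc i))
        \<Longrightarrow> dY i (\<theta> (Suc i) x) \<oplus>\<^bsub>Y i\<^esub> e \<odot>\<^bsub>Y i\<^esub> \<theta> i (dX i x) = \<zero>\<^bsub>Y i\<^esub>"
  obtains h where "\<And>i. h i \<in> mod_hom R (X i) (Y (Suc i))"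
    and "\<And>x. x \<in> carrier (X 0) \<Longrightarrow> dY 0 (h 0 x) = \<theta> 0 x"
    and "\<And>i x. x \<in> carrier (X (Suc i))
        \<Longrightarrow> dY (Suc i) (h (Suc i) x) = \<theta> (Suc i) x \<oplus>\<^bsub>Y (Suc i)\<^esub> e \<odot>\<^bsub>Y (Suc i)\<^esub> h i (dX i x)"
proof -
  have X: "module R (X i)" and db: "dual_basis R (X i) (B i) (b i) (c i)"
    and dX: "dX i \<in> mod_hom R (X (Suc i)) (X i)"
    and dd: "x \<in> carrier (X (Suc (Suc i))) \<Longrightarrow> dX i (dX (Suc i) x) = \<zero>\<^bsub>X i\<^esub>" for i x
    using pX by (simp_all add: projective_complex_def)
  have Y: "module R (Y i)" and dY: "dY i \<in> mod_hom R (Y (Suc i)) (Y i)"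
    and exact: "y \<in> carrier (Y (Suc i)) \<Longrightarrow> dY i y = \<zero>\<^bsub>Y i\<^esub>
        \<Longrightarrow> y \<in> dY (Suc i) ` carrier (Y (Suc (Suc i)))" for i y
    using aY by (simp_all add: acyclic_complex_def)
  let ?P = "\<lambda>n h. h \<in> mod_hom R (X n) (Y (Suc n))
      \<and> (n = 0 \<longrightarrow> (\<forall>x\<in>carrier (X 0). dY 0 (h x) = \<theta> 0 x))
      \<and> (\<forall>x\<in>carrier (X (Suc n)). dY n (h (dX n x)) = \<theta> n (dX n x))"
  let ?Q = "\<lambda>n h h'. \<forall>x\<in>carrier (X (Suc n)). dY (Suc n) (h' x)
      = \<theta> (Suc n) x \<oplus>\<^bsub>Y (Suc n)\<^esub> e \<odot>\<^bsub>Y (Suc n)\<^esub> h (dX n x)"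
  have "\<exists>f. \<forall>n. ?P n (f n) \<and> ?Q n (f n) (f (Suc n))"
  proof (rule dependent_nat_choice)
    obtain h where "h \<in> mod_hom R (X 0) (Y (Suc 0))" "\<forall>x\<in>carrier (X 0). dY 0 (h x) = \<theta> 0 x"
      using dual_basis_lift[OF X Y Y db \<theta> dY \<theta>0] by blast
    then show "\<exists>h. ?P 0 h" using hom_closed[OF dX] by blast
  next
    fix h n assume P: "?P n h"
    then have h: "h \<in> mod_hom R (X n) (Y (Suc n))"
      and hd: "\<And>x. x \<in> carrier (X (Suc n)) \<Longrightarrow> dY n (h (dX n x)) = \<theta> n (dX n x)" by auto
    interpret Yn: module R "Y n" by (rule Y)
    interpret Y1: module R "Y (Suc n)" by (rule Y)
    let ?r = "\<lambda>x. \<theta> (Suc n) x \<oplus>\<^bsub>Y (Suc n)\<^esub> e \<odot>\<^bsub>Y (Suc n)\<^esub> h (dX n x)"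
    have r: "?r \<in> mod_hom R (X (Suc n)) (Y (Suc n))"
      by (intro hom_sum[OF Y] \<theta> hom_scale[OF Y _ e] hom_comp[OF dX h])
    have im: "?r x \<in> dY (Suc n) ` carrier (Y (Suc (Suc n)))" if x: "x \<in> carrier (X (Suc n))" for x
    proof (rule exact)
      show "?r x \<in> carrier (Y (Suc n))" by (rule hom_closed[OF r x])
      have c: "\<theta> (Suc n) x \<in> carrier (Y (Suc n))" "h (dX n x) \<in> carrier (Y (Suc n))"
        using hom_closed[OF \<theta> x] hom_closed[OF h hom_closed[OF dX x]] by auto
      have "dY n (?r x) = dY n (\<theta> (Suc n) x) \<oplus>\<^bsub>Y n\<^esub> e \<odot>\<^bsub>Y n\<^esub> dY n (h (dX n x))"
        using c e by (simp add: hom_add[OF dY] hom_smult[OF dY])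
      then show "dY n (?r x) = \<zero>\<^bsub>Y n\<^esub>" using hd[OF x] compat[OF x] by simp
    qed
    obtain h' where h': "h' \<in> mod_hom R (X (Suc n)) (Y (Suc (Suc n)))"
      and eq: "\<forall>x\<in>carrier (X (Suc n)). dY (Suc n) (h' x) = ?r x"
      using dual_basis_lift[OF X Y Y db r dY im] by blast
    have "dY (Suc n) (h' (dX (Suc n) x)) = \<theta> (Suc n) (dX (Suc n) x)"
      if x: "x \<in> carrier (X (Suc (Suc n)))" for x
    proof -
      have dx: "dX (Suc n) x \<in> carrier (X (Suc n))" by (rule hom_closed[OF dX x])
      have "h (dX n (dX (Suc n) x)) = \<zero>\<^bsub>Y (Suc n)\<^esub>" using dd[OF x] hom_zero[OF X Y h] by simp
      then show ?thesis using eq dx e hom_closed[OF \<theta> dx] by simp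
    qed
    then show "\<exists>h'. ?P (Suc n) h' \<and> ?Q n h h'" using h' eq by blast
  qed
  then show ?thesis using that by (metis (no_types, lifting))
qed

end

section \<open>Minimal free resolution of the residue field\<close>

context module
begin

lemma submodule_iff:
  "submodule H R M \<longleftrightarrow> H \<subseteq> carrier M \<and> \<zero>\<^bsub>M\<^esub> \<in> H \<and> (\<forall>x\<in>H. \<forall>y\<in>H. x \<oplus>\<^bsub>M\<^esub> y \<in> H)
     \<and> (\<forall>a\<in>carrier R. \<forall>x\<in>H. a \<odot>\<^bsub>M\<^esub> x \<in> H)" (is "_ \<longleftrightarrow> ?r")
proof
  assume H: "submodule H R M"
  note E = submoduleE[OF H]
  obtain x where x: "x \<in> H" using E(2) by blast
  have "\<zero> \<odot>\<^bsub>M\<^esub> x \<in> H" using E(4)[OF R.zero_closed x] .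
  moreover have "x \<in> carrier M" using E(1) x by blast
  ultimately have "\<zero>\<^bsub>M\<^esub> \<in> H" by simp
  then show ?r using E(1,4,5) by blast
next
  assume r: ?r
  show "submodule H R M"
  proof (rule submoduleI)
    fix a assume a: "a \<in> H"
    then have "(\<ominus> \<one>) \<odot>\<^bsub>M\<^esub> a \<in> H" using r by auto
    moreover have "(\<ominus> \<one>) \<odot>\<^bsub>M\<^esub> a = \<ominus>\<^bsub>M\<^esub> a"
      using a r by (subst smult_l_minus) auto
    ultimately show "\<ominus>\<^bsub>M\<^esub> a \<in> H" by simp
  qed (use r in auto)
qed

end

lemma hom_image_submodule:
  assumes X: "module R X" and Y: "module R Y" and f: "f \<in> mod_hom R X Y"
  shows "submodule (f ` carrier X) R Y"
proof -
  interpret X: module R X by fact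
  interpret Y: module R Y by fact
  show ?thesis unfolding Y.submodule_iff
  proof (intro conjI ballI)
    show "f ` carrier X \<subseteq> carrier Y" using hom_closed[OF f] by auto
    show "\<zero>\<^bsub>Y\<^esub> \<in> f ` carrier X" using hom_zero[OF X Y f] by (metis X.M.zero_closed image_eqI)
    show "x \<oplus>\<^bsub>Y\<^esub> y \<in> f ` carrier X" if xy: "x \<in> f ` carrier X" "y \<in> f ` carrier X" for x y
    proof -
      obtain u v where uv: "u \<in> carrier X" "v \<in> carrier X" "x = f u" "y = f v" using xy by auto
      then have "x \<oplus>\<^bsub>Y\<^esub> y = f (u \<oplus>\<^bsub>X\<^esub> v)" by (simp add: hom_add[OF f])
      then show ?thesis using uv by simp
    qed
    show "a \<odot>\<^bsub>Y\<^esub> y \<in> f ` carrier X" if ay: "a \<in> carrier R" "y \<in> f ` carrier X" for a y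
    proof -
      obtain v where v: "v \<in> carrier X" "y = f v" using ay by auto
      then have "a \<odot>\<^bsub>Y\<^esub> y = f (a \<odot>\<^bsub>X\<^esub> v)" using ay by (simp add: hom_smult[OF f])
      then show ?thesis using v ay by simp
    qed
  qed
qed

lemma hom_kernel_submodule:
  assumes X: "module R X" and Y: "module R Y" and f: "f \<in> mod_hom R X Y"
  shows "submodule {x \<in> carrier X. f x = \<zero>\<^bsub>Y\<^esub>} R X"
proof -
  interpret X: module R X by fact
  interpret Y: module R Y by fact
  show ?thesis unfolding X.submodule_iff
    using hom_zero[OF X Y f] by (auto simp: hom_add[OF f] hom_smult[OF f])
qed

context cring
begin

lemma submodule_coord_ideal:
  assumes I: "ideal I R"
  shows "submodule {z \<in> carrier (free_mod R B). \<forall>k. z k \<in> I} R (free_mod R B)"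
proof -
  interpret F: module R "free_mod R B" by (rule module_free)
  have a: "x \<oplus>\<^bsub>free_mod R B\<^esub> y \<in> carrier (free_mod R B)"
    if "x \<in> carrier (free_mod R B)" "y \<in> carrier (free_mod R B)" for x y
    using that by (rule F.add.m_closed)
  have b: "c \<odot>\<^bsub>free_mod R B\<^esub> y \<in> carrier (free_mod R B)"
    if "c \<in> carrier R" "y \<in> carrier (free_mod R B)" for c y
    using that by (rule F.smult_closed)
  show ?thesis unfolding F.submodule_iff
    using a b F.zero_closed I by (auto simp: ideal_simps)
qed

lemma free_mod_expand:
  assumes "z \<in> carrier (free_mod R B)"
  shows "lin R (free_mod R B) (delta R) z = z"
  using dual_basis_free[of B] assms by (simp add: dual_basis_def)

lemma hom_expand:
  assumes Y: "module R Y" and f: "f \<in> mod_hom R (free_mod R B) Y"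
    and z: "z \<in> carrier (free_mod R B)"
  shows "f z = lin R Y (\<lambda>i. f (delta R i)) z"
proof -
  have "f (lin R (free_mod R B) (delta R) z) = lin R Y (\<lambda>i. f (delta R i)) z"
    using delta_carrier by (intro hom_lin[OF module_free Y f _ z]) auto
  then show ?thesis by (simp add: free_mod_expand[OF z])
qed

lemma free_mod_apply_carrier: "z \<in> carrier (free_mod R B) \<Longrightarrow> z k \<in> carrier R"
  by (simp add: free_mod_carrier)

lemma hom_coord_mult:
  assumes K: "ideal K R" and f: "f \<in> mod_hom R (free_mod R B) (free_mod R B')"
    and z: "z \<in> carrier (free_mod R B)"
    and prod: "\<And>i k. i \<in> B \<Longrightarrow> z i \<otimes> f (delta R i) k \<in> K"
  shows "f z k \<in> K"
proof -
  interpret F: module R "free_mod R B'" by (rule module_free)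
  have "f z \<in> {z \<in> carrier (free_mod R B'). \<forall>k. z k \<in> K}"
    unfolding hom_expand[OF module_free f z]
  proof (rule lin_mem_submodule[OF module_free submodule_coord_ideal[OF K]])
    fix i assume "z i \<noteq> \<zero>"
    then have i: "i \<in> B" using z by (auto simp: free_mod_carrier)
    have "z i \<odot>\<^bsub>free_mod R B'\<^esub> f (delta R i) \<in> carrier (free_mod R B')"
      by (rule F.smult_closed[OF free_mod_apply_carrier[OF z] hom_closed[OF f delta_carrier[OF i]]])
    then show "z i \<odot>\<^bsub>free_mod R B'\<^esub> f (delta R i) \<in> {z \<in> carrier (free_mod R B'). \<forall>k. z k \<in> K}"
      using prod[OF i] by simp
  qed
  then show ?thesis by blast
qed

lemma hom_coord_ideal:
  assumes K: "ideal K R" and f: "f \<in> mod_hom R (free_mod R B) (free_mod R B')"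
    and z: "z \<in> carrier (free_mod R B)" and zK: "\<And>k. z k \<in> K"
  shows "f z k \<in> K"
proof (rule hom_coord_mult[OF K f z])
  fix i k assume "i \<in> B"
  then show "z i \<otimes> f (delta R i) k \<in> K"
    using zK free_mod_apply_carrier[OF hom_closed[OF f delta_carrier]] by (blast intro: ideal_rmult[OF K])
qed

lemma free_mod_minus:
  assumes "x \<in> carrier (free_mod R B)" "y \<in> carrier (free_mod R B)"
  shows "(x \<ominus>\<^bsub>free_mod R B\<^esub> y) = (\<lambda>k. x k \<ominus> y k)"
proof -
  interpret F: module R "free_mod R B" by (rule module_free)
  have m: "(\<ominus> \<one>) \<odot>\<^bsub>free_mod R B\<^esub> y \<in> carrier (free_mod R B)"
    by (rule F.smult_closed[OF _ assms(2)]) simp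
  have "y \<oplus>\<^bsub>free_mod R B\<^esub> (\<ominus> \<one>) \<odot>\<^bsub>free_mod R B\<^esub> y = \<zero>\<^bsub>free_mod R B\<^esub>"
    using assms(2) by (auto simp: free_mod_carrier l_minus r_neg)
  then have "\<ominus>\<^bsub>free_mod R B\<^esub> y = (\<ominus> \<one>) \<odot>\<^bsub>free_mod R B\<^esub> y"
    using F.M.add.inv_unique'[OF assms(2) m] F.M.a_comm[OF assms(2) m] 
    by (metis F.M.minus_equality assms(2) m)
  then show ?thesis
    using assms unfolding a_minus_def by (auto simp: free_mod_carrier l_minus)
qed

lemma submodule_free_UNIV:
  fixes B :: "'i set"
  assumes "submodule U R (free_mod R B)"
  shows "submodule U R (free_mod R UNIV)"
proof -
  interpret F: module R "free_mod R B" by (rule module_free)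
  interpret W: module R "free_mod R (UNIV :: 'i set)" by (rule module_free)
  show ?thesis
    using assms unfolding F.submodule_iff W.submodule_iff by (auto simp: free_mod_carrier subset_iff)
qed

lemma coord_image_ideal:
  assumes U: "submodule U R (free_mod R B)"
  shows "ideal {z k | z. z \<in> U} R"
proof -
  interpret F: module R "free_mod R B" by (rule module_free)
  have c: "z k \<in> carrier R" if "z \<in> U" for z
    using that F.submoduleE(1)[OF U] by (auto simp: free_mod_carrier)
  have add: "(\<lambda>i. z i \<oplus> y i) \<in> U" if "z \<in> U" "y \<in> U" for z y
    using F.submoduleE(5)[OF U that] by simp
  have scale: "(\<lambda>i. a \<otimes> z i) \<in> U" if "a \<in> carrier R" "z \<in> U" for a z
    using F.submoduleE(4)[OF U that] by simp
  have zero: "(\<lambda>_. \<zero>) \<in> U" using U by (simp add: F.submodule_iff)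
  show ?thesis
  proof (rule ideal_of_closed)
    show "{z k | z. z \<in> U} \<subseteq> carrier R" using c by auto
    show "\<zero> \<in> {z k | z. z \<in> U}" using zero by (intro CollectI exI[of _ "\<lambda>_. \<zero>"]) simp
    fix a assume "a \<in> {z k | z. z \<in> U}"
    then obtain z where z: "z \<in> U" "a = z k" by auto
    show "a \<oplus> b \<in> {z k | z. z \<in> U}" if "b \<in> {z k | z. z \<in> U}" for b
    proof -
      obtain y where "y \<in> U" "b = y k" using \<open>b \<in> {z k | z. z \<in> U}\<close> by auto
      then show ?thesis using add[OF z(1)] z(2) by (intro CollectI exI[of _ "\<lambda>i. z i \<oplus> y i"]) simp
    qed
    show "x \<otimes> a \<in> {z k | z. z \<in> U}" if "x \<in> carrier R" for x
      using scale[OF that z(1)] z(2) by (intro CollectI exI[of _ "\<lambda>i. x \<otimes> z i"]) simp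
  qed
qed

end

context noetherian_cring
begin

text \<open>
Induction on the rank: the coordinates at \<open>b\<close> of the elements of \<open>U\<close> form an ideal, which is finitely
generated, and the elements of \<open>U\<close> whose coordinate at \<open>b\<close> vanishes form a submodule of smaller rank. Finite
generation is expressed by a finite set \<open>G\<close> such that every submodule containing \<open>G\<close> contains \<open>U\<close>.
\<close>

lemma submodule_free_fin_gen:
  fixes B :: "'i set" and U :: "('i \<Rightarrow> 'a) set"
  assumes "finite B" and "submodule U R (free_mod R UNIV)" and "\<And>z i. z \<in> U \<Longrightarrow> i \<notin> B \<Longrightarrow> z i = \<zero>"
  shows "\<exists>G. finite G \<and> G \<subseteq> U \<and> (\<forall>H. submodule H R (free_mod R UNIV) \<longrightarrow> G \<subseteq> H \<longrightarrow> U \<subseteq> H)"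
  using assms
proof (induction B arbitrary: U rule: finite_induct)
  case empty
  interpret W: module R "free_mod R (UNIV :: 'i set)" by (rule module_free)
  have z: "z = (\<lambda>_. \<zero>)" if "z \<in> U" for z using empty.prems(2)[OF that] by auto
  show ?case
  proof (intro exI[of _ "{}"] conjI allI impI subsetI)
    fix H z assume "submodule H R (free_mod R (UNIV :: 'i set))" "z \<in> U"
    then show "z \<in> H" using z unfolding W.submodule_iff by simp
  qed auto
next
  case (insert b B)
  interpret W: module R "free_mod R (UNIV :: 'i set)" by (rule module_free)
  note U = insert.prems(1)
  note E = W.submoduleE[OF U]
  let ?J = "{z b | z. z \<in> U}"
  obtain T where T: "T \<subseteq> carrier R" "finite T" "?J = Idl T"
    using finetely_gen[OF coord_image_ideal[OF U, of b]] by blast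
  have "\<exists>z. z \<in> U \<and> z b = t" if "t \<in> T" for t
  proof -
    have "t \<in> ?J" using that genideal_self[OF T(1)] T(3) by blast
    then show ?thesis by blast
  qed
  then obtain v where v: "\<And>t. t \<in> T \<Longrightarrow> v t \<in> U \<and> v t b = t" by metis
  let ?U' = "{z \<in> U. z b = \<zero>}"
  have U': "submodule ?U' R (free_mod R UNIV)"
  proof -
    have "?U' \<subseteq> carrier (free_mod R UNIV)" using E(1) by auto
    then show ?thesis using U unfolding W.submodule_iff by simp
  qed
  have "\<exists>G. finite G \<and> G \<subseteq> ?U' \<and> (\<forall>H. submodule H R (free_mod R UNIV) \<longrightarrow> G \<subseteq> H \<longrightarrow> ?U' \<subseteq> H)"
  proof (rule insert.IH[OF U'])
    fix z i assume "z \<in> ?U'" "i \<notin> B"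
    then show "z i = \<zero>" using insert.prems(2)[of z i] by (cases "i = b") auto
  qed
  then obtain G where "finite G \<and> G \<subseteq> ?U' \<and> (\<forall>H. submodule H R (free_mod R UNIV) \<longrightarrow> G \<subseteq> H \<longrightarrow> ?U' \<subseteq> H)" ..
  then have G: "finite G" "G \<subseteq> ?U'"
    and gen: "submodule H R (free_mod R UNIV) \<Longrightarrow> G \<subseteq> H \<Longrightarrow> ?U' \<subseteq> H" for H
    by simp_all
  show ?case
  proof (intro exI[of _ "v ` T \<union> G"] conjI allI impI)
    show "finite (v ` T \<union> G)" using T G by simp
    show "v ` T \<union> G \<subseteq> U" using v G by auto
    fix H assume H: "submodule H R (free_mod R (UNIV :: 'i set))" and sub: "v ` T \<union> G \<subseteq> H"
    note EH = W.submoduleE[OF H]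
    have HU: "submodule (H \<inter> U) R (free_mod R UNIV)"
      using H U unfolding W.submodule_iff by auto
    have "Idl T \<subseteq> {z b | z. z \<in> H \<inter> U}"
    proof (rule genideal_minimal[OF coord_image_ideal[OF HU]])
      show "T \<subseteq> {z b | z. z \<in> H \<inter> U}"
      proof
        fix t assume t: "t \<in> T"
        then have "v t \<in> H \<inter> U" "t = v t b" using v[OF t] sub by auto
        then show "t \<in> {z b | z. z \<in> H \<inter> U}" by blast
      qed
    qed
    then have cover: "?J \<subseteq> {z b | z. z \<in> H \<inter> U}" using T(3) by simp
    show "U \<subseteq> H"
    proof
      fix z assume z: "z \<in> U"
      then obtain h where h: "h \<in> H" "h \<in> U" "z b = h b" using cover by blast
      have zc: "\<And>i. z i \<in> carrier R" "\<And>i. h i \<in> carrier R"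
        using z h E(1) by (auto simp: free_mod_carrier subset_iff)
      let ?y = "z \<oplus>\<^bsub>free_mod R UNIV\<^esub> (\<ominus> \<one>) \<odot>\<^bsub>free_mod R UNIV\<^esub> h"
      have "(\<ominus> \<one>) \<odot>\<^bsub>free_mod R UNIV\<^esub> h \<in> U" by (rule E(4)[OF _ h(2)]) simp
      then have yU: "?y \<in> U" by (rule E(5)[OF z])
      have "?y b = \<zero>" using h(3) zc(2)[of b] by (simp add: l_minus r_neg)
      then have "?y \<in> ?U'" using yU by simp
      then have "?y \<in> H" using gen[OF H] sub by blast
      then have "?y \<oplus>\<^bsub>free_mod R UNIV\<^esub> h \<in> H" by (rule EH(5)[OF _ h(1)])
      moreover have "?y \<oplus>\<^bsub>free_mod R UNIV\<^esub> h = z"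
        using zc by (auto simp: l_minus a_assoc l_neg)
      ultimately show "z \<in> H" by simp
    qed
  qed
qed

end

context noetherian_local_ring
begin

text \<open>
Take a generating family of smallest size. If a relation had a coefficient outside \<open>\<mm>\<close>, this
coefficient would be a unit, and the corresponding generator could be omitted.
\<close>

lemma minimal_generators:
  fixes B :: "'i set"
  assumes B: "finite B" and U: "submodule U A (free_mod A B)"
  obtains S :: "nat set" and f where "finite S" "f \<in> mod_hom A (free_mod A S) (free_mod A B)"
    "f ` carrier (free_mod A S) = U"
    "\<And>z k. z \<in> carrier (free_mod A S) \<Longrightarrow> f z = \<zero>\<^bsub>free_mod A B\<^esub> \<Longrightarrow> z k \<in> \<mm>"
proof -
  let ?FB = "free_mod A B"
  interpret FB: module A ?FB by (rule module_free)
  have UB: "U \<subseteq> carrier ?FB" using FB.submoduleE(1)[OF U] .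
  let ?P = "\<lambda>n. \<exists>(S :: nat set) D. finite S \<and> card S = n \<and> D \<in> S \<rightarrow> U \<and> lin A ?FB D ` carrier (free_mod A S) = U"
  have lin_sub: "lin A ?FB D ` carrier (free_mod A S) \<subseteq> H"
    if "D \<in> S \<rightarrow> H" "submodule H A ?FB" for S :: "nat set" and D H
  proof
    fix y assume "y \<in> lin A ?FB D ` carrier (free_mod A S)"
    then obtain z where z: "z \<in> carrier (free_mod A S)" "y = lin A ?FB D z" by auto
    show "y \<in> H" unfolding z(2)
    proof (rule lin_mem_submodule[OF module_free that(2)])
      fix i assume "z i \<noteq> \<zero>"
      then have "D i \<in> H" using z that(1) by (auto simp: free_mod_carrier)
      then show "z i \<odot>\<^bsub>?FB\<^esub> D i \<in> H"
        using FB.submoduleE(4)[OF that(2) free_mod_apply_carrier[OF z(1)]] by blast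
    qed
  qed
  have ex: "\<exists>n. ?P n"
  proof -
    obtain G where G: "finite G" "G \<subseteq> U"
      and gen: "\<And>H. submodule H A (free_mod A UNIV) \<Longrightarrow> G \<subseteq> H \<Longrightarrow> U \<subseteq> H"
      using submodule_free_fin_gen[OF B submodule_free_UNIV[OF U]] UB
      by (auto simp: free_mod_carrier subset_iff)
    obtain D where D: "bij_betw D {0..<card G} G" using ex_bij_betw_nat_finite[OF G(1)] by blast
    let ?S = "{0..<card G}"
    have DU: "D \<in> ?S \<rightarrow> U" using D G(2) by (auto simp: bij_betw_def)
    have DB: "D \<in> ?S \<rightarrow> carrier ?FB" using DU UB by auto
    have sub: "submodule (lin A ?FB D ` carrier (free_mod A ?S)) A ?FB"
      by (rule hom_image_submodule[OF module_free module_free lin_hom[OF module_free DB]])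
    have "G \<subseteq> lin A ?FB D ` carrier (free_mod A ?S)"
    proof
      fix g assume "g \<in> G"
      then obtain i where i: "i \<in> ?S" "g = D i" using D unfolding bij_betw_def by blast
      then have "g = lin A ?FB D (delta A i)" using lin_delta[OF module_free DB i(1)] by simp
      then show "g \<in> lin A ?FB D ` carrier (free_mod A ?S)" using delta_carrier[OF i(1)] by blast
    qed
    then have "U \<subseteq> lin A ?FB D ` carrier (free_mod A ?S)"
      by (rule gen[OF submodule_free_UNIV[OF sub]])
    then have "lin A ?FB D ` carrier (free_mod A ?S) = U" using lin_sub[OF DU U] by blast
    then show ?thesis using DU by (intro exI[of _ "card G"] exI[of _ ?S] exI[of _ D]) auto
  qed
  define n where "n = (LEAST n. ?P n)"
  have Pn: "?P n" unfolding n_def using ex by (rule LeastI_ex)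
  have least: "n \<le> m" if "?P m" for m unfolding n_def using that by (rule Least_le)
  obtain S D where S: "finite (S :: nat set)" "card S = n" and DU: "D \<in> S \<rightarrow> U"
    and im: "lin A ?FB D ` carrier (free_mod A S) = U" using Pn by blast
  have DB: "D \<in> S \<rightarrow> carrier ?FB" using DU UB by auto
  note f = lin_hom[OF module_free DB]
  interpret FS: module A "free_mod A S" by (rule module_free)
  have "z k \<in> \<mm>" if z: "z \<in> carrier (free_mod A S)" and z0: "lin A ?FB D z = \<zero>\<^bsub>?FB\<^esub>" for z k
  proof (rule ccontr)
    assume nk: "z k \<notin> \<mm>"
    have zk: "z k \<in> carrier A" by (rule free_mod_apply_carrier[OF z])
    have k: "k \<in> S" using z nk ideal_zero[OF ideal_max] by (auto simp: free_mod_carrier)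
    obtain b where b: "b \<in> carrier A" "b \<otimes> z k = \<one>" using inverse_outside_max[OF zk nk] by blast
    let ?S' = "S - {k}"
    have D': "D \<in> ?S' \<rightarrow> carrier ?FB" "D \<in> ?S' \<rightarrow> U" using DB DU by auto
    let ?H = "lin A ?FB D ` carrier (free_mod A ?S')"
    have H: "submodule ?H A ?FB"
      by (rule hom_image_submodule[OF module_free module_free lin_hom[OF module_free D'(1)]])
    \<comment> \<open>The relation, scaled to have coefficient \<open>1\<close> at \<open>k\<close>, expresses \<open>D k\<close> by the other generators.\<close>
    define y where "y = delta A k \<ominus>\<^bsub>free_mod A S\<^esub> b \<odot>\<^bsub>free_mod A S\<^esub> z"
    have bz: "b \<odot>\<^bsub>free_mod A S\<^esub> z \<in> carrier (free_mod A S)" by (rule FS.smult_closed[OF b(1) z])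
    have y: "y \<in> carrier (free_mod A S)" unfolding y_def
      by (rule FS.M.minus_closed[OF delta_carrier[OF k] bz])
    have "y = (\<lambda>j. delta A k j \<ominus> b \<otimes> z j)" unfolding y_def
      using free_mod_minus[OF delta_carrier[OF k] bz] by simp
    then have "y k = \<zero>" using b by (simp add: delta_def r_neg a_minus_def)
    then have y': "y \<in> carrier (free_mod A ?S')" using y by (auto simp: free_mod_carrier)
    have "lin A ?FB D y = lin A ?FB D (delta A k) \<ominus>\<^bsub>?FB\<^esub> lin A ?FB D (b \<odot>\<^bsub>free_mod A S\<^esub> z)"
      unfolding y_def by (rule hom_diff[OF module_free module_free f delta_carrier[OF k] bz])
    also have "lin A ?FB D (b \<odot>\<^bsub>free_mod A S\<^esub> z) = b \<odot>\<^bsub>?FB\<^esub> \<zero>\<^bsub>?FB\<^esub>"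
      unfolding hom_smult[OF f b(1) z] z0 by simp
    also have "\<dots> = \<zero>\<^bsub>?FB\<^esub>" by (rule FB.smult_r_null[OF b(1)])
    also have "lin A ?FB D (delta A k) = D k" by (rule lin_delta[OF module_free DB k])
    also have "D k \<ominus>\<^bsub>?FB\<^esub> \<zero>\<^bsub>?FB\<^esub> = D k"
    proof -
      have "D k \<in> carrier ?FB" using DB k by auto
      then show ?thesis unfolding a_minus_def by (simp del: free_mod_sel)
    qed
    finally have Dk: "D k \<in> ?H" using y' by (metis image_eqI)
    have "D \<in> S \<rightarrow> ?H"
    proof
      fix j assume j: "j \<in> S"
      show "D j \<in> ?H"
      proof (cases "j = k")
        case False
        then have j': "j \<in> ?S'" using j by simp
        have "D j = lin A ?FB D (delta A j)" by (rule lin_delta[OF module_free D'(1) j', symmetric])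
        then show ?thesis using delta_carrier[OF j'] by blast
      qed (use Dk in simp)
    qed
    then have "U \<subseteq> ?H" using lin_sub[OF _ H] im by blast
    then have "?H = U" using lin_sub[OF D'(2) U] by blast
    then have "?P (card ?S')" using S D'(2) by blast
    then have "n \<le> card ?S'" by (rule least)
    then show False using S card_Diff1_less[OF S(1) k] by simp
  qed
  then show ?thesis using that[OF S(1) f im] by blast
qed

end

text \<open>
The module in degree \<open>i\<close> is free on \<open>S i\<close>. The augmentation to the residue field is left implicit: it is
the reduction of the single coordinate in degree \<open>0\<close>, with kernel given by \<open>d_aug\<close>. Minimality is the
assumption \<open>d_ker\<close>, that every relation has coefficients in \<open>\<mm>\<close>.
\<close>

locale minimal_resolution = noetherian_local_ring A \<mm>
  for A :: "('a, 'r) ring_scheme" (structure) and \<mm> +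
  fixes S :: "nat \<Rightarrow> nat set" and d :: "nat \<Rightarrow> (nat \<Rightarrow> 'a) \<Rightarrow> nat \<Rightarrow> 'a"
  assumes S0: "S 0 = {0}" and finS: "finite (S i)"
    and d_hom: "d i \<in> mod_hom A (free_mod A (S (Suc i))) (free_mod A (S i))"
    and d_aug: "d 0 ` carrier (free_mod A (S (Suc 0))) = {z \<in> carrier (free_mod A (S 0)). z 0 \<in> \<mm>}"
    and d_exact: "d (Suc i) ` carrier (free_mod A (S (Suc (Suc i))))
        = {z \<in> carrier (free_mod A (S (Suc i))). d i z = \<zero>\<^bsub>free_mod A (S i)\<^esub>}"
    and d_ker: "z \<in> carrier (free_mod A (S (Suc i))) \<Longrightarrow> d i z = \<zero>\<^bsub>free_mod A (S i)\<^esub> \<Longrightarrow> z k \<in> \<mm>"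

lemma (in noetherian_local_ring) minimal_resolution_exists:
  obtains S d where "minimal_resolution A \<mm> S d"
proof -
  let ?F = "\<lambda>S. free_mod A (S :: nat set)"
  let ?P = "\<lambda>n (S, S', f). finite S \<and> finite S' \<and> f \<in> mod_hom A (?F S') (?F S)
      \<and> (\<forall>z\<in>carrier (?F S'). f z = \<zero>\<^bsub>?F S\<^esub> \<longrightarrow> (\<forall>k. z k \<in> \<mm>))
      \<and> (n = (0::nat) \<longrightarrow> S = {0} \<and> f ` carrier (?F S') = {z \<in> carrier (?F {0}). z 0 \<in> \<mm>})"
  let ?Q = "\<lambda>(n::nat) (S, S', f) (T, T', g). T = S'
      \<and> g ` carrier (?F T') = {z \<in> carrier (?F S'). f z = \<zero>\<^bsub>?F S\<^esub>}"
  have "\<exists>x. \<forall>n. ?P n (x n) \<and> ?Q n (x n) (x (Suc n))"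
  proof (rule dependent_nat_choice)
    have eq: "{z \<in> carrier (?F {0}). z 0 \<in> \<mm>} = {z \<in> carrier (?F {0}). \<forall>k. z k \<in> \<mm>}"
    proof -
      have "z k \<in> \<mm>" if "z \<in> carrier (?F {0})" "z 0 \<in> \<mm>" for z k
        using that ideal_zero[OF ideal_max] by (cases "k = 0") (auto simp: free_mod_carrier)
      then show ?thesis by blast
    qed
    have "submodule {z \<in> carrier (?F {0}). z 0 \<in> \<mm>} A (?F {0})"
      unfolding eq by (rule submodule_coord_ideal[OF ideal_max])
    then obtain S :: "nat set" and f where "finite S" "f \<in> mod_hom A (?F S) (?F {0})"
      "f ` carrier (?F S) = {z \<in> carrier (?F {0}). z 0 \<in> \<mm>}"
      "\<And>z k. z \<in> carrier (?F S) \<Longrightarrow> f z = \<zero>\<^bsub>?F {0}\<^esub> \<Longrightarrow> z k \<in> \<mm>"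
      by (rule minimal_generators[rotated]) auto
    then show "\<exists>x. ?P 0 x" by (intro exI[of _ "({0}, S, f)"]) blast
  next
    fix x n assume P: "?P n x"
    obtain S S' f where x: "x = (S, S', f)" by (cases x)
    have fin: "finite S" "finite S'" and f: "f \<in> mod_hom A (?F S') (?F S)" using P x by auto
    obtain T :: "nat set" and g where g: "finite T" "g \<in> mod_hom A (?F T) (?F S')"
      "g ` carrier (?F T) = {z \<in> carrier (?F S'). f z = \<zero>\<^bsub>?F S\<^esub>}"
      "\<And>z k. z \<in> carrier (?F T) \<Longrightarrow> g z = \<zero>\<^bsub>?F S'\<^esub> \<Longrightarrow> z k \<in> \<mm>"
      using minimal_generators[OF fin(2) hom_kernel_submodule[OF module_free module_free f]] by blast
    then show "\<exists>y. ?P (Suc n) y \<and> ?Q n x y"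
      using fin unfolding x by (intro exI[of _ "(S', T, g)"]) blast
  qed
  then obtain x where x0: "\<forall>n. ?P n (x n) \<and> ?Q n (x n) (x (Suc n))" ..
  define S where "S n = fst (x n)" for n
  define d where "d n = snd (snd (x n))" for n
  have xP: "?P n (x n)" and xQ: "?Q n (x n) (x (Suc n))" for n
    using spec[OF x0, of n] by (rule conjunct1, rule conjunct2)
  have S': "fst (snd (x n)) = S (Suc n)" for n
    using xQ[of n] unfolding S_def case_prod_beta by simp
  have xe: "x n = (S n, S (Suc n), d n)" for n
    using S'[of n] by (simp add: S_def d_def prod_eq_iff)
  have P: "finite (S n)" "d n \<in> mod_hom A (?F (S (Suc n))) (?F (S n))"
    "\<And>z k. z \<in> carrier (?F (S (Suc n))) \<Longrightarrow> d n z = \<zero>\<^bsub>?F (S n)\<^esub> \<Longrightarrow> z k \<in> \<mm>"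
    for n using xP[of n] unfolding xe by simp_all
  have Q: "d (Suc n) ` carrier (?F (S (Suc (Suc n)))) = {z \<in> carrier (?F (S (Suc n))). d n z = \<zero>\<^bsub>?F (S n)\<^esub>}" for n
    using xQ[of n] unfolding xe by simp
  have Z: "S 0 = {0}" "d 0 ` carrier (?F (S (Suc 0))) = {z \<in> carrier (?F {0}). z 0 \<in> \<mm>}"
    using xP[of 0] unfolding xe by simp_all
  have "minimal_resolution A \<mm> S d"
  proof unfold_locales
    show "d 0 ` carrier (?F (S (Suc 0))) = {z \<in> carrier (?F (S 0)). z 0 \<in> \<mm>}"
      using Z by simp
  qed (rule Z(1), rule P(1), rule P(2), rule Q, rule P(3))
  then show ?thesis by (rule that)
qed

lemma hom_image_of_submodule:
  assumes X: "module R X" and Y: "module R Y" and f: "f \<in> mod_hom R X Y" and H: "submodule H R X"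
  shows "submodule (f ` H) R Y"
proof -
  interpret X: module R X by fact
  have HX: "H \<subseteq> carrier X" by (rule X.submoduleE(1)[OF H])
  have "module R (X\<lparr>carrier := H\<rparr>)" by (rule submodule.submodule_is_module[OF H X])
  moreover have "f \<in> mod_hom R (X\<lparr>carrier := H\<rparr>) Y"
    by (rule homI) (use HX hom_closed[OF f] hom_add[OF f] hom_smult[OF f] in \<open>auto simp: subset_iff\<close>)
  ultimately show ?thesis using hom_image_submodule[OF _ Y] by fastforce
qed

context minimal_resolution
begin

abbreviation F :: "nat \<Rightarrow> ('a, nat \<Rightarrow> 'a) module" where
  "F i \<equiv> free_mod A (S i)"

lemma F0_eqI:
  assumes "y \<in> carrier (F 0)" "z \<in> carrier (F 0)" "y 0 = z 0"
  shows "y = z"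
proof
  fix k show "y k = z k" using assms S0 by (cases "k = 0") (auto simp: free_mod_carrier)
qed

lemma F0_mem_image:
  assumes "z \<in> carrier (F 0)" "z 0 \<in> \<mm>"
  shows "z \<in> d 0 ` carrier (F (Suc 0))"
  unfolding d_aug using assms by simp

lemma dd:
  assumes "z \<in> carrier (F (Suc (Suc i)))"
  shows "d i (d (Suc i) z) = \<zero>\<^bsub>F i\<^esub>"
  using d_exact[of i] assms by blast

lemma exact:
  assumes "z \<in> carrier (F (Suc i))" "d i z = \<zero>\<^bsub>F i\<^esub>"
  shows "z \<in> d (Suc i) ` carrier (F (Suc (Suc i)))"
  using d_exact[of i] assms by blast

lemma projective_F: "projective_complex A F d S (\<lambda>_. delta A) (\<lambda>_ z. z)"
  by (simp add: projective_complex_def module_free dual_basis_free d_hom dd del: free_mod_sel)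

lemma acyclic_F: "acyclic_complex A F d"
  unfolding acyclic_complex_def using module_free d_hom exact by blast

lemma d_closed: "z \<in> carrier (F (Suc i)) \<Longrightarrow> d i z \<in> carrier (F i)"
  by (rule hom_closed[OF d_hom])

lemma d_max:
  assumes z: "z \<in> carrier (F (Suc i))"
  shows "d i z k \<in> \<mm>"
proof (cases i)
  case 0
  have "d 0 z \<in> d 0 ` carrier (F (Suc 0))" using z 0 by simp
  then have "d 0 z \<in> carrier (F 0)" "d 0 z 0 \<in> \<mm>" unfolding d_aug by auto
  then show ?thesis using 0 S0 ideal_zero[OF ideal_max] by (cases "k = 0") (auto simp: free_mod_carrier)
next
  case (Suc j)
  then show ?thesis using d_ker[OF d_closed] dd z by simp
qed

lemma max_preimage:
  assumes b: "b \<in> \<mm>"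
  obtains y where "y \<in> carrier (F (Suc 0))" "d 0 y 0 = b"
proof -
  interpret F0: module A "F 0" by (rule module_free)
  have "delta A 0 \<in> carrier (F 0)" by (rule delta_carrier) (simp add: S0)
  then have c: "b \<odot>\<^bsub>F 0\<^esub> delta A 0 \<in> carrier (F 0)" by (rule F0.smult_closed[OF max_carr[OF b]])
  have 1: "(b \<odot>\<^bsub>F 0\<^esub> delta A 0) 0 = b" using max_carr[OF b] by (simp add: delta_def)
  then have "b \<odot>\<^bsub>F 0\<^esub> delta A 0 \<in> d 0 ` carrier (F (Suc 0))"
    using b by (intro F0_mem_image[OF c]) simp
  then obtain y where "y \<in> carrier (F (Suc 0))" "b \<odot>\<^bsub>F 0\<^esub> delta A 0 = d 0 y" by blast
  then show ?thesis using that 1 by metis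
qed

text \<open>
Multiplication by \<open>x\<close> is zero on the residue field, hence null-homotopic on its resolution.
\<close>

lemma smult_homotopy:
  assumes x: "x \<in> \<mm>"
  obtains s where "\<And>i. s i \<in> mod_hom A (F i) (F (Suc i))"
    "\<And>z. z \<in> carrier (F 0) \<Longrightarrow> d 0 (s 0 z) = x \<odot>\<^bsub>F 0\<^esub> z"
    "\<And>i z. z \<in> carrier (F (Suc i)) \<Longrightarrow>
      d (Suc i) (s (Suc i) z) = x \<odot>\<^bsub>F (Suc i)\<^esub> z \<oplus>\<^bsub>F (Suc i)\<^esub> (\<ominus> \<one>) \<odot>\<^bsub>F (Suc i)\<^esub> s i (d i z)"
proof (rule chain_lift[OF projective_F acyclic_F, where e = "\<ominus> \<one>" and \<theta> = "\<lambda>i z. x \<odot>\<^bsub>F i\<^esub> z"])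
  have xc: "x \<in> carrier A" by (rule max_carr[OF x])
  show "(\<lambda>z. x \<odot>\<^bsub>F i\<^esub> z) \<in> mod_hom A (F i) (F i)" for i
    by (rule hom_scale[OF module_free hom_ident xc])
  show "\<ominus> \<one> \<in> carrier A" by simp
  show "x \<odot>\<^bsub>F 0\<^esub> z \<in> d 0 ` carrier (F (Suc 0))" if z: "z \<in> carrier (F 0)" for z
  proof (rule F0_mem_image)
    interpret F0: module A "F 0" by (rule module_free)
    show "x \<odot>\<^bsub>F 0\<^esub> z \<in> carrier (F 0)" by (rule F0.smult_closed[OF xc z])
    show "(x \<odot>\<^bsub>F 0\<^esub> z) 0 \<in> \<mm>"
      using ideal_rmult[OF ideal_max free_mod_apply_carrier[OF z] x] by simp
  qed
  show "d i (x \<odot>\<^bsub>F (Suc i)\<^esub> z) \<oplus>\<^bsub>F i\<^esub> (\<ominus> \<one>) \<odot>\<^bsub>F i\<^esub> (x \<odot>\<^bsub>F i\<^esub> d i z) = \<zero>\<^bsub>F i\<^esub>"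
    if z: "z \<in> carrier (F (Suc i))" for i z
  proof -
    have "d i (x \<odot>\<^bsub>F (Suc i)\<^esub> z) = x \<odot>\<^bsub>F i\<^esub> d i z" by (rule hom_smult[OF d_hom xc z])
    then show ?thesis
      using free_mod_apply_carrier[OF d_closed[OF z]] xc by (simp add: l_minus r_neg)
  qed
qed (use that in blast)

section \<open>The maximal ideal needs at most as many generators as the resolution is long\<close>

text \<open>
The number \<open>gen l\<close> is the \<open>l\<close>-th of the generators of \<open>\<mm>\<close> that the first differential singles out.
\<close>

definition gen :: "nat \<Rightarrow> 'a" where
  "gen l = d 0 (delta A l) 0"

text \<open>
This is \<open>\<mm>\<^sup>2\<close> plus the ideal of the generators other than \<open>gen l\<close>, described by the coefficients: it consists
of the combinations of generators in which \<open>gen l\<close> has a coefficient in \<open>\<mm>\<close>.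
\<close>

definition coeff_ideal :: "nat \<Rightarrow> 'a set" where
  "coeff_ideal l = {d 0 z 0 | z. z \<in> carrier (F (Suc 0)) \<and> z l \<in> \<mm>}"

lemma gen_max: "l \<in> S (Suc 0) \<Longrightarrow> gen l \<in> \<mm>"
  unfolding gen_def by (rule d_max[OF delta_carrier])

lemma ideal_coeff_ideal: "ideal (coeff_ideal l) A"
proof -
  interpret F1: module A "F (Suc 0)" by (rule module_free)
  let ?H = "{z \<in> carrier (F (Suc 0)). z l \<in> \<mm>}"
  have "submodule ?H A (F (Suc 0))" unfolding F1.submodule_iff
  proof (intro conjI ballI)
    show "?H \<subseteq> carrier (F (Suc 0))" by auto
    show "\<zero>\<^bsub>F (Suc 0)\<^esub> \<in> ?H" using F1.zero_closed ideal_zero[OF ideal_max] by simp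
    show "x \<oplus>\<^bsub>F (Suc 0)\<^esub> y \<in> ?H" if "x \<in> ?H" "y \<in> ?H" for x y
      using that F1.add.m_closed[of x y] ideal_add[OF ideal_max] by simp
    show "a \<odot>\<^bsub>F (Suc 0)\<^esub> y \<in> ?H" if "a \<in> carrier A" "y \<in> ?H" for a y
      using that F1.smult_closed[of a y] ideal_lmult[OF ideal_max] by simp
  qed
  from hom_image_of_submodule[OF module_free module_free d_hom this]
  have "ideal {y 0 | y. y \<in> d 0 ` ?H} A" by (rule coord_image_ideal)
  moreover have "{y 0 | y. y \<in> d 0 ` ?H} = coeff_ideal l" unfolding coeff_ideal_def by blast
  ultimately show ?thesis by simp
qed

lemma coeff_ideal_prod:
  assumes a: "a \<in> \<mm>" and b: "b \<in> \<mm>"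
  shows "a \<otimes> b \<in> coeff_ideal l"
proof -
  interpret F1: module A "F (Suc 0)" by (rule module_free)
  obtain y where y: "y \<in> carrier (F (Suc 0))" "d 0 y 0 = b" by (rule max_preimage[OF b])
  have ac: "a \<in> carrier A" by (rule max_carr[OF a])
  have "d 0 (a \<odot>\<^bsub>F (Suc 0)\<^esub> y) 0 = a \<otimes> b" using hom_smult[OF d_hom ac y(1)] y(2) by simp
  moreover have "(a \<odot>\<^bsub>F (Suc 0)\<^esub> y) l \<in> \<mm>"
    using ideal_rmult[OF ideal_max free_mod_apply_carrier[OF y(1)] a] by simp
  moreover have "a \<odot>\<^bsub>F (Suc 0)\<^esub> y \<in> carrier (F (Suc 0))" by (rule F1.smult_closed[OF ac y(1)])
  ultimately show ?thesis unfolding coeff_ideal_def by (metis (mono_tags, lifting) mem_Collect_eq)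
qed

lemma gen_mem_coeff_ideal:
  assumes "t \<in> S (Suc 0)" "l \<noteq> t"
  shows "gen t \<in> coeff_ideal l"
proof -
  have "delta A t l \<in> \<mm>" using assms(2) ideal_zero[OF ideal_max] by (simp add: delta_def)
  then show ?thesis unfolding coeff_ideal_def gen_def using delta_carrier[OF assms(1)] by blast
qed

text \<open>
Two ways to write an element of \<open>\<mm>\<close> by the generators differ by a relation, and relations have
coefficients in \<open>\<mm>\<close>.
\<close>

lemma coeff_ideal_cancel:
  assumes l: "l \<in> S (Suc 0)" and c: "c \<in> carrier A" and m: "gen l \<otimes> c \<in> coeff_ideal l"
  shows "c \<in> \<mm>"
proof -
  interpret F1: module A "F (Suc 0)" by (rule module_free)
  interpret F0: module A "F 0" by (rule module_free)
  obtain z where z: "z \<in> carrier (F (Suc 0))" "z l \<in> \<mm>" "gen l \<otimes> c = d 0 z 0"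
    using m unfolding coeff_ideal_def by blast
  have dl: "delta A l \<in> carrier (F (Suc 0))" by (rule delta_carrier[OF l])
  have cl: "c \<odot>\<^bsub>F (Suc 0)\<^esub> delta A l \<in> carrier (F (Suc 0))" by (rule F1.smult_closed[OF c dl])
  let ?y = "c \<odot>\<^bsub>F (Suc 0)\<^esub> delta A l \<ominus>\<^bsub>F (Suc 0)\<^esub> z"
  have y: "?y \<in> carrier (F (Suc 0))" by (rule F1.M.minus_closed[OF cl z(1)])
  have "d 0 (c \<odot>\<^bsub>F (Suc 0)\<^esub> delta A l) = d 0 z"
  proof (rule F0_eqI[OF d_closed[OF cl] d_closed[OF z(1)]])
    have "d 0 (c \<odot>\<^bsub>F (Suc 0)\<^esub> delta A l) 0 = c \<otimes> gen l"
      unfolding gen_def using hom_smult[OF d_hom c dl] by simp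
    then show "d 0 (c \<odot>\<^bsub>F (Suc 0)\<^esub> delta A l) 0 = d 0 z 0"
      using z(3) m_comm[OF c max_carr[OF gen_max[OF l]]] by simp
  qed
  then have "d 0 ?y = \<zero>\<^bsub>F 0\<^esub>"
    using hom_diff[OF module_free module_free d_hom cl z(1)] F0.M.r_neg[OF d_closed[OF z(1)]]
    by (simp add: a_minus_def del: free_mod_sel)
  then have "?y l \<in> \<mm>" by (rule d_ker[OF y])
  then have "c \<ominus> z l \<in> \<mm>" using free_mod_minus[OF cl z(1)] c by (simp add: delta_def)
  then have "(c \<ominus> z l) \<oplus> z l \<in> \<mm>" using z(2) by (rule ideal_add[OF ideal_max])
  moreover have "(c \<ominus> z l) \<oplus> z l = c" using c max_carr[OF z(2)] by algebra
  ultimately show ?thesis by simp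
qed

lemma max_eq_Idl_gens: "\<mm> = Idl (gen ` S (Suc 0))"
proof
  have sub: "gen ` S (Suc 0) \<subseteq> carrier A" using gen_max max_carr by blast
  show "Idl (gen ` S (Suc 0)) \<subseteq> \<mm>" by (rule genideal_minimal[OF ideal_max]) (use gen_max in auto)
  show "\<mm> \<subseteq> Idl (gen ` S (Suc 0))"
  proof
    fix b assume "b \<in> \<mm>"
    then obtain y where y: "y \<in> carrier (F (Suc 0))" "d 0 y 0 = b" by (rule max_preimage)
    have "d 0 y 0 \<in> Idl (gen ` S (Suc 0))"
    proof (rule hom_coord_mult[OF genideal_ideal[OF sub] d_hom y(1)])
      fix i k assume i: "i \<in> S (Suc 0)"
      have yc: "y i \<in> carrier A" by (rule free_mod_apply_carrier[OF y(1)])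
      have "d 0 (delta A i) k \<in> Idl (gen ` S (Suc 0))"
      proof (cases "k = 0")
        case True
        then show ?thesis using genideal_self[OF sub] i by (auto simp: gen_def)
      next
        case False
        then have "d 0 (delta A i) k = \<zero>"
          using d_closed[OF delta_carrier[OF i]] S0 by (simp add: free_mod_carrier)
        then show ?thesis using ideal_zero[OF genideal_ideal[OF sub]] by simp
      qed
      then show "y i \<otimes> d 0 (delta A i) k \<in> Idl (gen ` S (Suc 0))"
        by (rule ideal_lmult[OF genideal_ideal[OF sub] yc])
    qed
    then show "b \<in> Idl (gen ` S (Suc 0))" using y by simp
  qed
qed

text \<open>
The element \<open>v\<close> is obtained from \<open>1\<close> by applying the homotopies \<open>s\<close> of multiplication by \<open>gen t\<close>, for \<open>t \<in> T\<close>,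
one after the other; it is the image of a basis element of the Koszul complex. In the step
\<open>d (s v) = gen t v - s (d v)\<close>, and by induction \<open>d v\<close> has coordinates in the ideal of the generators used
before. If \<open>s v\<close> had all coordinates in \<open>\<mm>\<close>, those of \<open>d (s v)\<close> would lie in \<open>\<mm>\<^sup>2\<close>. So those of \<open>gen t v\<close> would
lie in \<open>coeff_ideal t\<close>, and those of \<open>v\<close> in \<open>\<mm>\<close>.
\<close>

lemma exists_iterated_homotopy_outside_max:
  assumes "finite T" "T \<subseteq> S (Suc 0)"
  shows "\<exists>v\<in>carrier (F (card T)). (\<exists>k. v k \<notin> \<mm>)
    \<and> (\<forall>j l k. card T = Suc j \<longrightarrow> l \<in> S (Suc 0) - T \<longrightarrow> d j v k \<in> coeff_ideal l)"
  using assms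
proof (induction T rule: finite_induct)
  case empty
  have "delta A 0 \<in> carrier (F 0)" by (rule delta_carrier) (simp add: S0)
  moreover have "delta A 0 (0::nat) \<notin> \<mm>" using one_not_max by (simp add: delta_def)
  ultimately show ?case by (intro bexI[of _ "delta A 0"]) auto
next
  case (insert t T)
  define n where "n = card T"
  have t: "t \<in> S (Suc 0)" "t \<notin> T" using insert by auto
  obtain v where v: "v \<in> carrier (F n)" and vm: "\<exists>k. v k \<notin> \<mm>"
    and vK: "\<And>j l k. n = Suc j \<Longrightarrow> l \<in> S (Suc 0) - T \<Longrightarrow> d j v k \<in> coeff_ideal l"
    using insert unfolding n_def by (metis insert_subset)
  have gc: "gen t \<in> carrier A" using gen_max[OF t(1)] max_carr by blast
  obtain s where s: "\<And>i. s i \<in> mod_hom A (F i) (F (Suc i))"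
    "\<And>z. z \<in> carrier (F 0) \<Longrightarrow> d 0 (s 0 z) = gen t \<odot>\<^bsub>F 0\<^esub> z"
    "\<And>i z. z \<in> carrier (F (Suc i)) \<Longrightarrow>
      d (Suc i) (s (Suc i) z) = gen t \<odot>\<^bsub>F (Suc i)\<^esub> z \<oplus>\<^bsub>F (Suc i)\<^esub> (\<ominus> \<one>) \<odot>\<^bsub>F (Suc i)\<^esub> s i (d i z)"
    by (rule smult_homotopy[OF gen_max[OF t(1)]]) blast
  define w where "w = s n v"
  have w: "w \<in> carrier (F (Suc n))" unfolding w_def by (rule hom_closed[OF s(1) v])
  have dw: "\<exists>r. d n w k = gen t \<otimes> v k \<oplus> r \<and> (\<forall>l \<in> S (Suc 0) - T. r \<in> coeff_ideal l)" for k
  proof (cases n)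
    case 0
    have "d n w k = gen t \<otimes> v k \<oplus> \<zero>"
      unfolding w_def using 0 s(2) v gc free_mod_apply_carrier[OF v] by simp
    then show ?thesis using ideal_zero[OF ideal_coeff_ideal] by blast
  next
    case (Suc j)
    have v': "v \<in> carrier (F (Suc j))" using v Suc by simp
    have "d n w k = gen t \<otimes> v k \<oplus> (\<ominus> \<one>) \<otimes> s j (d j v) k"
      unfolding w_def using s(3)[OF v'] by (simp add: Suc)
    moreover have "(\<ominus> \<one>) \<otimes> s j (d j v) k \<in> coeff_ideal l" if l: "l \<in> S (Suc 0) - T" for l
      by (rule ideal_lmult[OF ideal_coeff_ideal _ hom_coord_ideal[OF ideal_coeff_ideal s(1) d_closed[OF v'] vK[OF Suc l]]]) simp
    ultimately show ?thesis by blast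
  qed
  have "\<exists>k. w k \<notin> \<mm>"
  proof (rule ccontr)
    assume "\<not> ?thesis"
    then have wm: "\<And>k. w k \<in> \<mm>" by blast
    have "v k \<in> \<mm>" for k
    proof (rule coeff_ideal_cancel[OF t(1) free_mod_apply_carrier[OF v]])
      obtain r where r: "d n w k = gen t \<otimes> v k \<oplus> r" "r \<in> coeff_ideal t" using dw[of k] t by blast
      have "d n w k \<in> coeff_ideal t"
        by (rule hom_coord_mult[OF ideal_coeff_ideal d_hom w]) (rule coeff_ideal_prod[OF wm d_max[OF delta_carrier]])
      then have "d n w k \<ominus> r \<in> coeff_ideal t" using r(2) by (rule ideal_diff[OF ideal_coeff_ideal])
      moreover have "d n w k \<ominus> r = gen t \<otimes> v k"
      proof -
        have c: "gen t \<otimes> v k \<in> carrier A" using gc free_mod_apply_carrier[OF v] by simp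
        have "r \<in> carrier A" by (rule ideal_carr[OF ideal_coeff_ideal r(2)])
        then show ?thesis unfolding r(1) using c by algebra
      qed
      ultimately show "gen t \<otimes> v k \<in> coeff_ideal t" by simp
    qed
    then show False using vm by blast
  qed
  moreover have "d j w k \<in> coeff_ideal l" if j: "card (insert t T) = Suc j" and l: "l \<in> S (Suc 0) - insert t T" for j l k
  proof -
    have jn: "j = n" using j t insert.hyps by (simp add: n_def)
    obtain r where r: "d n w k = gen t \<otimes> v k \<oplus> r" "r \<in> coeff_ideal l" using dw[of k] l by blast
    have "gen t \<otimes> v k \<in> coeff_ideal l"
      using gen_mem_coeff_ideal[OF t(1), of l] l by (intro ideal_rmult[OF ideal_coeff_ideal free_mod_apply_carrier[OF v]]) auto
    then show ?thesis unfolding jn r(1) using r(2) by (rule ideal_add[OF ideal_coeff_ideal])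
  qed
  moreover have "card (insert t T) = Suc n" using t insert.hyps by (simp add: n_def)
  ultimately show ?case using w by (intro bexI[of _ w]) auto
qed

lemma betti_nonzero_embdim: "S (card (S (Suc 0))) \<noteq> {}"
proof -
  obtain v k where "v \<in> carrier (F (card (S (Suc 0))))" "v k \<notin> \<mm>"
    using exists_iterated_homotopy_outside_max[OF finS subset_refl] by blast
  then have "k \<in> S (card (S (Suc 0)))" using ideal_zero[OF ideal_max] by (auto simp: free_mod_carrier)
  then show ?thesis by blast
qed

section \<open>Prolonging regular sequences\<close>

text \<open>
This says that \<open>F / I F\<close> has no homology above degree \<open>n\<close>. Induction on the regular sequence: if
\<open>d v = x u\<close> modulo \<open>I\<close>, then \<open>x (d u) = 0\<close> modulo \<open>I\<close>, hence \<open>d u = 0\<close> modulo \<open>I\<close>, because \<open>x\<close> is not a zero divisor.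
By induction \<open>u = d w\<close>, and \<open>v - x w\<close> is a cycle modulo \<open>I\<close>.
\<close>

lemma acyclic_mod_reg_ideal:
  assumes "reg_ideal n I" "n \<le> j" "v \<in> carrier (F (Suc j))" "\<And>k. d j v k \<in> I"
  shows "\<exists>w\<in>carrier (F (Suc (Suc j))). \<forall>k. v k \<ominus> d (Suc j) w k \<in> I"
  using assms
proof (induction arbitrary: j v rule: reg_ideal.induct)
  case reg_0
  then have "d j v = \<zero>\<^bsub>F j\<^esub>" by auto
  then obtain w where w: "w \<in> carrier (F (Suc (Suc j)))" "v = d (Suc j) w"
    using exact reg_0 by blast
  then show ?case using free_mod_apply_carrier[OF reg_0(2)] by (intro bexI[of _ w]) (auto simp: r_neg a_minus_def)
next
  case (reg_Suc n I x)
  have iI: "ideal I A" using reg_ideal_ideal reg_Suc by blast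
  have xc: "x \<in> carrier A" using reg_Suc max_carr by blast
  note v = \<open>v \<in> carrier (F (Suc j))\<close>
  interpret Fj: module A "F j" by (rule module_free)
  interpret Fj1: module A "F (Suc j)" by (rule module_free)
  obtain j' where j: "j = Suc j'" using \<open>Suc n \<le> j\<close> by (cases j) auto
  have "\<exists>r. r \<in> carrier A \<and> d j v k \<ominus> x \<otimes> r \<in> I \<and> (d j v k = \<zero> \<longrightarrow> r = \<zero>)" for k
  proof (cases "d j v k = \<zero>")
    case True
    then show ?thesis using ideal_zero[OF iI] xc by (intro exI[of _ \<zero>]) (auto simp: a_minus_def)
  next
    case False
    obtain i r where ir: "i \<in> I" "r \<in> carrier A" "d j v k = i \<oplus> r \<otimes> x"
      using reg_Suc.prems(3)[of k] by (rule adjoinE)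
    have "d j v k \<ominus> x \<otimes> r = i" unfolding ir(3) using ideal_carr[OF iI ir(1)] ir(2) xc by algebra
    then show ?thesis using ir False by blast
  qed
  then obtain u where u: "\<And>k. u k \<in> carrier A" "\<And>k. d j v k \<ominus> x \<otimes> u k \<in> I" "\<And>k. d j v k = \<zero> \<Longrightarrow> u k = \<zero>"
    by metis
  have dv: "d j v \<in> carrier (F j)" by (rule d_closed[OF v])
  have uF: "u \<in> carrier (F j)"
  proof -
    have "{i. u i \<noteq> \<zero>} \<subseteq> {i. d j v i \<noteq> \<zero>}" using u(3) by auto
    then show ?thesis using dv u(1,3) unfolding free_mod_carrier by (auto intro: finite_subset)
  qed
  have xu: "x \<odot>\<^bsub>F j\<^esub> u \<in> carrier (F j)" by (rule Fj.smult_closed[OF xc uF])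
  have "d j' u k \<in> I" for k
  proof -
    let ?y = "d j v \<ominus>\<^bsub>F j\<^esub> x \<odot>\<^bsub>F j\<^esub> u"
    have y: "?y \<in> carrier (F (Suc j'))" using Fj.M.minus_closed[OF dv xu] by (simp only: j)
    have "?y k \<in> I" for k using u(2)[of k] free_mod_minus[OF dv xu] by simp
    then have 1: "d j' ?y k \<in> I" by (rule hom_coord_ideal[OF iI d_hom y])
    have "d j' ?y = d j' (d j v) \<ominus>\<^bsub>F j'\<^esub> d j' (x \<odot>\<^bsub>F j\<^esub> u)"
      using hom_diff[OF module_free module_free d_hom[of j'] dv[unfolded j] xu[unfolded j]] by (simp only: j)
    also have "d j' (d j v) = \<zero>\<^bsub>F j'\<^esub>" using dd[of v j'] v by (simp only: j)
    also have "d j' (x \<odot>\<^bsub>F j\<^esub> u) = x \<odot>\<^bsub>F j'\<^esub> d j' u" using hom_smult[OF d_hom xc, of u j'] uF by (simp only: j)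
    finally have eq: "d j' ?y = \<zero>\<^bsub>F j'\<^esub> \<ominus>\<^bsub>F j'\<^esub> x \<odot>\<^bsub>F j'\<^esub> d j' u" .
    interpret Fj': module A "F j'" by (rule module_free)
    have du: "d j' u \<in> carrier (F j')" using d_closed uF j by simp
    have "d j' ?y k = \<zero> \<ominus> x \<otimes> d j' u k"
      unfolding eq using free_mod_minus[OF Fj'.zero_closed Fj'.smult_closed[OF xc du]] by simp
    then have "\<ominus> (d j' ?y k) = x \<otimes> d j' u k"
      using xc free_mod_apply_carrier[OF du] by (simp add: a_minus_def)
    then have "x \<otimes> d j' u k \<in> I" using ideal_minus[OF iI 1] by simp
    then show "d j' u k \<in> I" using reg_Suc.hyps(3) free_mod_apply_carrier[OF du] by blast
  qed
  then obtain w where w: "w \<in> carrier (F (Suc (Suc j')))" "\<forall>k. u k \<ominus> d (Suc j') w k \<in> I"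
    using reg_Suc.IH[of j' u] uF \<open>Suc n \<le> j\<close> j by auto
  have w': "w \<in> carrier (F (Suc j))" "\<And>k. u k \<ominus> d j w k \<in> I" using w by (auto simp: j)
  have xw: "x \<odot>\<^bsub>F (Suc j)\<^esub> w \<in> carrier (F (Suc j))" by (rule Fj1.smult_closed[OF xc w'(1)])
  let ?v = "v \<ominus>\<^bsub>F (Suc j)\<^esub> x \<odot>\<^bsub>F (Suc j)\<^esub> w"
  have v': "?v \<in> carrier (F (Suc j))" by (rule Fj1.M.minus_closed[OF v xw])
  have "d j ?v k \<in> I" for k
  proof -
    have "d j ?v = d j v \<ominus>\<^bsub>F j\<^esub> x \<odot>\<^bsub>F j\<^esub> d j w"
      using hom_diff[OF module_free module_free d_hom v xw] hom_smult[OF d_hom xc w'(1)] by simp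
    then have "d j ?v k = d j v k \<ominus> x \<otimes> d j w k"
      using free_mod_minus[OF dv Fj.smult_closed[OF xc d_closed[OF w'(1)]]] by simp
    also have "\<dots> = (d j v k \<ominus> x \<otimes> u k) \<oplus> x \<otimes> (u k \<ominus> d j w k)"
      using free_mod_apply_carrier[OF dv] xc u(1)[of k] free_mod_apply_carrier[OF d_closed[OF w'(1)]] by algebra
    also have "\<dots> \<in> I" by (intro ideal_add[OF iI u(2)] ideal_lmult[OF iI xc w'(2)])
    finally show ?thesis .
  qed
  then obtain y where y: "y \<in> carrier (F (Suc (Suc j)))" "\<forall>k. ?v k \<ominus> d (Suc j) y k \<in> I"
    using reg_Suc.IH[of j ?v] v' \<open>Suc n \<le> j\<close> by auto
  have "v k \<ominus> d (Suc j) y k \<in> adjoin A I x" for k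
  proof -
    have wc: "w k \<in> carrier A" by (rule free_mod_apply_carrier[OF w'(1)])
    have "v k \<ominus> d (Suc j) y k = (?v k \<ominus> d (Suc j) y k) \<oplus> w k \<otimes> x"
      using free_mod_minus[OF v xw] free_mod_apply_carrier[OF v] wc xc
        free_mod_apply_carrier[OF d_closed[OF y(1)]] by simp algebra
    then show ?thesis using adjoinI[of "?v k \<ominus> d (Suc j) y k" I "w k" x] y(2) wc by simp
  qed
  then show ?case using y(1) by blast
qed

text \<open>
If \<open>\<mm>\<close> consists of zero divisors modulo \<open>I\<close>, some \<open>s \<notin> I\<close> has \<open>\<mm> s \<subseteq> I\<close>. The differentials have entries in
\<open>\<mm>\<close>, so \<open>s\<close> times a basis element of the last module is a cycle modulo \<open>I\<close>. As nothing lies above, it would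
have to vanish modulo \<open>I\<close>.
\<close>

lemma reg_ideal_extend:
  assumes reg: "reg_ideal n I" and "n \<le> q" and ne: "S (Suc q) \<noteq> {}" and top: "S (Suc (Suc q)) = {}"
  shows "\<exists>I'. reg_ideal (Suc n) I'"
proof (rule ccontr)
  assume no: "\<not> ?thesis"
  have iI: "ideal I A" using reg_ideal_ideal reg by blast
  have "\<exists>a\<in>carrier A. a \<notin> I \<and> x \<otimes> a \<in> I" if "x \<in> \<mm>" for x
    using no reg_Suc[OF reg that] by blast
  then obtain s where s: "s \<in> carrier A" "s \<notin> I" "\<And>x. x \<in> \<mm> \<Longrightarrow> x \<otimes> s \<in> I"
    using zero_divisors_common_annihilator[OF iI ideal_max] by blast
  obtain k where k: "k \<in> S (Suc q)" using ne by blast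
  interpret Fq: module A "F (Suc q)" by (rule module_free)
  have dk: "delta A k \<in> carrier (F (Suc q))" by (rule delta_carrier[OF k])
  let ?v = "s \<odot>\<^bsub>F (Suc q)\<^esub> delta A k"
  have v: "?v \<in> carrier (F (Suc q))" by (rule Fq.smult_closed[OF s(1) dk])
  have "d q ?v i \<in> I" for i
  proof -
    have "d q ?v i = s \<otimes> d q (delta A k) i" using hom_smult[OF d_hom s(1) dk] by simp
    also have "\<dots> = d q (delta A k) i \<otimes> s" by (rule m_comm[OF s(1) max_carr[OF d_max[OF dk]]])
    finally show ?thesis using s(3)[OF d_max[OF dk]] by simp
  qed
  then obtain w where w: "w \<in> carrier (F (Suc (Suc q)))" "\<forall>i. ?v i \<ominus> d (Suc q) w i \<in> I"
    using acyclic_mod_reg_ideal[OF reg \<open>n \<le> q\<close> v] by blast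
  have "w = \<zero>\<^bsub>F (Suc (Suc q))\<^esub>" using w(1) top by (auto simp: free_mod_carrier)
  then have "d (Suc q) w = \<zero>\<^bsub>F (Suc q)\<^esub>" using hom_zero[OF module_free module_free d_hom] by simp
  then have "?v k \<ominus> \<zero> \<in> I" using w(2) by (metis free_mod_sel(1))
  then show False using s by (simp add: delta_def a_minus_def)
qed

lemma regular_of_finite_resolution:
  assumes A: "noetherian_local_ring A \<mm>" and fin: "\<And>i. i > N \<Longrightarrow> S i = {}"
  shows "regular_local_ring A \<mm>"
proof -
  have bound: "i \<le> N" if "S i \<noteq> {}" for i using fin[of i] that by (cases "i > N") auto
  define n where "n = Max {i. S i \<noteq> {}}"
  have "{i. S i \<noteq> {}} \<subseteq> {..N}"
  proof
    fix i assume "i \<in> {i. S i \<noteq> {}}"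
    then show "i \<in> {..N}" using bound[of i] by simp
  qed
  then have finite: "finite {i. S i \<noteq> {}}" by (rule finite_subset) simp
  have "S 0 \<noteq> {}" by (simp add: S0)
  then have Sn: "S n \<noteq> {}" using Max_in[OF finite] by (auto simp: n_def)
  have top: "S (Suc n) = {}"
  proof (rule ccontr)
    assume "S (Suc n) \<noteq> {}"
    then have "Suc n \<le> n" unfolding n_def by (intro Max_ge[OF finite]) simp
    then show False by simp
  qed
  have "\<exists>I. reg_ideal i I" if "i \<le> n" for i
    using that
  proof (induction i)
    case 0
    then show ?case using reg_0 by blast
  next
    case (Suc i)
    then obtain I where I: "reg_ideal i I" by auto
    obtain q where q: "n = Suc q" using Suc.prems by (cases n) auto
    show ?case by (rule reg_ideal_extend[OF I, of q]) (use Suc.prems q Sn top in auto)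
  qed
  then obtain I where I: "reg_ideal n I" by blast
  have "card (S (Suc 0)) \<le> n"
    unfolding n_def using betti_nonzero_embdim by (intro Max_ge[OF finite]) simp
  then show ?thesis
  proof (rule regularI[OF A I])
    show "finite (gen ` S (Suc 0))" using finS by simp
    show "gen ` S (Suc 0) \<subseteq> carrier A" using gen_max max_carr by blast
    show "\<mm> = Idl (gen ` S (Suc 0))" by (rule max_eq_Idl_gens)
    show "card (gen ` S (Suc 0)) \<le> card (S (Suc 0))" by (rule card_image_le[OF finS])
  qed
qed

end

section \<open>Splitting off the residue field\<close>

lemma (in module) submodule_Union_chain:
  assumes "C \<noteq> {}" "subset.chain {H. submodule H R M} C"
  shows "submodule (\<Union>C) R M"
proof -
  have sub: "\<And>H. H \<in> C \<Longrightarrow> submodule H R M" using assms(2) by (auto simp: pred_on.chain_def)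
  have tot: "\<And>H K. H \<in> C \<Longrightarrow> K \<in> C \<Longrightarrow> H \<subseteq> K \<or> K \<subseteq> H"
    using assms(2) by (auto simp: pred_on.chain_def)
  show ?thesis unfolding submodule_iff
  proof (intro conjI ballI)
    show "\<Union>C \<subseteq> carrier M" using submoduleE(1)[OF sub] by blast
    obtain H where "H \<in> C" using assms(1) by blast
    then show "\<zero>\<^bsub>M\<^esub> \<in> \<Union>C" using sub[of H] unfolding submodule_iff by blast
    show "a \<odot>\<^bsub>M\<^esub> x \<in> \<Union>C" if "a \<in> carrier R" "x \<in> \<Union>C" for a x
      using that submoduleE(4)[OF sub] by blast
    fix x y assume "x \<in> \<Union>C" "y \<in> \<Union>C"
    then obtain H K where HK: "H \<in> C" "K \<in> C" "x \<in> H" "y \<in> K" by blast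
    show "x \<oplus>\<^bsub>M\<^esub> y \<in> \<Union>C"
    proof (cases "H \<subseteq> K")
      case True
      then have "x \<oplus>\<^bsub>M\<^esub> y \<in> K" using HK submoduleE(5)[OF sub[OF HK(2)]] by blast
      then show ?thesis using HK by blast
    next
      case False
      then have "y \<in> H" using tot[OF HK(1,2)] HK by blast
      then have "x \<oplus>\<^bsub>M\<^esub> y \<in> H" using HK submoduleE(5)[OF sub[OF HK(1)]] by blast
      then show ?thesis using HK by blast
    qed
  qed
qed

context module
begin

lemma submodule_gen: "S \<subseteq> carrier M \<Longrightarrow> submodule (gen_submodule R M S) R M"
  unfolding submodule_iff gen_submodule_def
  using carrier_is_submodule by (auto simp: submodule_iff)

lemma gen_submodule_superset: "S \<subseteq> gen_submodule R M S"
  by (auto simp: gen_submodule_def)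

lemma gen_submodule_minimal: "submodule H R M \<Longrightarrow> S \<subseteq> H \<Longrightarrow> gen_submodule R M S \<subseteq> H"
  by (auto simp: gen_submodule_def)

end

text \<open>
\<open>N / H\<close> is a copy of the residue field spanned by the class of \<open>w\<close>. Take \<open>H\<close> maximal among the submodules
between \<open>\<mm> N\<close> and \<open>N\<close> that do not contain \<open>w\<close>: every \<open>v \<in> N - H\<close> then spans a module containing \<open>w\<close> modulo
\<open>H\<close>, with a unit as coefficient of \<open>v\<close>.
\<close>

lemma (in noetherian_local_ring) complement_of_minimal_generator:
  fixes M :: "('a, 'x, 'm) module_scheme"
  assumes M: "module A M" and N: "submodule N A M" and w: "w \<in> N" "w \<notin> ideal_smult A M \<mm> N"
  obtains H where "submodule H A M" "\<And>v. v \<in> N \<Longrightarrow> \<exists>a\<in>carrier A. v \<ominus>\<^bsub>M\<^esub> a \<odot>\<^bsub>M\<^esub> w \<in> H"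
    "\<And>a. a \<in> carrier A \<Longrightarrow> a \<odot>\<^bsub>M\<^esub> w \<in> H \<Longrightarrow> a \<in> \<mm>"
proof -
  interpret M: module A M by fact
  let ?mN = "ideal_smult A M \<mm> N"
  have Ac: "\<zero> \<in> carrier A" "\<one> \<in> carrier A"
    "\<And>a b. a \<in> carrier A \<Longrightarrow> b \<in> carrier A \<Longrightarrow> a \<oplus> b \<in> carrier A"
    "\<And>a b. a \<in> carrier A \<Longrightarrow> b \<in> carrier A \<Longrightarrow> a \<otimes> b \<in> carrier A" by simp_all
  have NM: "N \<subseteq> carrier M" by (rule M.submoduleE(1)[OF N])
  have gens: "{a \<odot>\<^bsub>M\<^esub> x | a x. a \<in> \<mm> \<and> x \<in> N} \<subseteq> N"
    using M.submoduleE(4)[OF N] max_carr by auto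
  have mN: "submodule ?mN A M" "?mN \<subseteq> N" "\<And>a x. a \<in> \<mm> \<Longrightarrow> x \<in> N \<Longrightarrow> a \<odot>\<^bsub>M\<^esub> x \<in> ?mN"
  proof -
    show "submodule ?mN A M" unfolding ideal_smult_def by (rule M.submodule_gen) (use gens NM in blast)
    show "?mN \<subseteq> N" unfolding ideal_smult_def by (rule M.gen_submodule_minimal[OF N gens])
    show "a \<odot>\<^bsub>M\<^esub> x \<in> ?mN" if "a \<in> \<mm>" "x \<in> N" for a x
      unfolding ideal_smult_def by (rule subsetD[OF M.gen_submodule_superset]) (use that in blast)
  qed
  let ?C = "{H. submodule H A M \<and> ?mN \<subseteq> H \<and> H \<subseteq> N \<and> w \<notin> H}"
  have "\<exists>H\<in>?C. \<forall>K\<in>?C. H \<subseteq> K \<longrightarrow> K = H"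
  proof (rule subset_Zorn_nonempty)
    show "?C \<noteq> {}" using mN w by blast
    fix \<K> assume K: "\<K> \<noteq> {}" "subset.chain ?C \<K>"
    then have "submodule (\<Union>\<K>) A M"
      by (intro M.submodule_Union_chain) (auto simp: pred_on.chain_def)
    moreover have "\<K> \<subseteq> ?C" using K(2) by (simp add: pred_on.chain_def)
    then have "?mN \<subseteq> \<Union>\<K>" "\<Union>\<K> \<subseteq> N" "w \<notin> \<Union>\<K>" using K(1) by blast+
    ultimately show "\<Union>\<K> \<in> ?C" by blast
  qed
  then obtain H where HC: "H \<in> ?C" and max0: "\<forall>K\<in>?C. H \<subseteq> K \<longrightarrow> K = H" ..
  have H: "submodule H A M" "?mN \<subseteq> H" "H \<subseteq> N" "w \<notin> H" using HC by simp_all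
  have max: "K = H" if "K \<in> ?C" "H \<subseteq> K" for K using bspec[OF max0 that(1)] that(2) by (rule mp)
  have wc: "w \<in> carrier M" using w NM by blast
  show ?thesis
  proof (rule that[OF H(1)])
    fix a assume a: "a \<in> carrier A" "a \<odot>\<^bsub>M\<^esub> w \<in> H"
    show "a \<in> \<mm>"
    proof (rule ccontr)
      assume "a \<notin> \<mm>"
      then obtain b where b: "b \<in> carrier A" "b \<otimes> a = \<one>" using inverse_outside_max a by blast
      have "b \<odot>\<^bsub>M\<^esub> (a \<odot>\<^bsub>M\<^esub> w) \<in> H" by (rule M.submoduleE(4)[OF H(1) b(1) a(2)])
      then show False using H(4) b a wc by (simp flip: M.smult_assoc1)
    qed
  next
    fix v assume v: "v \<in> N"
    have vc: "v \<in> carrier M" using v NM by blast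
    show "\<exists>a\<in>carrier A. v \<ominus>\<^bsub>M\<^esub> a \<odot>\<^bsub>M\<^esub> w \<in> H"
    proof (cases "v \<in> H")
      case True
      have "v \<ominus>\<^bsub>M\<^esub> \<zero> \<odot>\<^bsub>M\<^esub> w = v" using vc wc by (simp add: a_minus_def)
      then show ?thesis using True Ac(1) by metis
    next
      case False
      let ?K = "{h \<oplus>\<^bsub>M\<^esub> r \<odot>\<^bsub>M\<^esub> v | h r. h \<in> H \<and> r \<in> carrier A}"
      have Hc: "\<And>h. h \<in> H \<Longrightarrow> h \<in> carrier M" using H(3) NM by blast
      have H0: "\<zero>\<^bsub>M\<^esub> \<in> H" using H(1) by (simp add: M.submodule_iff)
      have K: "submodule ?K A M" unfolding M.submodule_iff
      proof (intro conjI ballI)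
        show "?K \<subseteq> carrier M" using Hc vc by auto
        have "\<zero>\<^bsub>M\<^esub> = \<zero>\<^bsub>M\<^esub> \<oplus>\<^bsub>M\<^esub> \<zero> \<odot>\<^bsub>M\<^esub> v" using vc by simp
        then show "\<zero>\<^bsub>M\<^esub> \<in> ?K" using H0 by blast
      next
        fix y z assume "y \<in> ?K" "z \<in> ?K"
        then obtain h r h' r' where hr: "h \<in> H" "r \<in> carrier A" "h' \<in> H" "r' \<in> carrier A"
          and eq: "y = h \<oplus>\<^bsub>M\<^esub> r \<odot>\<^bsub>M\<^esub> v" "z = h' \<oplus>\<^bsub>M\<^esub> r' \<odot>\<^bsub>M\<^esub> v" by blast
        have "y \<oplus>\<^bsub>M\<^esub> z = (h \<oplus>\<^bsub>M\<^esub> h') \<oplus>\<^bsub>M\<^esub> (r \<oplus> r') \<odot>\<^bsub>M\<^esub> v"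
          unfolding eq using hr Hc vc by (simp add: M.smult_l_distr M.M.a_ac)
        moreover have "h \<oplus>\<^bsub>M\<^esub> h' \<in> H" by (rule M.submoduleE(5)[OF H(1) hr(1,3)])
        ultimately show "y \<oplus>\<^bsub>M\<^esub> z \<in> ?K" using hr Ac(3) by blast
      next
        fix c z assume c: "c \<in> carrier A" and "z \<in> ?K"
        then obtain h r where hr: "h \<in> H" "r \<in> carrier A" and eq: "z = h \<oplus>\<^bsub>M\<^esub> r \<odot>\<^bsub>M\<^esub> v" by blast
        have "c \<odot>\<^bsub>M\<^esub> z = c \<odot>\<^bsub>M\<^esub> h \<oplus>\<^bsub>M\<^esub> (c \<otimes> r) \<odot>\<^bsub>M\<^esub> v"
          unfolding eq using hr Hc vc c by (simp add: M.smult_r_distr M.smult_assoc1)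
        moreover have "c \<odot>\<^bsub>M\<^esub> h \<in> H" by (rule M.submoduleE(4)[OF H(1) c hr(1)])
        ultimately show "c \<odot>\<^bsub>M\<^esub> z \<in> ?K" using hr c Ac(4) by blast
      qed
      have HK: "H \<subseteq> ?K"
      proof
        fix h assume h: "h \<in> H"
        have "h = h \<oplus>\<^bsub>M\<^esub> \<zero> \<odot>\<^bsub>M\<^esub> v" using Hc[OF h] vc by simp
        then show "h \<in> ?K" using h Ac(1) by blast
      qed
      have "v = \<zero>\<^bsub>M\<^esub> \<oplus>\<^bsub>M\<^esub> \<one> \<odot>\<^bsub>M\<^esub> v" using vc by simp
      then have vK: "v \<in> ?K" using H0 Ac(2) by blast
      have KN: "?K \<subseteq> N"
        using H(3) v M.submoduleE(4)[OF N] M.submoduleE(5)[OF N] by blast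
      have "w \<in> ?K"
      proof (rule ccontr)
        assume "w \<notin> ?K"
        then have "?K = H" using max[of ?K] K HK KN H(2) by blast
        then show False using vK False by blast
      qed
      then obtain h r where hr: "h \<in> H" "r \<in> carrier A" and eq: "w = h \<oplus>\<^bsub>M\<^esub> r \<odot>\<^bsub>M\<^esub> v" by blast
      have "r \<notin> \<mm>"
      proof
        assume "r \<in> \<mm>"
        then have "r \<odot>\<^bsub>M\<^esub> v \<in> H" using mN(3) v H(2) by blast
        then have "w \<in> H" unfolding eq by (rule M.submoduleE(5)[OF H(1) hr(1)])
        then show False using H(4) by simp
      qed
      then obtain b where b: "b \<in> carrier A" "b \<otimes> r = \<one>" using inverse_outside_max hr by blast
      have "b \<odot>\<^bsub>M\<^esub> w = b \<odot>\<^bsub>M\<^esub> h \<oplus>\<^bsub>M\<^esub> (b \<otimes> r) \<odot>\<^bsub>M\<^esub> v"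
        unfolding eq using hr Hc vc b(1) by (simp add: M.smult_r_distr M.smult_assoc1)
      then have bw: "b \<odot>\<^bsub>M\<^esub> w = b \<odot>\<^bsub>M\<^esub> h \<oplus>\<^bsub>M\<^esub> v" using b vc by simp
      have bh: "b \<odot>\<^bsub>M\<^esub> h \<in> H" by (rule M.submoduleE(4)[OF H(1) b(1) hr(1)])
      have "v \<ominus>\<^bsub>M\<^esub> b \<odot>\<^bsub>M\<^esub> w = \<ominus>\<^bsub>M\<^esub> (b \<odot>\<^bsub>M\<^esub> h)"
        unfolding bw a_minus_def
        using Hc[OF bh] vc M.M.a_lcomm[of v "\<ominus>\<^bsub>M\<^esub> (b \<odot>\<^bsub>M\<^esub> h)" "\<ominus>\<^bsub>M\<^esub> v"]
        by (simp add: M.M.minus_add M.M.r_neg)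
      then have "v \<ominus>\<^bsub>M\<^esub> b \<odot>\<^bsub>M\<^esub> w \<in> H" using M.submoduleE(3)[OF H(1) bh] by simp
      then show ?thesis using b(1) by blast
    qed
  qed
qed

context minimal_resolution
begin

text \<open>
The map \<open>g\<close> lifts the functional \<open>a w + H \<mapsto> a + \<mm>\<close> to a homomorphism into \<open>A\<close>. By the dual
basis its values on the generators can be chosen freely.
\<close>

lemma functional_on_cover:
  fixes P :: "('a, 'c, 'p) module_scheme" and M :: "('a, 'b, 'm) module_scheme"
  assumes P: "module A P" and M: "module A M" and db: "dual_basis A P (carrier P) (\<lambda>x. x) c"
    and e: "e \<in> mod_hom A P M" and H: "submodule H A M" and w: "w \<in> carrier M"
    and cov: "\<And>p. p \<in> carrier P \<Longrightarrow> \<exists>a\<in>carrier A. e p \<ominus>\<^bsub>M\<^esub> a \<odot>\<^bsub>M\<^esub> w \<in> H"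
  obtains g where "g \<in> mod_hom A P (F 0)"
    "\<And>p. p \<in> carrier P \<Longrightarrow> e p \<ominus>\<^bsub>M\<^esub> g p 0 \<odot>\<^bsub>M\<^esub> w \<in> H"
proof -
  interpret P: module A P by fact
  interpret M: module A M by fact
  interpret F0: module A "F 0" by (rule module_free)
  have c: "c \<in> mod_hom A P (free_mod A (carrier P))" and bc: "\<And>p. p \<in> carrier P \<Longrightarrow> lin A P (\<lambda>x. x) (c p) = p"
    using db by (auto simp: dual_basis_def)
  obtain al where al: "\<And>p. p \<in> carrier P \<Longrightarrow> al p \<in> carrier A"
    "\<And>p. p \<in> carrier P \<Longrightarrow> e p \<ominus>\<^bsub>M\<^esub> al p \<odot>\<^bsub>M\<^esub> w \<in> H" using cov by metis
  have d0: "delta A 0 \<in> carrier (F 0)" by (rule delta_carrier) (simp add: S0)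
  let ?b = "\<lambda>p. al p \<odot>\<^bsub>F 0\<^esub> delta A 0"
  have b: "?b \<in> carrier P \<rightarrow> carrier (F 0)" using F0.smult_closed[OF al(1) d0] by blast
  have eP: "e \<in> carrier P \<rightarrow> carrier M" using hom_closed[OF e] by blast
  have G: "lin A (F 0) ?b \<in> mod_hom A (free_mod A (carrier P)) (F 0)" by (rule lin_hom[OF module_free b])
  have W: "(\<lambda>z. z 0 \<odot>\<^bsub>M\<^esub> w) \<in> mod_hom A (F 0) M"
    by (rule homI) (use w in \<open>auto simp: free_mod_apply_carrier M.smult_l_distr M.smult_assoc1\<close>)
  \<comment> \<open>The asserted difference, as a linear function of the coordinates of \<open>p\<close>, so that it can be tested on generators.\<close>
  let ?\<Phi> = "\<lambda>y. lin A M e y \<ominus>\<^bsub>M\<^esub> lin A (F 0) ?b y 0 \<odot>\<^bsub>M\<^esub> w"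
  have Phi: "?\<Phi> \<in> mod_hom A (free_mod A (carrier P)) M"
    by (rule hom_subtract[OF M lin_hom[OF M eP] hom_comp[OF G W]])
  show ?thesis
  proof (rule that[of "\<lambda>p. lin A (F 0) ?b (c p)"])
    show "(\<lambda>p. lin A (F 0) ?b (c p)) \<in> mod_hom A P (F 0)" by (rule hom_comp[OF c G])
    fix p assume p: "p \<in> carrier P"
    have cp: "c p \<in> carrier (free_mod A (carrier P))" by (rule hom_closed[OF c p])
    have "?\<Phi> (c p) \<in> H"
    proof (subst hom_expand[OF M Phi cp], rule lin_mem_submodule[OF M H])
      fix q assume "c p q \<noteq> \<zero>"
      then have q: "q \<in> carrier P" using cp by (auto simp: free_mod_carrier)
      have 1: "lin A M e (delta A q) = e q" by (rule lin_delta[OF M eP q])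
      have 2: "lin A (F 0) ?b (delta A q) 0 = al q"
        using lin_delta[OF module_free b q] al(1)[OF q] by (simp add: delta_def)
      have "?\<Phi> (delta A q) \<in> H" unfolding 1 2 by (rule al(2)[OF q])
      then show "c p q \<odot>\<^bsub>M\<^esub> ?\<Phi> (delta A q) \<in> H"
        by (rule M.submoduleE(4)[OF H free_mod_apply_carrier[OF cp]])
    qed
    moreover have "lin A M e (c p) = e p"
    proof -
      have "e (lin A P (\<lambda>x. x) (c p)) = lin A M e (c p)"
        by (rule hom_lin[OF P M e _ cp]) auto
      then show ?thesis using bc[OF p] by simp
    qed
    ultimately show "e p \<ominus>\<^bsub>M\<^esub> lin A (F 0) ?b (c p) 0 \<odot>\<^bsub>M\<^esub> w \<in> H" by simp
  qed
qed

end

section \<open>Comparison of the two resolutions\<close>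

text \<open>
The data of the first half: \<open>P\<close> with augmentation \<open>e\<close> is a resolution of \<open>N\<close> by modules with dual bases,
and \<open>x u\<close> is a minimal generator of \<open>N\<close>, while \<open>\<mm> u \<subseteq> N\<close>. In degree \<open>i\<close> the mapping cone of \<open>x : P \<rightarrow> P\<close> is the sum of
\<open>P i\<close> and \<open>P (i - 1)\<close>. Maps into and out of it are given by their two components.
\<close>

locale covered_minimal_generator = minimal_resolution A \<mm> S d
  for A :: "('a, 'r) ring_scheme" (structure) and \<mm> S d +
  fixes M :: "('a, 'b, 'm) module_scheme" and N :: "'b set"
    and P :: "nat \<Rightarrow> ('a, 'c, 'p) module_scheme" and dP e c and x u
  assumes M: "module A M" and N: "submodule N A M"
    and P: "module A (P i)" and db: "dual_basis A (P i) (carrier (P i)) (\<lambda>p. p) (c i)"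
    and dP_hom: "dP i \<in> mod_hom A (P (Suc i)) (P i)"
    and e_hom: "e \<in> mod_hom A (P 0) M" and e_image: "e ` carrier (P 0) = N"
    and e_ker: "{p \<in> carrier (P 0). e p = \<zero>\<^bsub>M\<^esub>} = dP 0 ` carrier (P (Suc 0))"
    and dP_ker: "{p \<in> carrier (P (Suc i)). dP i p = \<zero>\<^bsub>P i\<^esub>} = dP (Suc i) ` carrier (P (Suc (Suc i)))"
    and x: "x \<in> \<mm>" and u: "u \<in> carrier M" and max_u: "a \<in> \<mm> \<Longrightarrow> a \<odot>\<^bsub>M\<^esub> u \<in> N"
    and xu: "x \<odot>\<^bsub>M\<^esub> u \<notin> ideal_smult A M \<mm> N"
begin

lemma xc: "x \<in> carrier A"
  by (rule max_carr[OF x])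

lemma dP_closed: "p \<in> carrier (P (Suc i)) \<Longrightarrow> dP i p \<in> carrier (P i)"
  by (rule hom_closed[OF dP_hom])

lemma ddP: "p \<in> carrier (P (Suc (Suc i))) \<Longrightarrow> dP i (dP (Suc i) p) = \<zero>\<^bsub>P i\<^esub>"
  using dP_ker[of i] by blast

lemma e_dP: "p \<in> carrier (P (Suc 0)) \<Longrightarrow> e (dP 0 p) = \<zero>\<^bsub>M\<^esub>"
  using e_ker by blast

lemma exactP: "p \<in> carrier (P (Suc i)) \<Longrightarrow> dP i p = \<zero>\<^bsub>P i\<^esub> \<Longrightarrow> p \<in> dP (Suc i) ` carrier (P (Suc (Suc i)))"
  using dP_ker[of i] by blast

lemma exactP0: "p \<in> carrier (P 0) \<Longrightarrow> e p = \<zero>\<^bsub>M\<^esub> \<Longrightarrow> p \<in> dP 0 ` carrier (P (Suc 0))"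
  using e_ker by blast

lemma projective_P: "projective_complex A P dP (\<lambda>i. carrier (P i)) (\<lambda>_ p. p) c"
  by (simp add: projective_complex_def P db dP_hom ddP)

lemma acyclic_P: "acyclic_complex A P dP"
  unfolding acyclic_complex_def using P dP_hom exactP by blast

text \<open>
The component on \<open>P\<close> of the chain map from the cone to \<open>F\<close>. It lifts the projection of \<open>N\<close> onto its
residue field quotient in which \<open>x u\<close> becomes \<open>1\<close>.
\<close>

lemma to_residue:
  obtains g where "\<And>i. g i \<in> mod_hom A (P i) (F i)"
    "\<And>i p. p \<in> carrier (P (Suc i)) \<Longrightarrow> d i (g (Suc i) p) = g i (dP i p)"
    "\<And>p. p \<in> carrier (P 0) \<Longrightarrow> e p = x \<odot>\<^bsub>M\<^esub> u \<Longrightarrow> \<one> \<ominus> g 0 p 0 \<in> \<mm>"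
proof -
  interpret M: module A M by (rule M)
  let ?w = "x \<odot>\<^bsub>M\<^esub> u"
  have w: "?w \<in> N" by (rule max_u[OF x])
  have wc: "?w \<in> carrier M" using xc u by simp
  obtain H where H: "submodule H A M" "\<And>v. v \<in> N \<Longrightarrow> \<exists>a\<in>carrier A. v \<ominus>\<^bsub>M\<^esub> a \<odot>\<^bsub>M\<^esub> ?w \<in> H"
    "\<And>a. a \<in> carrier A \<Longrightarrow> a \<odot>\<^bsub>M\<^esub> ?w \<in> H \<Longrightarrow> a \<in> \<mm>"
    by (rule complement_of_minimal_generator[OF M N w xu]) blast
  have "\<exists>a\<in>carrier A. e p \<ominus>\<^bsub>M\<^esub> a \<odot>\<^bsub>M\<^esub> ?w \<in> H" if "p \<in> carrier (P 0)" for p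
    using H(2) e_image that by blast
  then obtain g0 where g0: "g0 \<in> mod_hom A (P 0) (F 0)"
    "\<And>p. p \<in> carrier (P 0) \<Longrightarrow> e p \<ominus>\<^bsub>M\<^esub> g0 p 0 \<odot>\<^bsub>M\<^esub> ?w \<in> H"
    using functional_on_cover[OF P M db e_hom H(1) wc] by blast
  have g0c: "g0 p 0 \<in> carrier A" if "p \<in> carrier (P 0)" for p
    by (rule free_mod_apply_carrier[OF hom_closed[OF g0(1) that]])
  have g0d: "g0 (dP 0 p) 0 \<in> \<mm>" if p: "p \<in> carrier (P (Suc 0))" for p
  proof -
    have c: "dP 0 p \<in> carrier (P 0)" by (rule dP_closed[OF p])
    have "\<ominus>\<^bsub>M\<^esub> (g0 (dP 0 p) 0 \<odot>\<^bsub>M\<^esub> ?w) \<in> H"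
      using g0(2)[OF c] e_dP[OF p] g0c[OF c] wc by (simp add: a_minus_def)
    then have "\<ominus>\<^bsub>M\<^esub> (\<ominus>\<^bsub>M\<^esub> (g0 (dP 0 p) 0 \<odot>\<^bsub>M\<^esub> ?w)) \<in> H" by (rule M.submoduleE(3)[OF H(1)])
    then have "g0 (dP 0 p) 0 \<odot>\<^bsub>M\<^esub> ?w \<in> H" using g0c[OF c] wc M.M.minus_minus by simp
    then show ?thesis by (rule H(3)[OF g0c[OF c]])
  qed
  obtain h where h: "\<And>i. h i \<in> mod_hom A (P (Suc i)) (F (Suc i))"
    "\<And>p. p \<in> carrier (P (Suc 0)) \<Longrightarrow> d 0 (h 0 p) = g0 (dP 0 p)"
    "\<And>i p. p \<in> carrier (P (Suc (Suc i))) \<Longrightarrow> d (Suc i) (h (Suc i) p)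
        = \<zero>\<^bsub>F (Suc i)\<^esub> \<oplus>\<^bsub>F (Suc i)\<^esub> \<one> \<odot>\<^bsub>F (Suc i)\<^esub> h i (dP (Suc i) p)"
  proof (rule chain_lift[OF projective_complex_shift[OF projective_P] acyclic_F, where e = "\<one>"
        and \<theta> = "\<lambda>i. if i = 0 then (\<lambda>p. g0 (dP 0 p)) else (\<lambda>p. \<zero>\<^bsub>F i\<^esub>)"])
    show "(if i = 0 then (\<lambda>p. g0 (dP 0 p)) else (\<lambda>p. \<zero>\<^bsub>F i\<^esub>)) \<in> mod_hom A (P (Suc i)) (F i)" for i
      using hom_comp[OF dP_hom g0(1)] hom_const_zero[OF module_free] by (cases i) auto
    show "(if (0::nat) = 0 then (\<lambda>p. g0 (dP 0 p)) else (\<lambda>p. \<zero>\<^bsub>F 0\<^esub>)) p \<in> d 0 ` carrier (F (Suc 0))"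
      if p: "p \<in> carrier (P (Suc 0))" for p
      using F0_mem_image[OF hom_closed[OF g0(1) dP_closed[OF p]] g0d[OF p]] by simp
    show "\<one> \<in> carrier A" by simp
    show "d i ((if Suc i = 0 then (\<lambda>p. g0 (dP 0 p)) else (\<lambda>p. \<zero>\<^bsub>F (Suc i)\<^esub>)) p) \<oplus>\<^bsub>F i\<^esub>
        \<one> \<odot>\<^bsub>F i\<^esub> (if i = 0 then (\<lambda>p. g0 (dP 0 p)) else (\<lambda>p. \<zero>\<^bsub>F i\<^esub>)) (dP (Suc i) p) = \<zero>\<^bsub>F i\<^esub>"
      if p: "p \<in> carrier (P (Suc (Suc i)))" for i p
    proof -
      have "d i \<zero>\<^bsub>F (Suc i)\<^esub> = \<zero>\<^bsub>F i\<^esub>" by (rule hom_zero[OF module_free module_free d_hom])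
      moreover have "g0 (dP 0 (dP (Suc 0) p)) = \<zero>\<^bsub>F 0\<^esub>" if "i = 0"
        using that ddP[of p 0] p hom_zero[OF P module_free g0(1)] by simp
      ultimately show ?thesis by (cases i) auto
    qed
  qed (use that in auto)
  let ?g = "\<lambda>i. case i of 0 \<Rightarrow> g0 | Suc j \<Rightarrow> h j"
  show ?thesis
  proof (rule that[of ?g])
    show "?g i \<in> mod_hom A (P i) (F i)" for i using g0(1) h(1) by (cases i) auto
    show "d i (?g (Suc i) p) = ?g i (dP i p)" if p: "p \<in> carrier (P (Suc i))" for i p
    proof (cases i)
      case 0
      then show ?thesis using h(2) p by simp
    next
      case (Suc j)
      have "h j (dP (Suc j) p) \<in> carrier (F (Suc j))"
        using p by (intro hom_closed[OF h(1)] dP_closed) (simp add: Suc)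
      then show ?thesis using h(3)[of p j] p free_mod_apply_carrier by (fastforce simp: Suc)
    qed
    show "\<one> \<ominus> ?g 0 p 0 \<in> \<mm>" if p: "p \<in> carrier (P 0)" "e p = ?w" for p
    proof -
      have "(\<one> \<ominus> g0 p 0) \<odot>\<^bsub>M\<^esub> ?w = ?w \<ominus>\<^bsub>M\<^esub> g0 p 0 \<odot>\<^bsub>M\<^esub> ?w"
        using g0c[OF p(1)] wc by (simp add: a_minus_def M.smult_l_distr M.smult_l_minus)
      also have "\<dots> \<in> H" using g0(2)[OF p(1)] p(2) by simp
      finally show ?thesis using H(3)[of "\<one> \<ominus> g0 p 0"] g0c[OF p(1)] by simp
    qed
  qed
qed

text \<open>
The component on the shifted copy of \<open>P\<close> of the chain map from the cone to \<open>F\<close>. It is a null homotopy of \<open>x g\<close>,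
which exists because \<open>x\<close> kills the residue field.
\<close>

lemma to_residue_homotopy:
  assumes g: "\<And>i. g i \<in> mod_hom A (P i) (F i)"
    and gd: "\<And>i p. p \<in> carrier (P (Suc i)) \<Longrightarrow> d i (g (Suc i) p) = g i (dP i p)"
  obtains k where "\<And>i. k i \<in> mod_hom A (P i) (F (Suc i))"
    "\<And>p. p \<in> carrier (P 0) \<Longrightarrow> d 0 (k 0 p) = x \<odot>\<^bsub>F 0\<^esub> g 0 p"
    "\<And>i p. p \<in> carrier (P (Suc i)) \<Longrightarrow> d (Suc i) (k (Suc i) p)
        = x \<odot>\<^bsub>F (Suc i)\<^esub> g (Suc i) p \<oplus>\<^bsub>F (Suc i)\<^esub> (\<ominus> \<one>) \<odot>\<^bsub>F (Suc i)\<^esub> k i (dP i p)"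
proof (rule chain_lift[OF projective_P acyclic_F, where e = "\<ominus> \<one>" and \<theta> = "\<lambda>i p. x \<odot>\<^bsub>F i\<^esub> g i p"])
  show "(\<lambda>p. x \<odot>\<^bsub>F i\<^esub> g i p) \<in> mod_hom A (P i) (F i)" for i by (rule hom_scale[OF module_free g xc])
  show "\<ominus> \<one> \<in> carrier A" by simp
  show "x \<odot>\<^bsub>F 0\<^esub> g 0 p \<in> d 0 ` carrier (F (Suc 0))" if p: "p \<in> carrier (P 0)" for p
  proof (rule F0_mem_image)
    have gp: "g 0 p \<in> carrier (F 0)" by (rule hom_closed[OF g p])
    interpret F0: module A "F 0" by (rule module_free)
    show "x \<odot>\<^bsub>F 0\<^esub> g 0 p \<in> carrier (F 0)" by (rule F0.smult_closed[OF xc gp])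
    show "(x \<odot>\<^bsub>F 0\<^esub> g 0 p) 0 \<in> \<mm>"
      using ideal_rmult[OF ideal_max free_mod_apply_carrier[OF gp] x] by simp
  qed
  show "d i (x \<odot>\<^bsub>F (Suc i)\<^esub> g (Suc i) p) \<oplus>\<^bsub>F i\<^esub> (\<ominus> \<one>) \<odot>\<^bsub>F i\<^esub> (x \<odot>\<^bsub>F i\<^esub> g i (dP i p)) = \<zero>\<^bsub>F i\<^esub>"
    if p: "p \<in> carrier (P (Suc i))" for i p
  proof -
    have "d i (x \<odot>\<^bsub>F (Suc i)\<^esub> g (Suc i) p) = x \<odot>\<^bsub>F i\<^esub> g i (dP i p)"
      using hom_smult[OF d_hom xc hom_closed[OF g p]] gd[OF p] by simp
    then show ?thesis
      using free_mod_apply_carrier[OF hom_closed[OF g dP_closed[OF p]]] xc by (simp add: l_minus r_neg)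
  qed
qed (use that in blast)

text \<open>
The component in the shifted copy of \<open>P\<close> of the chain map from \<open>F\<close> to the cone. It lifts the map
\<open>\<mm> \<rightarrow> N\<close>, \<open>a \<mapsto> a u\<close>, from the first syzygy of the residue field; the sign is the one of the shifted
differential.
\<close>

lemma from_syzygy:
  obtains f where "\<And>i. f i \<in> mod_hom A (F (Suc i)) (P i)"
    "\<And>z. z \<in> carrier (F (Suc 0)) \<Longrightarrow> e (f 0 z) = d 0 z 0 \<odot>\<^bsub>M\<^esub> u"
    "\<And>i z. z \<in> carrier (F (Suc (Suc i))) \<Longrightarrow> dP i (f (Suc i) z) = \<ominus>\<^bsub>P i\<^esub> f i (d (Suc i) z)"
proof -
  interpret M: module A M by (rule M)
  let ?r = "\<lambda>z. d 0 z 0 \<odot>\<^bsub>M\<^esub> u"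
  have U: "(\<lambda>z. z 0 \<odot>\<^bsub>M\<^esub> u) \<in> mod_hom A (F 0) M"
    by (rule homI) (use u in \<open>auto simp: free_mod_apply_carrier M.smult_l_distr M.smult_assoc1\<close>)
  have r: "?r \<in> mod_hom A (F (Suc 0)) M" by (rule hom_comp[OF d_hom U])
  have im: "?r z \<in> e ` carrier (P 0)" if "z \<in> carrier (F (Suc 0))" for z
    unfolding e_image by (rule max_u[OF d_max[OF that]])
  obtain k where k: "k \<in> mod_hom A (F (Suc 0)) (P 0)" "\<forall>z\<in>carrier (F (Suc 0)). e (k z) = ?r z"
    using dual_basis_lift[OF module_free P M dual_basis_free r e_hom im] by blast
  obtain h where h: "\<And>i. h i \<in> mod_hom A (F (Suc (Suc i))) (P (Suc i))"
    "\<And>z. z \<in> carrier (F (Suc (Suc 0))) \<Longrightarrow> dP 0 (h 0 z) = \<ominus>\<^bsub>P 0\<^esub> k (d (Suc 0) z)"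
    "\<And>i z. z \<in> carrier (F (Suc (Suc (Suc i)))) \<Longrightarrow> dP (Suc i) (h (Suc i) z)
        = \<zero>\<^bsub>P (Suc i)\<^esub> \<oplus>\<^bsub>P (Suc i)\<^esub> (\<ominus> \<one>) \<odot>\<^bsub>P (Suc i)\<^esub> h i (d (Suc (Suc i)) z)"
  proof (rule chain_lift[OF projective_complex_shift[OF projective_complex_shift[OF projective_F]] acyclic_P,
        where e = "\<ominus> \<one>" and \<theta> = "\<lambda>i. if i = 0 then (\<lambda>z. \<ominus>\<^bsub>P 0\<^esub> k (d (Suc 0) z)) else (\<lambda>z. \<zero>\<^bsub>P i\<^esub>)"])
    show "(if i = 0 then (\<lambda>z. \<ominus>\<^bsub>P 0\<^esub> k (d (Suc 0) z)) else (\<lambda>z. \<zero>\<^bsub>P i\<^esub>)) \<in> mod_hom A (F (Suc (Suc i))) (P i)" for i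
      using hom_minus[OF P hom_comp[OF d_hom k(1)]] hom_const_zero[OF P] by (cases i) auto
    show "\<ominus> \<one> \<in> carrier A" by simp
    show "(if (0::nat) = 0 then (\<lambda>z. \<ominus>\<^bsub>P 0\<^esub> k (d (Suc 0) z)) else (\<lambda>z. \<zero>\<^bsub>P 0\<^esub>)) z \<in> dP 0 ` carrier (P (Suc 0))"
      if z: "z \<in> carrier (F (Suc (Suc 0)))" for z
    proof -
      interpret P0: module A "P 0" by (rule P)
      have dz: "d (Suc 0) z \<in> carrier (F (Suc 0))" by (rule d_closed[OF z])
      have kc: "k (d (Suc 0) z) \<in> carrier (P 0)" by (rule hom_closed[OF k(1) dz])
      have "e (k (d (Suc 0) z)) = \<zero>\<^bsub>M\<^esub>" using k(2) dz dd[OF z] u by simp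
      then have "e (\<ominus>\<^bsub>P 0\<^esub> k (d (Suc 0) z)) = \<zero>\<^bsub>M\<^esub>" using hom_neg[OF P M e_hom kc] by simp
      then show ?thesis using exactP0[OF P0.M.a_inv_closed[OF kc]] by simp
    qed
    show "dP i ((if Suc i = 0 then (\<lambda>z. \<ominus>\<^bsub>P 0\<^esub> k (d (Suc 0) z)) else (\<lambda>z. \<zero>\<^bsub>P (Suc i)\<^esub>)) z) \<oplus>\<^bsub>P i\<^esub>
        (\<ominus> \<one>) \<odot>\<^bsub>P i\<^esub> (if i = 0 then (\<lambda>z. \<ominus>\<^bsub>P 0\<^esub> k (d (Suc 0) z)) else (\<lambda>z. \<zero>\<^bsub>P i\<^esub>)) (d (Suc (Suc i)) z) = \<zero>\<^bsub>P i\<^esub>"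
      if z: "z \<in> carrier (F (Suc (Suc (Suc i))))" for i z
    proof -
      interpret Pi: module A "P i" by (rule P)
      have "dP i \<zero>\<^bsub>P (Suc i)\<^esub> = \<zero>\<^bsub>P i\<^esub>" by (rule hom_zero[OF P P dP_hom])
      moreover have "k (d (Suc 0) (d (Suc (Suc 0)) z)) = \<zero>\<^bsub>P 0\<^esub>" if "i = 0"
        using that dd[of z "Suc 0"] z hom_zero[OF module_free P k(1)] by simp
      moreover have "(\<ominus> \<one>) \<odot>\<^bsub>P i\<^esub> \<zero>\<^bsub>P i\<^esub> = \<zero>\<^bsub>P i\<^esub>" "\<zero>\<^bsub>P i\<^esub> \<oplus>\<^bsub>P i\<^esub> \<zero>\<^bsub>P i\<^esub> = \<zero>\<^bsub>P i\<^esub>"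
        "\<ominus>\<^bsub>P i\<^esub> \<zero>\<^bsub>P i\<^esub> = \<zero>\<^bsub>P i\<^esub>" by simp_all
      ultimately show ?thesis by (cases i) auto
    qed
  qed (use that in auto)
  let ?f = "\<lambda>i. case i of 0 \<Rightarrow> k | Suc j \<Rightarrow> h j"
  show ?thesis
  proof (rule that[of ?f])
    show "?f i \<in> mod_hom A (F (Suc i)) (P i)" for i using k(1) h(1) by (cases i) auto
    show "e (?f 0 z) = d 0 z 0 \<odot>\<^bsub>M\<^esub> u" if "z \<in> carrier (F (Suc 0))" for z using k(2) that by simp
    show "dP i (?f (Suc i) z) = \<ominus>\<^bsub>P i\<^esub> ?f i (d (Suc i) z)" if z: "z \<in> carrier (F (Suc (Suc i)))" for i z
    proof (cases i)
      case 0
      then show ?thesis using h(2) z by simp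
    next
      case (Suc j)
      interpret Pj: module A "P (Suc j)" by (rule P)
      have "h j (d (Suc (Suc j)) z) \<in> carrier (P (Suc j))"
        using z by (intro hom_closed[OF h(1)] d_closed) (simp add: Suc)
      then show ?thesis using h(3)[of z j] z by (simp add: Suc Pj.smult_l_minus)
    qed
  qed
qed

text \<open>
The component in \<open>P\<close> of the chain map from \<open>F\<close> to the cone. It starts with \<open>1 \<mapsto> p0\<close>, and it is not a chain
map by itself: for \<open>a \<in> \<mm>\<close>, the element \<open>a p0\<close> lies over \<open>a (x u) = x (a u)\<close> and becomes a boundary after
subtracting \<open>x\<close> times the element over \<open>a u\<close> that \<open>f1\<close> provides.
\<close>

lemma from_residue:
  assumes p0: "p0 \<in> carrier (P 0)" "e p0 = x \<odot>\<^bsub>M\<^esub> u"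
    and f1: "\<And>i. f1 i \<in> mod_hom A (F (Suc i)) (P i)"
    and f10: "\<And>z. z \<in> carrier (F (Suc 0)) \<Longrightarrow> e (f1 0 z) = d 0 z 0 \<odot>\<^bsub>M\<^esub> u"
    and f1S: "\<And>i z. z \<in> carrier (F (Suc (Suc i))) \<Longrightarrow> dP i (f1 (Suc i) z) = \<ominus>\<^bsub>P i\<^esub> f1 i (d (Suc i) z)"
  obtains f where "\<And>i. f i \<in> mod_hom A (F i) (P i)"
    "\<And>z. f 0 z = z 0 \<odot>\<^bsub>P 0\<^esub> p0"
    "\<And>i z. z \<in> carrier (F (Suc i)) \<Longrightarrow> dP i (f (Suc i) z) = f i (d i z) \<ominus>\<^bsub>P i\<^esub> x \<odot>\<^bsub>P i\<^esub> f1 i z"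
proof -
  interpret M: module A M by (rule M)
  interpret P0: module A "P 0" by (rule P)
  let ?k = "\<lambda>z. z 0 \<odot>\<^bsub>P 0\<^esub> p0"
  have k: "?k \<in> mod_hom A (F 0) (P 0)"
    by (rule homI) (use p0 in \<open>auto simp: free_mod_apply_carrier P0.smult_l_distr P0.smult_assoc1\<close>)
  let ?t = "\<lambda>i. if i = 0 then (\<lambda>z. ?k (d 0 z) \<ominus>\<^bsub>P 0\<^esub> x \<odot>\<^bsub>P 0\<^esub> f1 0 z)
      else (\<lambda>z. \<ominus>\<^bsub>P i\<^esub> (x \<odot>\<^bsub>P i\<^esub> f1 i z))"
  have t: "?t i \<in> mod_hom A (F (Suc i)) (P i)" for i
    using hom_subtract[OF P hom_comp[OF d_hom k] hom_scale[OF P f1 xc]] hom_minus[OF P hom_scale[OF P f1 xc]]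
    by (cases i) auto
  obtain h where h: "\<And>i. h i \<in> mod_hom A (F (Suc i)) (P (Suc i))"
    "\<And>z. z \<in> carrier (F (Suc 0)) \<Longrightarrow> dP 0 (h 0 z) = ?k (d 0 z) \<ominus>\<^bsub>P 0\<^esub> x \<odot>\<^bsub>P 0\<^esub> f1 0 z"
    "\<And>i z. z \<in> carrier (F (Suc (Suc i))) \<Longrightarrow> dP (Suc i) (h (Suc i) z)
        = \<ominus>\<^bsub>P (Suc i)\<^esub> (x \<odot>\<^bsub>P (Suc i)\<^esub> f1 (Suc i) z) \<oplus>\<^bsub>P (Suc i)\<^esub> \<one> \<odot>\<^bsub>P (Suc i)\<^esub> h i (d (Suc i) z)"
  proof (rule chain_lift[OF projective_complex_shift[OF projective_F] acyclic_P, where e = "\<one>" and \<theta> = ?t])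
    show "?t i \<in> mod_hom A (F (Suc i)) (P i)" for i by (rule t)
    show "\<one> \<in> carrier A" by simp
    show "?t 0 z \<in> dP 0 ` carrier (P (Suc 0))" if z: "z \<in> carrier (F (Suc 0))" for z
    proof (rule exactP0)
      show "?t 0 z \<in> carrier (P 0)" by (rule hom_closed[OF t z])
      have a: "d 0 z 0 \<in> carrier A" by (rule free_mod_apply_carrier[OF d_closed[OF z]])
      have c: "?k (d 0 z) \<in> carrier (P 0)" "x \<odot>\<^bsub>P 0\<^esub> f1 0 z \<in> carrier (P 0)"
        using a p0 xc hom_closed[OF f1 z] by auto
      have "e (?t 0 z) = d 0 z 0 \<odot>\<^bsub>M\<^esub> (x \<odot>\<^bsub>M\<^esub> u) \<ominus>\<^bsub>M\<^esub> x \<odot>\<^bsub>M\<^esub> (d 0 z 0 \<odot>\<^bsub>M\<^esub> u)"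
        using hom_diff[OF P M e_hom c] hom_smult[OF e_hom a p0(1)] p0(2)
          hom_smult[OF e_hom xc hom_closed[OF f1 z]] f10[OF z] by simp
      also have "d 0 z 0 \<odot>\<^bsub>M\<^esub> (x \<odot>\<^bsub>M\<^esub> u) = x \<odot>\<^bsub>M\<^esub> (d 0 z 0 \<odot>\<^bsub>M\<^esub> u)"
        using a xc u m_comm[OF a xc] by (simp flip: M.smult_assoc1)
      finally show "e (?t 0 z) = \<zero>\<^bsub>M\<^esub>" using a xc u by (simp add: a_minus_def M.M.r_neg)
    qed
    show "dP i (?t (Suc i) z) \<oplus>\<^bsub>P i\<^esub> \<one> \<odot>\<^bsub>P i\<^esub> ?t i (d (Suc i) z) = \<zero>\<^bsub>P i\<^esub>"
      if z: "z \<in> carrier (F (Suc (Suc i)))" for i z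
    proof -
      interpret Pi: module A "P i" by (rule P)
      interpret Pi1: module A "P (Suc i)" by (rule P)
      have dz: "d (Suc i) z \<in> carrier (F (Suc i))" by (rule d_closed[OF z])
      have c: "f1 (Suc i) z \<in> carrier (P (Suc i))" "f1 i (d (Suc i) z) \<in> carrier (P i)"
        using hom_closed[OF f1] z dz by auto
      have xf: "x \<odot>\<^bsub>P i\<^esub> f1 i (d (Suc i) z) \<in> carrier (P i)" using c xc by simp
      have "dP i (?t (Suc i) z) = \<ominus>\<^bsub>P i\<^esub> (x \<odot>\<^bsub>P i\<^esub> dP i (f1 (Suc i) z))"
        using c xc hom_neg[OF P P dP_hom, of "x \<odot>\<^bsub>P (Suc i)\<^esub> f1 (Suc i) z" i] hom_smult[OF dP_hom xc c(1)] by simp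
      also have "\<dots> = x \<odot>\<^bsub>P i\<^esub> f1 i (d (Suc i) z)"
        unfolding f1S[OF z] using c xc xf by (simp add: Pi.smult_r_minus Pi.M.minus_minus)
      finally have 1: "dP i (?t (Suc i) z) = x \<odot>\<^bsub>P i\<^esub> f1 i (d (Suc i) z)" .
      have 2: "?t i (d (Suc i) z) = \<ominus>\<^bsub>P i\<^esub> (x \<odot>\<^bsub>P i\<^esub> f1 i (d (Suc i) z))"
      proof (cases i)
        case 0
        have "d 0 (d (Suc 0) z) 0 = \<zero>" using dd[of z 0] z 0 by simp
        then show ?thesis using 0 xf p0 by (simp add: a_minus_def)
      qed simp
      show ?thesis unfolding 1 2 using xf by (simp add: Pi.M.r_neg)
    qed
  qed (use that in auto)
  let ?f = "\<lambda>i. case i of 0 \<Rightarrow> ?k | Suc j \<Rightarrow> h j"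
  show ?thesis
  proof (rule that[of ?f])
    show "?f i \<in> mod_hom A (F i) (P i)" for i using k h(1) by (cases i) auto
    show "?f 0 z = z 0 \<odot>\<^bsub>P 0\<^esub> p0" for z by simp
    show "dP i (?f (Suc i) z) = ?f i (d i z) \<ominus>\<^bsub>P i\<^esub> x \<odot>\<^bsub>P i\<^esub> f1 i z"
      if z: "z \<in> carrier (F (Suc i))" for i z
    proof (cases i)
      case 0
      then show ?thesis using h(2) z by simp
    next
      case (Suc j)
      interpret Pj: module A "P (Suc j)" by (rule P)
      have "h j (d (Suc j) z) \<in> carrier (P (Suc j))" "x \<odot>\<^bsub>P (Suc j)\<^esub> f1 (Suc j) z \<in> carrier (P (Suc j))"
        using z xc hom_closed[OF f1, of z "Suc j"] by (auto simp: Suc intro: hom_closed[OF h(1)] d_closed)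
      then show ?thesis using h(3)[of z j] z by (simp add: Suc a_minus_def Pj.M.a_comm)
    qed
  qed
qed

text \<open>
The composite \<open>\<phi>\<close> of the two chain maps through the cone is multiplication by an element of \<open>1 + \<mm>\<close> in degree
\<open>0\<close>, so \<open>1 - \<phi>\<close> is null-homotopic. In degree \<open>j > n + 1\<close> both summands of the cone vanish, and \<open>1 = d h + h d\<close>
has entries in \<open>\<mm>\<close>.
\<close>

lemma resolution_stops:
  assumes fin: "\<And>i. i > n \<Longrightarrow> carrier (P i) = {\<zero>\<^bsub>P i\<^esub>}" and j: "j > Suc n"
  shows "S j = {}"
proof -
  have w: "x \<odot>\<^bsub>M\<^esub> u \<in> N" by (rule max_u[OF x])
  then obtain p0 where p0: "p0 \<in> carrier (P 0)" "e p0 = x \<odot>\<^bsub>M\<^esub> u" using e_image by (metis imageE)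
  obtain g where g: "\<And>i. g i \<in> mod_hom A (P i) (F i)"
    and gd: "\<And>i p. p \<in> carrier (P (Suc i)) \<Longrightarrow> d i (g (Suc i) p) = g i (dP i p)"
    and g0: "\<And>p. p \<in> carrier (P 0) \<Longrightarrow> e p = x \<odot>\<^bsub>M\<^esub> u \<Longrightarrow> \<one> \<ominus> g 0 p 0 \<in> \<mm>"
    by (rule to_residue) blast
  obtain k where k: "\<And>i. k i \<in> mod_hom A (P i) (F (Suc i))"
    and k0: "\<And>p. p \<in> carrier (P 0) \<Longrightarrow> d 0 (k 0 p) = x \<odot>\<^bsub>F 0\<^esub> g 0 p"
    and kS: "\<And>i p. p \<in> carrier (P (Suc i)) \<Longrightarrow> d (Suc i) (k (Suc i) p)
        = x \<odot>\<^bsub>F (Suc i)\<^esub> g (Suc i) p \<oplus>\<^bsub>F (Suc i)\<^esub> (\<ominus> \<one>) \<odot>\<^bsub>F (Suc i)\<^esub> k i (dP i p)"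
    by (rule to_residue_homotopy[OF g gd]) blast+
  obtain f1 where f1: "\<And>i. f1 i \<in> mod_hom A (F (Suc i)) (P i)"
    and f10: "\<And>z. z \<in> carrier (F (Suc 0)) \<Longrightarrow> e (f1 0 z) = d 0 z 0 \<odot>\<^bsub>M\<^esub> u"
    and f1S: "\<And>i z. z \<in> carrier (F (Suc (Suc i))) \<Longrightarrow> dP i (f1 (Suc i) z) = \<ominus>\<^bsub>P i\<^esub> f1 i (d (Suc i) z)"
    by (rule from_syzygy) blast
  obtain f where f: "\<And>i. f i \<in> mod_hom A (F i) (P i)"
    and f0: "\<And>z. f 0 z = z 0 \<odot>\<^bsub>P 0\<^esub> p0"
    and fS: "\<And>i z. z \<in> carrier (F (Suc i)) \<Longrightarrow> dP i (f (Suc i) z) = f i (d i z) \<ominus>\<^bsub>P i\<^esub> x \<odot>\<^bsub>P i\<^esub> f1 i z"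
    by (rule from_residue[OF p0 f1 f10 f1S]) blast+
  define \<phi> where "\<phi> i = (case i of 0 \<Rightarrow> (\<lambda>z. g 0 (f 0 z))
      | Suc i' \<Rightarrow> (\<lambda>z. g (Suc i') (f (Suc i') z) \<oplus>\<^bsub>F (Suc i')\<^esub> k i' (f1 i' z)))" for i
  have phi0: "\<phi> 0 = (\<lambda>z. g 0 (f 0 z))" by (simp add: \<phi>_def)
  have phiS: "\<phi> (Suc i) = (\<lambda>z. g (Suc i) (f (Suc i) z) \<oplus>\<^bsub>F (Suc i)\<^esub> k i (f1 i z))" for i
    by (simp add: \<phi>_def)
  have phi: "\<phi> i \<in> mod_hom A (F i) (F i)" for i
  proof (cases i)
    case 0
    then show ?thesis using hom_comp[OF f g] by (simp add: phi0)
  next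
    case (Suc i')
    have "\<phi> (Suc i') \<in> mod_hom A (F (Suc i')) (F (Suc i'))" unfolding phiS
      by (rule hom_sum[OF module_free hom_comp[OF f g] hom_comp[OF f1 k]])
    then show ?thesis using Suc by simp
  qed
  have phid: "d i (\<phi> (Suc i) z) = \<phi> i (d i z)" if z: "z \<in> carrier (F (Suc i))" for i z
  proof -
    interpret Fi: module A "F i" by (rule module_free)
    interpret Pi: module A "P i" by (rule P)
    note dz = d_closed[OF z]
    have fz: "f (Suc i) z \<in> carrier (P (Suc i))" "f1 i z \<in> carrier (P i)" "f i (d i z) \<in> carrier (P i)"
      by (rule hom_closed[OF f z] hom_closed[OF f1 z] hom_closed[OF f dz])+
    have xf: "x \<odot>\<^bsub>P i\<^esub> f1 i z \<in> carrier (P i)" by (rule Pi.smult_closed[OF xc fz(2)])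
    let ?a = "g i (f i (d i z))" and ?b = "x \<odot>\<^bsub>F i\<^esub> g i (f1 i z)"
    have ac: "?a \<in> carrier (F i)" by (rule hom_closed[OF g fz(3)])
    have bc: "?b \<in> carrier (F i)" by (rule Fi.smult_closed[OF xc hom_closed[OF g fz(2)]])
    have "d i (\<phi> (Suc i) z) = d i (g (Suc i) (f (Suc i) z)) \<oplus>\<^bsub>F i\<^esub> d i (k i (f1 i z))"
      unfolding phiS by (rule hom_add[OF d_hom hom_closed[OF g fz(1)] hom_closed[OF k fz(2)]])
    also have "d i (g (Suc i) (f (Suc i) z)) = ?a \<ominus>\<^bsub>F i\<^esub> ?b"
      unfolding gd[OF fz(1)] fS[OF z] hom_diff[OF P module_free g fz(3) xf] hom_smult[OF g xc fz(2)] ..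
    finally have eq: "d i (\<phi> (Suc i) z) = (?a \<ominus>\<^bsub>F i\<^esub> ?b) \<oplus>\<^bsub>F i\<^esub> d i (k i (f1 i z))" .
    show ?thesis
    proof (cases i)
      case 0
      have "d i (k i (f1 i z)) = ?b" using k0 fz(2) 0 by simp
      then have "d i (\<phi> (Suc i) z) = ?a"
        unfolding eq a_minus_def using ac bc
        by (simp add: Fi.M.a_assoc Fi.M.l_neg del: free_mod_sel)
      then show ?thesis using 0 by (simp add: phi0)
    next
      case (Suc i')
      have z': "z \<in> carrier (F (Suc (Suc i')))" using z Suc by simp
      have fz': "f1 (Suc i') z \<in> carrier (P (Suc i'))" using fz(2) Suc by simp
      have tc: "f1 i' (d (Suc i') z) \<in> carrier (P i')" by (rule hom_closed[OF f1 d_closed[OF z']])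
      let ?y = "k i' (f1 i' (d (Suc i') z))"
      have yc: "?y \<in> carrier (F i)" unfolding Suc by (rule hom_closed[OF k tc])
      have "d i (k i (f1 i z)) = ?b \<oplus>\<^bsub>F i\<^esub> (\<ominus> \<one>) \<odot>\<^bsub>F i\<^esub> k i' (dP i' (f1 (Suc i') z))"
        using kS[OF fz'] by (simp only: Suc)
      also have "k i' (dP i' (f1 (Suc i') z)) = \<ominus>\<^bsub>F i\<^esub> ?y"
        unfolding f1S[OF z'] Suc by (rule hom_neg[OF P module_free k tc])
      also have "(\<ominus> \<one>) \<odot>\<^bsub>F i\<^esub> (\<ominus>\<^bsub>F i\<^esub> ?y) = ?y"
        using Fi.smult_l_minus[of \<one> "\<ominus>\<^bsub>F i\<^esub> ?y"] Fi.smult_one[of "\<ominus>\<^bsub>F i\<^esub> ?y"]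
          Fi.M.minus_minus[OF yc] Fi.M.a_inv_closed[OF yc] by (simp del: free_mod_sel)
      finally have "d i (\<phi> (Suc i) z) = ?a \<oplus>\<^bsub>F i\<^esub> ?y"
        unfolding eq a_minus_def using ac bc yc
        by (simp add: Fi.M.a_assoc Fi.M.r_neg1 del: free_mod_sel)
      then show ?thesis by (simp only: Suc phiS)
    qed
  qed
  obtain h where h: "\<And>i. h i \<in> mod_hom A (F i) (F (Suc i))"
    and hS: "\<And>i z. z \<in> carrier (F (Suc i)) \<Longrightarrow> d (Suc i) (h (Suc i) z)
        = (z \<ominus>\<^bsub>F (Suc i)\<^esub> \<phi> (Suc i) z) \<oplus>\<^bsub>F (Suc i)\<^esub> (\<ominus> \<one>) \<odot>\<^bsub>F (Suc i)\<^esub> h i (d i z)"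
  proof (rule chain_lift[OF projective_F acyclic_F, where e = "\<ominus> \<one>" and \<theta> = "\<lambda>i z. z \<ominus>\<^bsub>F i\<^esub> \<phi> i z"])
    show "(\<lambda>z. z \<ominus>\<^bsub>F i\<^esub> \<phi> i z) \<in> mod_hom A (F i) (F i)" for i
      by (rule hom_subtract[OF module_free hom_ident phi])
    show "\<ominus> \<one> \<in> carrier A" by simp
    show "z \<ominus>\<^bsub>F 0\<^esub> \<phi> 0 z \<in> d 0 ` carrier (F (Suc 0))" if z: "z \<in> carrier (F 0)" for z
    proof (rule F0_mem_image)
      interpret F0: module A "F 0" by (rule module_free)
      note pz = hom_closed[OF phi z]
      show "z \<ominus>\<^bsub>F 0\<^esub> \<phi> 0 z \<in> carrier (F 0)" by (rule F0.M.minus_closed[OF z pz])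
      have zc: "z 0 \<in> carrier A" by (rule free_mod_apply_carrier[OF z])
      have gc: "g 0 p0 0 \<in> carrier A" by (rule free_mod_apply_carrier[OF hom_closed[OF g p0(1)]])
      have "\<phi> 0 z 0 = z 0 \<otimes> g 0 p0 0"
        unfolding phi0 f0 using hom_smult[OF g zc p0(1)] by simp
      then have "(z \<ominus>\<^bsub>F 0\<^esub> \<phi> 0 z) 0 = z 0 \<otimes> (\<one> \<ominus> g 0 p0 0)"
        using free_mod_minus[OF z pz] zc gc by simp algebra
      then show "(z \<ominus>\<^bsub>F 0\<^esub> \<phi> 0 z) 0 \<in> \<mm>"
        using ideal_lmult[OF ideal_max zc g0[OF p0]] by simp
    qed
    show "d i (z \<ominus>\<^bsub>F (Suc i)\<^esub> \<phi> (Suc i) z) \<oplus>\<^bsub>F i\<^esub> (\<ominus> \<one>) \<odot>\<^bsub>F i\<^esub> (d i z \<ominus>\<^bsub>F i\<^esub> \<phi> i (d i z)) = \<zero>\<^bsub>F i\<^esub>"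
      if z: "z \<in> carrier (F (Suc i))" for i z
    proof -
      interpret Fi: module A "F i" by (rule module_free)
      have c: "d i z \<ominus>\<^bsub>F i\<^esub> \<phi> i (d i z) \<in> carrier (F i)"
        by (rule Fi.M.minus_closed[OF d_closed[OF z] hom_closed[OF phi d_closed[OF z]]])
      have "d i (z \<ominus>\<^bsub>F (Suc i)\<^esub> \<phi> (Suc i) z) = d i z \<ominus>\<^bsub>F i\<^esub> \<phi> i (d i z)"
        using hom_diff[OF module_free module_free d_hom z hom_closed[OF phi z]] phid[OF z] by simp
      then show ?thesis
        using Fi.smult_l_minus[OF one_closed c] Fi.smult_one[OF c] Fi.M.r_neg[OF c]
        by (simp del: free_mod_sel)
    qed
  qed (use that in blast)
  show "S j = {}"
  proof (rule ccontr)
    assume "S j \<noteq> {}"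
    then obtain l where l: "l \<in> S j" by blast
    obtain i where i: "j = Suc i" "i > n" using j by (cases j) auto
    interpret Fj: module A "F (Suc i)" by (rule module_free)
    let ?z = "delta A l"
    have z: "?z \<in> carrier (F (Suc i))" using delta_carrier[OF l] i by simp
    have "f (Suc i) ?z = \<zero>\<^bsub>P (Suc i)\<^esub>" "f1 i ?z = \<zero>\<^bsub>P i\<^esub>"
      using hom_closed[OF f z] hom_closed[OF f1 z] fin[of "Suc i"] fin[of i] i by auto
    then have phz: "\<phi> (Suc i) ?z = \<zero>\<^bsub>F (Suc i)\<^esub>"
      unfolding phiS using hom_zero[OF P module_free g] hom_zero[OF P module_free k] by simp
    have dz: "d i ?z \<in> carrier (F i)" by (rule d_closed[OF z])
    have hz: "h (Suc i) ?z \<in> carrier (F (Suc (Suc i)))" by (rule hom_closed[OF h z])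
    have 1: "d (Suc i) (h (Suc i) ?z) l \<in> \<mm>" by (rule d_max[OF hz])
    have 2: "h i (d i ?z) l \<in> \<mm>" by (rule hom_coord_ideal[OF ideal_max h dz d_max[OF z]])
    have "d (Suc i) (h (Suc i) ?z) l = \<one> \<oplus> (\<ominus> \<one>) \<otimes> h i (d i ?z) l"
      using fun_cong[OF hS[OF z, unfolded phz free_mod_minus[OF z Fj.zero_closed]], of l]
      by (simp add: delta_def a_minus_def)
    then have "\<one> = d (Suc i) (h (Suc i) ?z) l \<oplus> h i (d i ?z) l"
      using max_carr[OF 2] by (simp add: l_minus a_assoc l_neg)
    then have "\<one> \<in> \<mm>" using ideal_add[OF ideal_max 1 2] by simp
    then show False using one_not_max by simp
  qed
qed

end

section \<open>Regularity of the ring\<close>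

theorem theorem3p1:
  fixes A :: "('a, 'r) ring_scheme" and \<mm> :: "'a set"
    and M :: "('a, 'b, 'm) module_scheme" and N L :: "'b set"
  assumes "noetherian_local_ring A \<mm>"
    and "fin_gen_module A M"
    and "depth A \<mm> M > 0"
    and "submodule N A M" and "submodule L A M"
    and "N \<subseteq> L" and "L \<subseteq> colon M N \<mm>"
    and "ideal_smult A M \<mm> N \<noteq> ideal_smult A M \<mm> L"
    and "proj_dim A (M\<lparr>carrier := N\<rparr>) < \<infinity>"
  shows "regular_local_ring A \<mm>"
proof -
  interpret noetherian_local_ring A \<mm> by fact
  have M: "module A M" using assms(2) by (simp add: fin_gen_module_def)
  interpret M: module A M by (rule M)
  note N = \<open>submodule N A M\<close> and L = \<open>submodule L A M\<close>
  have LM: "L \<subseteq> carrier M" by (rule M.submoduleE(1)[OF L])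
  have NM: "N \<subseteq> carrier M" by (rule M.submoduleE(1)[OF N])
  have mLsub: "{a \<odot>\<^bsub>M\<^esub> v | a v. a \<in> \<mm> \<and> v \<in> L} \<subseteq> carrier M" using LM max_carr by auto
  have mNsub: "{a \<odot>\<^bsub>M\<^esub> v | a v. a \<in> \<mm> \<and> v \<in> N} \<subseteq> carrier M" using NM max_carr by auto
  have "ideal_smult A M \<mm> N \<subseteq> ideal_smult A M \<mm> L"
    unfolding ideal_smult_def
    by (rule M.gen_submodule_minimal[OF M.submodule_gen[OF mLsub] subset_trans[OF _ M.gen_submodule_superset]])
      (use \<open>N \<subseteq> L\<close> in blast)
  then have "\<not> ideal_smult A M \<mm> L \<subseteq> ideal_smult A M \<mm> N" using assms(8) by blast
  then have "\<not> {a \<odot>\<^bsub>M\<^esub> v | a v. a \<in> \<mm> \<and> v \<in> L} \<subseteq> ideal_smult A M \<mm> N"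
    unfolding ideal_smult_def using M.gen_submodule_minimal[OF M.submodule_gen[OF mNsub]] by blast
  then obtain x u where x: "x \<in> \<mm>" and u: "u \<in> L" and xu: "x \<odot>\<^bsub>M\<^esub> u \<notin> ideal_smult A M \<mm> N" by blast
  have max_u: "a \<odot>\<^bsub>M\<^esub> u \<in> N" if "a \<in> \<mm>" for a
    using u \<open>L \<subseteq> colon M N \<mm>\<close> that by (auto simp: colon_def)
  have "{enat n | n. \<exists>(P :: nat \<Rightarrow> ('a, ('a, 'b) res_carrier) module) d e.
       projective_resolution A (M\<lparr>carrier := N\<rparr>) P d e \<and> (\<forall>i>n. carrier (P i) = {\<zero>\<^bsub>P i\<^esub>})} \<noteq> {}"
    (is "?D \<noteq> {}")
  proof
    assume "?D = {}"
    then have "proj_dim A (M\<lparr>carrier := N\<rparr>) = Inf {}"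
      unfolding proj_dim_def by (rule arg_cong)
    then have "proj_dim A (M\<lparr>carrier := N\<rparr>) = \<infinity>" by (simp add: top_enat_def)
    then show False using assms(9) by simp
  qed
  then obtain n and P :: "nat \<Rightarrow> ('a, ('a, 'b) res_carrier) module" and dP e
    where res: "projective_resolution A (M\<lparr>carrier := N\<rparr>) P dP e"
      and fin: "\<forall>i>n. carrier (P i) = {\<zero>\<^bsub>P i\<^esub>}" by blast
  note res = res[unfolded projective_resolution_def mod_ker_def, simplified]
  have "\<forall>i. \<exists>c. dual_basis A (P i) (carrier (P i)) (\<lambda>p. p) c"
    using dual_basis_projective res by blast
  then obtain c where c: "\<And>i. dual_basis A (P i) (carrier (P i)) (\<lambda>p. p) (c i)" by metis
  obtain S d where S: "minimal_resolution A \<mm> S d" by (rule minimal_resolution_exists)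
  interpret minimal_resolution A \<mm> S d by (rule S)
  interpret covered_minimal_generator A \<mm> S d M N P dP e c x u
  proof (intro covered_minimal_generator.intro[OF S] covered_minimal_generator_axioms.intro)
    show "module A (P i)" for i using res by (simp add: projective_module_def)
    show "e \<in> mod_hom A (P 0) M" using res NM by (auto simp: mod_hom_def)
    show "u \<in> carrier M" using u LM by blast
  qed (use res c M N x max_u xu in auto)
  show ?thesis
  proof (rule regular_of_finite_resolution[OF assms(1)])
    fix i assume "i > Suc n"
    then show "S i = {}" using fin by (intro resolution_stops[of n]) auto
  qed
qed

end
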